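(* Let $\Omega\subset\mathbb{R}^n$ be a bounded nonempty open set. For $j=1,2$, let $\psi_j:\Omega\to[-\infty,\infty)$ be bounded from above and $f_j\in W^{1,p(\cdot)}(\Omega)$ be bounded and such that $\mathcal{K}_{\psi_j,f_j}\ne\varnothing$, and let $u_j$ be a solution of the $\mathcal{K}_{\psi_j,f_j}$-obstacle problem. If $\psi_1\le\psi_2$ a.e. in $\Omega$ and $(f_1-f_2)_+\in W^{1,p(\cdot)}_0(\Omega)$, then $u_1\le u_2$ a.e. in $\Omega$. Moreover, the lsc-regularizations satisfy $u_1^*\le u_2^*$ everywhere in $\Omega$.
   Context: Standing assumptions: $p:\mathbb{R}^n\to[1,\infty]$ is measurable, $1<p^-:=\operatorname{ess\,inf}_{\mathbb{R}^n}p\le p^+:=\operatorname{ess\,sup}_{\mathbb{R}^n}p<\infty$, and $p$ is log-H\"older continuous: there is $L>0$ with $|p(x)-p(y)|\le L/\log(e+1/|x-y|)$ for all $x,y\in\mathbb{R}^n$. Here $g_+=\max\{g,0\}$. For an open set $\Omega$, $L^{p(\cdot)}(\Omega)$ is the space of measurable $u:\Omega\to\mathbb{R}$ with finite norm $\|u\|_{L^{p(\cdot)}(\Omega)}=\inf\{\lambda>0:\int_\Omega|u(x)/\lambda|^{p(x)}\,dx\le1\}$; $W^{1,p(\cdot)}(\Omega)$ consists of $u\in L^{p(\cdot)}(\Omega)$ with distributional gradient $\nabla u\in L^{p(\cdot)}(\Omega)$, with norm $\|u\|_{L^{p(\cdot)}(\Omega)}+\|\nabla u\|_{L^{p(\cdot)}(\Omega)}$.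 $W^{1,p(\cdot)}_0(\Omega)$ is the closure in $W^{1,p(\cdot)}(\Omega)$ of the $W^{1,p(\cdot)}(\mathbb{R}^n)$-functions with compact support in $\Omega$. For $f\in W^{1,p(\cdot)}(\Omega)$ and $\psi:\Omega\to[-\infty,\infty]$ let $\mathcal{K}_{\psi,f}=\{v\in W^{1,p(\cdot)}(\Omega):v-f\in W^{1,p(\cdot)}_0(\Omega)\text{ and }v\ge\psi\text{ a.e. in }\Omega\}$. A function $u\in\mathcal{K}_{\psi,f}$ is a solution of the $\mathcal{K}_{\psi,f}$-obstacle problem if $\int_\Omega|\nabla u|^{p(x)}\,dx\le\int_\Omega|\nabla v|^{p(x)}\,dx$ for all $v\in\mathcal{K}_{\psi,f}$. The lsc-regularization of $u$ is $u^*(x)=\operatorname{ess\,lim\,inf}_{y\to x}u(y)$, $x\in\Omega$. *)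

theory Defs
  imports "HOL-Analysis.Analysis" "HOL-Probability.Essential_Supremum"
begin

text \<open>
  Functions on \<open>\<Omega>\<close> are total functions of which only the values on \<open>\<Omega>\<close> matter;
  measurability, integrals and "almost everywhere" refer to \<open>lebesgue_on \<Omega>\<close>.
\<close>

text \<open>The counterpart of the library's \<open>esssup\<close>, which on measurable functions is
  \<open>Limsup (ae_filter M)\<close>.\<close>

definition essinf :: "'a measure \<Rightarrow> ('a \<Rightarrow> ereal) \<Rightarrow> ereal" where
  "essinf M f = Liminf (ae_filter M) f"

text \<open>
  The exponent is real-valued: the log-Hoelder estimate for all \<open>x, y\<close> together with
  \<open>esssup p < \<infinity>\<close> rules out the value \<open>\<infinity>\<close>. For \<open>x = y\<close> the estimate
  only says \<open>0 \<le> L\<close> (with \<open>1 / 0 = 0\<close>).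
\<close>

definition log_hoelder_exponent :: "('a::euclidean_space \<Rightarrow> real) \<Rightarrow> bool" where
  "log_hoelder_exponent p \<longleftrightarrow>
     p \<in> borel_measurable lebesgue \<and> (\<forall>x. 1 \<le> p x) \<and>
     1 < essinf lebesgue (\<lambda>x. ereal (p x)) \<and>
     esssup lebesgue (\<lambda>x. ereal (p x)) < \<infinity> \<and>
     (\<exists>L>0. \<forall>x y. \<bar>p x - p y\<bar> \<le> L / ln (exp 1 + 1 / dist x y))"

definition modular ::
    "('a::euclidean_space \<Rightarrow> real) \<Rightarrow> 'a set \<Rightarrow> ('a \<Rightarrow> 'b::real_normed_vector) \<Rightarrow> ennreal" where
  "modular p \<Omega> u = (\<integral>\<^sup>+ x. ennreal (norm (u x) powr p x) \<partial>lebesgue_on \<Omega>)"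

text \<open>The infimum over the empty set is \<open>\<infinity>\<close> in \<open>ennreal\<close>.\<close>

definition lux_norm ::
    "('a::euclidean_space \<Rightarrow> real) \<Rightarrow> 'a set \<Rightarrow> ('a \<Rightarrow> 'b::real_normed_vector) \<Rightarrow> ennreal" where
  "lux_norm p \<Omega> u = (INF l\<in>{l::real. 0 < l \<and> modular p \<Omega> (\<lambda>x. u x /\<^sub>R l) \<le> 1}. ennreal l)"

definition Lp_var ::
    "('a::euclidean_space \<Rightarrow> real) \<Rightarrow> 'a set \<Rightarrow> ('a \<Rightarrow> 'b::real_normed_vector) set" where
  "Lp_var p \<Omega> = {u. u \<in> borel_measurable (lebesgue_on \<Omega>) \<and> lux_norm p \<Omega> u < \<infinity>}"

text \<open>Class \<open>C\<^sup>k\<close> on the whole space.\<close>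

primrec Ck :: "nat \<Rightarrow> ('a::euclidean_space \<Rightarrow> real) \<Rightarrow> bool" where
  "Ck 0 f \<longleftrightarrow> continuous_on UNIV f"
| "Ck (Suc k) f \<longleftrightarrow> (\<forall>x. f differentiable (at x)) \<and>
     (\<forall>i\<in>Basis. Ck k (\<lambda>x. frechet_derivative f (at x) i))"

definition test_function :: "'a::euclidean_space set \<Rightarrow> ('a \<Rightarrow> real) \<Rightarrow> bool" where
  "test_function \<Omega> \<phi> \<longleftrightarrow> (\<forall>k. Ck k \<phi>) \<and>
     (\<exists>K. compact K \<and> K \<subseteq> \<Omega> \<and> (\<forall>x. x \<notin> K \<longrightarrow> \<phi> x = 0))"

definition locally_integrable ::
    "'a::euclidean_space set \<Rightarrow> ('a \<Rightarrow> 'b::euclidean_space) \<Rightarrow> bool" where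
  "locally_integrable \<Omega> u \<longleftrightarrow>
     (\<forall>K. compact K \<longrightarrow> K \<subseteq> \<Omega> \<longrightarrow> integrable (lebesgue_on K) u)"

definition distributional_gradient ::
    "'a::euclidean_space set \<Rightarrow> ('a \<Rightarrow> real) \<Rightarrow> ('a \<Rightarrow> 'a) \<Rightarrow> bool" where
  "distributional_gradient \<Omega> u g \<longleftrightarrow>
     locally_integrable \<Omega> u \<and> locally_integrable \<Omega> g \<and>
     (\<forall>\<phi>. test_function \<Omega> \<phi> \<longrightarrow> (\<forall>i\<in>Basis.
        (\<integral>x. u x * frechet_derivative \<phi> (at x) i \<partial>lebesgue_on \<Omega>) =
        - (\<integral>x. (g x \<bullet> i) * \<phi> x \<partial>lebesgue_on \<Omega>)))"

text \<open>A representative of the distributional gradient, which is unique up to null sets;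
  it is only meaningful if a distributional gradient exists.\<close>

definition grad :: "'a::euclidean_space set \<Rightarrow> ('a \<Rightarrow> real) \<Rightarrow> 'a \<Rightarrow> 'a" where
  "grad \<Omega> u = (SOME g. distributional_gradient \<Omega> u g)"

definition W1p :: "('a::euclidean_space \<Rightarrow> real) \<Rightarrow> 'a set \<Rightarrow> ('a \<Rightarrow> real) set" where
  "W1p p \<Omega> = {u \<in> Lp_var p \<Omega>. \<exists>g \<in> Lp_var p \<Omega>. distributional_gradient \<Omega> u g}"

definition W1p_norm :: "('a::euclidean_space \<Rightarrow> real) \<Rightarrow> 'a set \<Rightarrow> ('a \<Rightarrow> real) \<Rightarrow> ennreal" where
  "W1p_norm p \<Omega> u = lux_norm p \<Omega> u + lux_norm p \<Omega> (grad \<Omega> u)"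

text \<open>Sobolev functions are determined up to null sets, so compact support in \<open>\<Omega>\<close>
  means vanishing almost everywhere outside a compact subset of \<open>\<Omega>\<close>.\<close>

definition W1p_compact_support ::
    "('a::euclidean_space \<Rightarrow> real) \<Rightarrow> 'a set \<Rightarrow> ('a \<Rightarrow> real) set" where
  "W1p_compact_support p \<Omega> = {w \<in> W1p p UNIV.
     \<exists>K. compact K \<and> K \<subseteq> \<Omega> \<and> (AE x in lebesgue. x \<notin> K \<longrightarrow> w x = 0)}"

definition W1p_0 :: "('a::euclidean_space \<Rightarrow> real) \<Rightarrow> 'a set \<Rightarrow> ('a \<Rightarrow> real) set" where
  "W1p_0 p \<Omega> = {u \<in> W1p p \<Omega>. \<forall>\<epsilon>::real. \<epsilon> > 0 \<longrightarrow>
     (\<exists>w \<in> W1p_compact_support p \<Omega>. W1p_norm p \<Omega> (\<lambda>x. u x - w x) < ennreal \<epsilon>)}"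

definition obstacle_class ::
    "('a::euclidean_space \<Rightarrow> real) \<Rightarrow> 'a set \<Rightarrow> ('a \<Rightarrow> ereal) \<Rightarrow> ('a \<Rightarrow> real) \<Rightarrow> ('a \<Rightarrow> real) set" where
  "obstacle_class p \<Omega> \<psi> f = {v \<in> W1p p \<Omega>.
     (\<lambda>x. v x - f x) \<in> W1p_0 p \<Omega> \<and> (AE x in lebesgue_on \<Omega>. \<psi> x \<le> ereal (v x))}"

definition obstacle_solution ::
    "('a::euclidean_space \<Rightarrow> real) \<Rightarrow> 'a set \<Rightarrow> ('a \<Rightarrow> ereal) \<Rightarrow> ('a \<Rightarrow> real) \<Rightarrow> ('a \<Rightarrow> real) \<Rightarrow> bool" where
  "obstacle_solution p \<Omega> \<psi> f u \<longleftrightarrow> u \<in> obstacle_class p \<Omega> \<psi> f \<and>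
     (\<forall>v \<in> obstacle_class p \<Omega> \<psi> f. modular p \<Omega> (grad \<Omega> u) \<le> modular p \<Omega> (grad \<Omega> v))"

text \<open>The essential lower limit is the limit as \<open>r \<rightarrow> 0\<close>, i.e. the supremum over
  \<open>r > 0\<close>, of the essential infima over the balls of radius \<open>r\<close> around \<open>x\<close>.\<close>

definition lsc_reg :: "'a::euclidean_space set \<Rightarrow> ('a \<Rightarrow> real) \<Rightarrow> 'a \<Rightarrow> ereal" where
  "lsc_reg \<Omega> u x = (SUP r\<in>{0<..}. essinf (lebesgue_on (ball x r \<inter> \<Omega>)) (\<lambda>y. ereal (u y)))"

end

theory Submission
  imports Defs
begin

text \<open>
  Let \<open>a = (u\<^sub>1 - u\<^sub>2)\<^sub>+\<close>. Since \<open>u\<^sub>1 - u\<^sub>2\<close> lies below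
  \<open>(u\<^sub>1 - f\<^sub>1) - (u\<^sub>2 - f\<^sub>2) + (f\<^sub>1 - f\<^sub>2)\<^sub>+\<close>, which has zero boundary values, so does \<open>a\<close>.
  Hence \<open>u\<^sub>1 - a/2\<close> and \<open>u\<^sub>2 + a/2\<close> compete in the two obstacle problems; on \<open>{u\<^sub>1 > u\<^sub>2}\<close> both have
  the gradient \<open>(\<nabla>u\<^sub>1 + \<nabla>u\<^sub>2)/2\<close>, and adding the two minimality inequalities contradicts
  the strict convexity of \<open>\<bar>\<xi>\<bar>\<^bsup>p(x)\<^esup>\<close> unless \<open>\<nabla>a = 0\<close> almost everywhere. Testing
  \<open>\<nabla>a = 0\<close> with a function that is strictly monotone in one direction on the
  bounded set \<open>\<Omega>\<close> gives \<open>a = 0\<close>.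

  The chain rule for the positive part is obtained without mollification: a weak derivative \<open>G\<close>
  of \<open>U\<close> is the \<open>L\<^sup>1\<close>-limit of the difference quotients of \<open>U\<close>, because these are averages of
  translates of \<open>G\<close>. The quotients of \<open>U\<^sub>+\<close> for positive and for negative steps converge to functions
  which differ only on \<open>{U = 0}\<close>, and by uniqueness of weak derivatives \<open>G\<close> vanishes there.
\<close>

section \<open>Smooth functions and bumps\<close>

text \<open>That the positive part has zero boundary values is a truncation argument, and the
  gradients are its obstacle. If \<open>w\<close> runs through approximations of an upper bound
  \<open>h\<close> of \<open>v\<close>, the positive part of min(v, w) has compact support along
  with \<open>w\<close>, but the sets {w < v}, on which its gradient follows \<open>w\<close>, need
  not become null. They shrink to {v = h}, and there the gradients of \<open>v\<close> and
  \<open>h\<close> agree almost everywhere: the vanishing of a weak gradient on a zero set is used a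
  second time.

  The factor 1/2 makes the gradients of the two competitors coincide, so one pointwise midpoint
  inequality meets both minimality conditions at once.

  The final test function is not supported in \<Omega>. It is admissible because functions with zero
  boundary values are limits of functions on the whole space that vanish outside compact subsets of
  \<Omega>.

  Limits are taken in the modular: for a bounded exponent it has the same null sequences as the
  norm, and it is open to pointwise estimates and dominated convergence.\<close>

definition smooth :: "('a::euclidean_space \<Rightarrow> real) \<Rightarrow> bool" where
  "smooth f \<longleftrightarrow> (\<forall>k. Ck k f)"

abbreviation partial :: "'a::euclidean_space \<Rightarrow> ('a \<Rightarrow> real) \<Rightarrow> 'a \<Rightarrow> real" where
  "partial i f x \<equiv> frechet_derivative f (at x) i"

lemma partial_eq: "(f has_derivative f') (at x) \<Longrightarrow> partial i f x = f' i"
  by (drule frechet_derivative_at) simp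

lemma Ck_SucI:
  assumes "\<And>x. (f has_derivative f' x) (at x)" "\<And>i. i \<in> Basis \<Longrightarrow> Ck k (\<lambda>x. f' x i)"
  shows "Ck (Suc k) f"
proof -
  have "frechet_derivative f (at x) = f' x" for x
    using frechet_derivative_at[OF assms(1)] by simp
  then show ?thesis using assms by (auto simp: differentiable_def)
qed

lemma Ck_Suc_imp_Ck: "Ck (Suc k) f \<Longrightarrow> Ck k f"
proof (induction k arbitrary: f)
  case 0
  then have "\<And>x. isCont f x"
    by (auto intro: differentiable_imp_continuous_within)
  then show ?case by (simp add: continuous_at_imp_continuous_on)
next
  case (Suc k)
  from Suc.prems have "\<forall>x. f differentiable (at x)" "\<And>i. i \<in> Basis \<Longrightarrow> Ck (Suc k) (partial i f)"
    by (subst (asm) Ck.simps(2), blast)+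
  with Suc.IH show ?case by (subst Ck.simps(2)) blast
qed

lemma smooth_imp_has_derivative:
  "smooth f \<Longrightarrow> (f has_derivative frechet_derivative f (at x)) (at x)"
  unfolding smooth_def frechet_derivative_works[symmetric] by (drule spec[of _ "Suc 0"]) simp

lemma smooth_continuous_on: "smooth f \<Longrightarrow> continuous_on T f"
  unfolding smooth_def by (drule spec[of _ 0]) (auto intro: continuous_on_subset)

lemma smooth_partial: "smooth f \<Longrightarrow> i \<in> Basis \<Longrightarrow> smooth (partial i f)"
  unfolding smooth_def by (rule allI, drule_tac x = "Suc k" in spec) simp

lemma smoothI:
  assumes "\<And>x. (f has_derivative f' x) (at x)" "\<And>i. i \<in> Basis \<Longrightarrow> smooth (\<lambda>x. f' x i)"
  shows "smooth f"
  unfolding smooth_def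
proof
  fix k
  have "Ck (Suc k) f" using assms by (intro Ck_SucI) (auto simp: smooth_def)
  then show "Ck k f" by (rule Ck_Suc_imp_Ck)
qed

lemma Ck_const: "Ck k (\<lambda>x. c)"
proof (induction k arbitrary: c)
  case (Suc k)
  then show ?case by (intro Ck_SucI[where f' = "\<lambda>x h. 0"]) auto
qed simp

lemma Ck_add: "Ck k f \<Longrightarrow> Ck k g \<Longrightarrow> Ck k (\<lambda>x. f x + g x)"
proof (induction k arbitrary: f g)
  case 0 then show ?case by (auto intro: continuous_intros)
next
  case (Suc k)
  then show ?case
    by (intro Ck_SucI[where f' = "\<lambda>x h. frechet_derivative f (at x) h + frechet_derivative g (at x) h"])
      (auto intro!: has_derivative_add simp: frechet_derivative_works[symmetric])
qed

lemma Ck_mult: "Ck k f \<Longrightarrow> Ck k g \<Longrightarrow> Ck k (\<lambda>x. f x * g x)"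
proof (induction k arbitrary: f g)
  case 0 then show ?case by (auto intro: continuous_intros)
next
  case (Suc k)
  have "Ck k f" "Ck k g" using Suc.prems Ck_Suc_imp_Ck by blast+
  with Suc show ?case
    by (intro Ck_SucI[where f' = "\<lambda>x h. f x * frechet_derivative g (at x) h + frechet_derivative f (at x) h * g x"])
      (auto intro!: has_derivative_mult Ck_add simp: frechet_derivative_works[symmetric])
qed

lemma Ck_compose:
  fixes f :: "real \<Rightarrow> real" and g :: "'a::euclidean_space \<Rightarrow> real"
  shows "Ck k f \<Longrightarrow> Ck k g \<Longrightarrow> Ck k (\<lambda>x. f (g x))"
proof (induction k arbitrary: f)
  case 0
  then show ?case by (auto intro: continuous_on_compose2)
next
  case (Suc k)
  have k: "Ck k g" using Suc.prems Ck_Suc_imp_Ck by blast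
  \<comment> \<open>In dimension one a derivative is determined by its value in direction 1, so the
    chain rule becomes a product of two scalar functions and \<open>Ck_mult\<close> applies.\<close>
  let ?f = "\<lambda>t. frechet_derivative f (at t) 1"
  have f: "Ck k ?f" using Suc.prems(1) by simp
  have "(f has_derivative (\<lambda>h. ?f t * h)) (at t)" for t
  proof -
    have d: "(f has_derivative frechet_derivative f (at t)) (at t)"
      using Suc.prems(1) by (simp add: frechet_derivative_works[symmetric])
    then have "linear (frechet_derivative f (at t))" by (rule has_derivative_linear)
    then have "frechet_derivative f (at t) h = ?f t * h" for h
      using linear_scale[of "frechet_derivative f (at t)" h 1] by (simp add: mult.commute)
    then have "frechet_derivative f (at t) = (\<lambda>h. ?f t * h)" ..
    with d show ?thesis by simp
  qed
  moreover have "(g has_derivative frechet_derivative g (at x)) (at x)" for x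
    using Suc.prems(2) by (simp add: frechet_derivative_works[symmetric])
  ultimately have "((\<lambda>x. f (g x)) has_derivative (\<lambda>h. ?f (g x) * frechet_derivative g (at x) h)) (at x)" for x
    using has_derivative_compose by blast
  moreover have "Ck k (\<lambda>x. ?f (g x) * frechet_derivative g (at x) i)" if "i \<in> Basis" for i
    using Suc.IH[OF f k] Suc.prems(2) that by (intro Ck_mult) auto
  ultimately show ?case by (intro Ck_SucI) auto
qed

lemma smooth_const [intro!]: "smooth (\<lambda>x. c)"
  and smooth_add [intro]: "smooth f \<Longrightarrow> smooth g \<Longrightarrow> smooth (\<lambda>x. f x + g x)"
  and smooth_mult [intro]: "smooth f \<Longrightarrow> smooth g \<Longrightarrow> smooth (\<lambda>x. f x * g x)"
  and smooth_compose: "smooth F \<Longrightarrow> smooth f \<Longrightarrow> smooth (\<lambda>x. F (f x))" for F :: "real \<Rightarrow> real"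
  by (auto simp: smooth_def Ck_const Ck_add Ck_mult Ck_compose)

lemma smooth_prod: "(\<And>j. j \<in> J \<Longrightarrow> smooth (f j)) \<Longrightarrow> smooth (\<lambda>x. \<Prod>j\<in>J. f j x)"
  by (induction J rule: infinite_finite_induct) auto

lemma smooth_sum: "(\<And>j. j \<in> J \<Longrightarrow> smooth (f j)) \<Longrightarrow> smooth (\<lambda>x. \<Sum>j\<in>J. f j x)"
  by (induction J rule: infinite_finite_induct) auto

lemma smooth_inner [intro]: "smooth (\<lambda>x. x \<bullet> b)"
proof (rule smoothI)
  show "((\<lambda>x. x \<bullet> b) has_derivative (\<lambda>h. h \<bullet> b)) (at x)" for x :: 'a
    by (auto intro!: derivative_eq_intros)
qed auto

lemma partial_translate:
  assumes "smooth f"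
  shows "partial i (\<lambda>x. f (x + c)) x = partial i f (x + c)"
proof -
  have "((\<lambda>x. x + c) has_derivative (\<lambda>h. h)) (at x)" by (auto intro!: derivative_eq_intros)
  from has_derivative_compose[OF this smooth_imp_has_derivative[OF assms]]
  show ?thesis by (rule partial_eq)
qed

lemma smooth_translate:
  assumes "smooth f"
  shows "smooth (\<lambda>x. f (x + c))"
proof -
  have "smooth f \<Longrightarrow> Ck k (\<lambda>x. f (x + c))" for k
  proof (induction k arbitrary: f)
    case 0
    then show ?case
      by (auto intro!: continuous_on_compose2[OF smooth_continuous_on[of f UNIV]] continuous_intros)
  next
    case (Suc k)
    have "((\<lambda>x. x + c) has_derivative (\<lambda>h. h)) (at x)" for x by (auto intro!: derivative_eq_intros)
    from has_derivative_compose[OF this smooth_imp_has_derivative[OF Suc.prems]]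
    have "((\<lambda>x. f (x + c)) has_derivative frechet_derivative f (at (x + c))) (at x)" for x .
    moreover have "Ck k (\<lambda>x. frechet_derivative f (at (x + c)) i)" if "i \<in> Basis" for i
      using Suc.IH[OF smooth_partial[OF Suc.prems that]] .
    ultimately show ?case by (rule Ck_SucI)
  qed
  from this[OF assms] show ?thesis by (simp add: smooth_def)
qed

lemma partial_mult:
  assumes "smooth f" "smooth g"
  shows "partial i (\<lambda>x. f x * g x) x = f x * partial i g x + partial i f x * g x"
  by (rule partial_eq[OF has_derivative_mult[OF smooth_imp_has_derivative[OF assms(1)] smooth_imp_has_derivative[OF assms(2)]]])

text \<open>The powers of \<open>1 / t\<close> make the family closed under differentiation: the
  derivative of \<open>bump m c\<close> is a combination of \<open>bump (m + 1) c\<close> and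
  \<open>bump (m + 2) c\<close>. As the parameter \<open>c\<close> decreases to 0,
  \<open>bump 0 c\<close> increases to the indicator of the positive half-line.\<close>

definition bump :: "nat \<Rightarrow> real \<Rightarrow> real \<Rightarrow> real" where
  "bump m c t = (if t > 0 then (1 / t) ^ m * exp (- c / t) else 0)"

text \<open>With \<open>y = c / t\<close> this says that the exponential beats the power
  \<open>y ^ m\<close>; the factor \<open>1 / c ^ m\<close> undoes the substitution.\<close>

lemma bump_tendsto_0:
  assumes "c > 0"
  shows "(bump m c \<longlongrightarrow> 0) (at_right 0)"
proof -
  have "((\<lambda>y::real. y ^ m / exp y) \<longlongrightarrow> 0) at_top"
    by (rule tendsto_power_div_exp_0)
  moreover have "filterlim (\<lambda>t. c * inverse t) at_top (at_right 0)"
    using assms filterlim_inverse_at_top_right filterlim_tendsto_pos_mult_at_top tendsto_const by blast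
  ultimately have "((\<lambda>t. (c * inverse t) ^ m / exp (c * inverse t)) \<longlongrightarrow> 0) (at_right 0)"
    by (rule filterlim_compose)
  then have "((\<lambda>t. (1 / c ^ m) * ((c * inverse t) ^ m / exp (c * inverse t))) \<longlongrightarrow> (1 / c ^ m) * 0) (at_right 0)"
    by (intro tendsto_intros)
  then have "((\<lambda>t. (1 / c ^ m) * ((c * inverse t) ^ m / exp (c * inverse t))) \<longlongrightarrow> 0) (at_right 0)"
    by simp
  then show ?thesis
  proof (rule Lim_transform_eventually)
    have "(1 / c ^ m) * ((c * inverse t) ^ m / exp (c * inverse t)) = bump m c t" if "t > 0" for t
      using assms that by (simp add: bump_def power_mult_distrib exp_minus divide_inverse)
    then show "\<forall>\<^sub>F t in at_right 0. (1 / c ^ m) * ((c * inverse t) ^ m / exp (c * inverse t)) = bump m c t"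
      by (auto simp: eventually_at_right_field intro!: exI[of _ 1])
  qed
qed

lemma bump_has_derivative:
  assumes "c > 0"
  shows "(bump m c has_real_derivative (c * bump (m + 2) c t - m * bump (m + 1) c t)) (at t)"
proof (cases t "0::real" rule: linorder_cases)
  case less
  have "((\<lambda>t. 0) has_real_derivative 0) (at t)" by simp
  moreover have "eventually (\<lambda>s. s < 0) (nhds t)" using less
    using eventually_nhds_in_open[of "{..<0}" t] by simp
  ultimately have "(bump m c has_real_derivative 0) (at t)"
    by (subst DERIV_cong_ev[OF refl _ refl, where g = "\<lambda>_. 0"])
      (auto elim!: eventually_mono simp: bump_def)
  with less show ?thesis by (simp add: bump_def)
next
  case greater
  have "((\<lambda>t. (1 / t) ^ m * exp (- c / t)) has_real_derivative
      (c * ((1 / t) ^ (m + 2) * exp (- c / t)) - m * ((1 / t) ^ (m + 1) * exp (- c / t)))) (at t)"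
  proof -
    have 1: "((\<lambda>t. 1 / t) has_real_derivative - ((1 / t) ^ 2)) (at t)"
      using greater by (auto intro!: derivative_eq_intros simp: power2_eq_square)
    have 2: "((\<lambda>t. exp (- c / t)) has_real_derivative exp (- c / t) * (c * (1 / t) ^ 2)) (at t)"
      using greater by (auto intro!: derivative_eq_intros simp: power2_eq_square)
    \<comment> \<open>The exponent \<open>m - Suc 0\<close> is truncated for \<open>m = 0\<close>,
      where the factor \<open>real m\<close> removes the term; hence the case distinction.\<close>
    have "real m * (- (y\<^sup>2) * y ^ (m - Suc 0)) * e + e * (c * y\<^sup>2) * y ^ m
        = c * (y ^ (m + 2) * e) - real m * (y ^ (m + 1) * e)" for y e
      by (cases m) (simp_all add: power2_eq_square algebra_simps)
    then show ?thesis
      by (rule DERIV_cong[OF DERIV_mult[OF DERIV_power[OF 1] 2]])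
  qed
  moreover have "eventually (\<lambda>s. s > 0) (nhds t)" using greater
    using eventually_nhds_in_open[of "{0<..}" t] by simp
  ultimately have "(bump m c has_real_derivative (c * ((1 / t) ^ (m + 2) * exp (- c / t)) - m * ((1 / t) ^ (m + 1) * exp (- c / t)))) (at t)"
    by (subst DERIV_cong_ev[OF refl _ refl, where g = "\<lambda>t. (1 / t) ^ m * exp (- c / t)"])
      (auto elim!: eventually_mono simp: bump_def)
  with greater show ?thesis by (simp add: bump_def)
next
  case equal
  \<comment> \<open>At 0 the right difference quotient of \<open>bump m c\<close> is
    \<open>bump (m + 1) c\<close> itself, and the left one is 0.\<close>
  have "((\<lambda>h. (bump m c (0 + h) - bump m c 0) / h) \<longlongrightarrow> 0) (at_right 0)"
    using bump_tendsto_0[OF assms, of "m + 1"]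
    by (rule Lim_transform_eventually)
      (auto simp: eventually_at_right_field bump_def intro!: exI[of _ 1])
  moreover have "((\<lambda>h. (bump m c (0 + h) - bump m c 0) / h) \<longlongrightarrow> 0) (at_left 0)"
    by (rule Lim_transform_eventually[OF tendsto_const])
      (auto simp: eventually_at_left_field bump_def intro!: exI[of _ "-1"])
  ultimately have "(bump m c has_real_derivative 0) (at 0)"
    unfolding DERIV_def by (rule filterlim_split_at[rotated])
  then show ?thesis using equal by (simp add: bump_def)
qed

lemma smooth_bump:
  assumes "c > 0"
  shows "smooth (bump m c)"
proof -
  have "Ck k (bump m c)" for k
  proof (induction k arbitrary: m)
    case 0
    have "isCont (bump m c) t" for t using bump_has_derivative[OF assms] by (rule DERIV_isCont)
    then show ?case by (simp add: continuous_at_imp_continuous_on)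
  next
    case (Suc k)
    have "(bump m c has_derivative (\<lambda>h. (c * bump (m + 2) c t + (- real m) * bump (m + 1) c t) * h)) (at t)" for t
      using bump_has_derivative[OF assms, of m t] unfolding has_field_derivative_def
      by (rule has_derivative_eq_rhs) (simp add: fun_eq_iff)
    then show ?case
    proof (rule Ck_SucI)
      show "Ck k (\<lambda>t. (c * bump (m + 2) c t + (- real m) * bump (m + 1) c t) * i)" for i
        by (rule Ck_mult[OF Ck_add[OF Ck_mult[OF Ck_const Suc.IH] Ck_mult[OF Ck_const Suc.IH]] Ck_const])
    qed
  qed
  then show ?thesis by (simp add: smooth_def)
qed

lemma smooth_shift_inner: "smooth (\<lambda>x. x \<bullet> b - c)" "smooth (\<lambda>x. c - x \<bullet> b)"
proof -
  have "smooth (\<lambda>x. x \<bullet> b + (- c))" "smooth (\<lambda>x. c + (- 1) * (x \<bullet> b))"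
    by (rule smooth_add[OF smooth_inner smooth_const]
        smooth_add[OF smooth_const smooth_mult[OF smooth_const smooth_inner]])+
  then show "smooth (\<lambda>x. x \<bullet> b - c)" "smooth (\<lambda>x. c - x \<bullet> b)" by simp_all
qed

text \<open>One factor for each face of the box. The parameter \<open>1 / Suc n\<close> is positive
  and tends to 0, so these are smooth functions that vanish outside the box and converge pointwise
  to its indicator.\<close>

definition box_bump :: "nat \<Rightarrow> 'a::euclidean_space \<Rightarrow> 'a \<Rightarrow> 'a \<Rightarrow> real" where
  "box_bump n a b x =
     (\<Prod>i\<in>Basis. bump 0 (1 / Suc n) (x \<bullet> i - a \<bullet> i) * bump 0 (1 / Suc n) (b \<bullet> i - x \<bullet> i))"

lemma smooth_box_bump: "smooth (box_bump n a b)"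
  unfolding box_bump_def [abs_def]
  by (intro smooth_prod smooth_mult smooth_compose[OF smooth_bump] smooth_shift_inner) auto

lemma bump_0_range: "c > 0 \<Longrightarrow> 0 \<le> bump 0 c t" "c > 0 \<Longrightarrow> bump 0 c t \<le> 1"
  by (auto simp: bump_def)

lemma box_bump_nonneg: "0 \<le> box_bump n a b x"
  unfolding box_bump_def by (intro prod_nonneg) (auto intro!: mult_nonneg_nonneg bump_0_range)

lemma box_bump_le_1: "box_bump n a b x \<le> 1"
  unfolding box_bump_def
  by (intro prod_le_1) (auto intro!: mult_nonneg_nonneg mult_le_one bump_0_range)

lemma box_bump_eq_0: "x \<notin> box a b \<Longrightarrow> box_bump n a b x = 0"
  unfolding box_bump_def by (intro prod_zero) (force simp: bump_def mem_box not_less)+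

lemma box_bump_pos: "x \<in> box a b \<Longrightarrow> 0 < box_bump n a b x"
  unfolding box_bump_def by (auto simp: bump_def mem_box not_less intro!: prod_pos)

lemma bump_0_tendsto_1:
  assumes "t > 0"
  shows "(\<lambda>n. bump 0 (1 / Suc n) t) \<longlonglongrightarrow> 1"
proof -
  have "(\<lambda>n. exp (- (inverse (real (Suc n))) / t)) \<longlonglongrightarrow> exp (- 0 / t)"
    using assms by (intro tendsto_intros LIMSEQ_inverse_real_of_nat) auto
  then show ?thesis using assms by (simp add: bump_def inverse_eq_divide)
qed

lemma box_bump_tendsto: "(\<lambda>n. box_bump n a b x) \<longlonglongrightarrow> indicator (box a b) x"
proof (cases "x \<in> box a b")
  case True
  then have "(\<lambda>n. box_bump n a b x) \<longlonglongrightarrow> (\<Prod>i\<in>(Basis::'a set). 1 * 1)"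
    unfolding box_bump_def by (intro tendsto_prod tendsto_mult bump_0_tendsto_1) (auto simp: mem_box)
  with True show ?thesis by simp
qed (simp add: box_bump_eq_0)

section \<open>Test functions and cutoffs\<close>

lemma test_functionI:
  assumes "smooth \<phi>" "compact K" "K \<subseteq> S" "\<And>x. x \<notin> K \<Longrightarrow> \<phi> x = 0"
  shows "test_function S \<phi>"
  using assms unfolding test_function_def smooth_def by blast

lemma test_functionD: "test_function S \<phi> \<Longrightarrow> smooth \<phi>"
  unfolding test_function_def smooth_def by blast

lemma test_function_mono: "test_function S \<phi> \<Longrightarrow> S \<subseteq> S' \<Longrightarrow> test_function S' \<phi>"
  unfolding test_function_def by blast

lemma test_function_mult:
  assumes "test_function S \<phi>" "smooth \<psi>"
  shows "test_function S (\<lambda>x. \<phi> x * \<psi> x)"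
proof -
  obtain K where "compact K" "K \<subseteq> S" "\<And>x. x \<notin> K \<Longrightarrow> \<phi> x = 0"
    using assms(1) unfolding test_function_def by blast
  then show "test_function S (\<lambda>x. \<phi> x * \<psi> x)"
    using assms(2) test_functionD[OF assms(1)]
    by (auto intro!: test_functionI[of _ K] smooth_mult)
qed

lemma test_function_box_bump: "cbox a b \<subseteq> S \<Longrightarrow> test_function S (box_bump n a b)"
  using box_subset_cbox by (intro test_functionI[of _ "cbox a b"] smooth_box_bump box_bump_eq_0) auto

lemma partial_eq_0_open:
  assumes "open V" "x \<in> V" "\<And>y. y \<in> V \<Longrightarrow> f y = c"
  shows "partial i f x = 0"
proof -
  have "((\<lambda>_. c) has_derivative (\<lambda>_. 0)) (at x)" by simp
  then have "(f has_derivative (\<lambda>_. 0)) (at x)"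
    by (rule has_derivative_transform_within_open[OF _ assms(1,2)]) (simp add: assms(3))
  then show ?thesis by (rule partial_eq)
qed

text \<open>\<open>T\<close> is a normalised antiderivative of a bump that is positive exactly
  between 0 and \<open>m\<close>, and is therefore constant on either side.\<close>

lemma smooth_step_exists:
  assumes "m > 0"
  obtains T :: "real \<Rightarrow> real" where "smooth T" "\<And>t. t \<le> 0 \<Longrightarrow> T t = 0" "\<And>t. m \<le> t \<Longrightarrow> T t = 1"
proof -
  define \<beta> where "\<beta> t = bump 0 1 t * bump 0 1 (m - t)" for t
  have "smooth (\<lambda>t::real. m + (- 1) * (t \<bullet> 1))"
    by (rule smooth_add[OF smooth_const smooth_mult[OF smooth_const smooth_inner]])
  then have "smooth (\<lambda>t::real. m - t)" by simp
  then have \<beta>: "smooth \<beta>" unfolding \<beta>_def [abs_def]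
    by (intro smooth_mult smooth_bump smooth_compose[OF smooth_bump]) auto
  then have "isCont \<beta> t" for t
    using smooth_continuous_on[of \<beta> UNIV] by (simp add: continuous_on_eq_continuous_at)
  then have "\<exists>F. \<forall>x. -\<infinity> < ereal x \<longrightarrow> ereal x < \<infinity> \<longrightarrow> (F has_vector_derivative \<beta> x) (at x)"
    by (intro einterval_antiderivative) auto
  then obtain F where "(F has_vector_derivative \<beta> x) (at x)" for x by auto
  then have F: "(F has_real_derivative \<beta> x) (at x)" for x
    by (simp add: has_real_derivative_iff_has_vector_derivative)
  \<comment> \<open>The mean value theorem shows that the total increase of \<open>F\<close> is
    positive, so that division by it is possible.\<close>
  obtain z where "0 < z" "z < m" "F m - F 0 = (m - 0) * \<beta> z"
    using MVT2[OF assms, of F \<beta>] F by blast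
  then have less: "F 0 < F m"
    using assms by (simp add: \<beta>_def bump_def algebra_simps)
  have low: "F t = F 0" if "t \<le> 0" for t
  proof (cases "t = 0")
    case False
    with that have "t < 0" by simp
    from MVT2[OF this, of F \<beta>] F obtain z where "t < z" "z < 0" "F 0 - F t = (0 - t) * \<beta> z" by blast
    then show ?thesis by (simp add: \<beta>_def bump_def)
  qed simp
  have high: "F t = F m" if "m \<le> t" for t
  proof (cases "t = m")
    case False
    with that have "m < t" by simp
    from MVT2[OF this, of F \<beta>] F obtain z where "m < z" "z < t" "F t - F m = (t - m) * \<beta> z" by blast
    then show ?thesis by (simp add: \<beta>_def bump_def)
  qed simp
  have "smooth F"
  proof (rule smoothI)
    show "(F has_derivative (\<lambda>h. \<beta> x * h)) (at x)" for x
      using F[of x] by (simp add: has_field_derivative_def)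
  qed (rule smooth_mult[OF \<beta> smooth_const])
  then have "smooth (\<lambda>t. (1 / (F m - F 0)) * (F t + (- F 0)))"
    by (intro smooth_mult smooth_add smooth_const)
  then show thesis
  proof (rule that)
    show "1 / (F m - F 0) * (F t + - F 0) = 0" if "t \<le> 0" for t
      using low[OF that] by simp
    show "1 / (F m - F 0) * (F t + - F 0) = 1" if "m \<le> t" for t
      using high[OF that] less by simp
  qed
qed

text \<open>A finite sum of box bumps is bounded below by some \<open>m > 0\<close> on the compact
  set \<open>K\<close>, and a smooth step turns all values from \<open>m\<close> on into 1. The
  cutoff is 1 on an open set around \<open>K\<close> and not only on \<open>K\<close>, so that its
  derivatives vanish at the points of \<open>K\<close>.\<close>

lemma cutoff_exists:
  fixes K S :: "'a::euclidean_space set"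
  assumes "compact K" "open S" "K \<subseteq> S"
  obtains \<zeta> V where "test_function S \<zeta>" "open V" "K \<subseteq> V" "\<And>x. x \<in> V \<Longrightarrow> \<zeta> x = 1"
proof -
  have "\<exists>a b. x \<in> box a b \<and> cbox a b \<subseteq> S" if "x \<in> K" for x
  proof -
    from that assms obtain e where e: "e > 0" "ball x e \<subseteq> S"
      by (meson open_contains_ball subsetD)
    obtain a b where ab: "box a b \<subseteq> ball x (e / 2)" "x \<in> box a b"
      using rational_boxes[of "e / 2" x] e(1) by auto
    then have "closure (box a b) = cbox a b" by (intro closure_box) auto
    then have "cbox a b \<subseteq> closure (ball x (e / 2))"
      using closure_mono[OF ab(1)] by simp
    also have "\<dots> \<subseteq> ball x e" using e(1) by auto
    finally show ?thesis using e ab by blast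
  qed
  then obtain a b where ab: "\<And>x. x \<in> K \<Longrightarrow> x \<in> box (a x) (b x)" "\<And>x. x \<in> K \<Longrightarrow> cbox (a x) (b x) \<subseteq> S"
    by metis
  have "K \<subseteq> (\<Union>x\<in>K. box (a x) (b x))" using ab(1) by blast
  then obtain C where C: "C \<subseteq> K" "finite C" "K \<subseteq> (\<Union>x\<in>C. box (a x) (b x))"
    using compactE_image[OF assms(1), of K "\<lambda>x. box (a x) (b x)"] by auto
  define \<Phi> where "\<Phi> y = (\<Sum>x\<in>C. box_bump 0 (a x) (b x) y)" for y
  have \<Phi>: "smooth \<Phi>" unfolding \<Phi>_def [abs_def] by (intro smooth_sum smooth_box_bump)
  have pos: "\<Phi> y > 0" if "y \<in> K" for y
  proof -
    from that C obtain x where "x \<in> C" "y \<in> box (a x) (b x)" by blast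
    then show ?thesis unfolding \<Phi>_def
      by (intro sum_pos2[OF C(2)]) (auto intro: box_bump_pos box_bump_nonneg)
  qed
  have "\<exists>m>0. \<forall>y\<in>K. m < \<Phi> y"
  proof (cases "K = {}")
    case False
    then obtain y where "y \<in> K" "\<And>z. z \<in> K \<Longrightarrow> \<Phi> y \<le> \<Phi> z"
      using continuous_attains_inf[OF assms(1) False smooth_continuous_on[OF \<Phi>]] by auto
    \<comment> \<open>Half the minimum, so that the bound is strict and defines an open set
      containing \<open>K\<close>.\<close>
    with pos[of y] show ?thesis by (intro exI[of _ "\<Phi> y / 2"]) (auto simp: less_le_trans field_simps; fastforce)
  qed (auto intro: exI[of _ 1])
  then obtain m where m: "m > 0" "\<And>y. y \<in> K \<Longrightarrow> m < \<Phi> y" by blast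
  obtain T where T: "smooth T" "\<And>t. t \<le> 0 \<Longrightarrow> T t = 0" "\<And>t. m \<le> t \<Longrightarrow> T t = (1::real)"
    using smooth_step_exists[OF m(1)] by blast
  have "test_function S (\<lambda>y. T (\<Phi> y))"
  proof (rule test_functionI)
    show "smooth (\<lambda>y. T (\<Phi> y))" by (rule smooth_compose[OF T(1) \<Phi>])
    show "compact (\<Union>x\<in>C. cbox (a x) (b x))" using C(2) by (intro compact_UN) auto
    show "(\<Union>x\<in>C. cbox (a x) (b x)) \<subseteq> S" using ab C by blast
    show "T (\<Phi> y) = 0" if "y \<notin> (\<Union>x\<in>C. cbox (a x) (b x))" for y
    proof -
      have "box_bump 0 (a x) (b x) y = 0" if "x \<in> C" for x
        using that \<open>y \<notin> _\<close> box_subset_cbox by (intro box_bump_eq_0) blast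
      then show ?thesis by (simp add: \<Phi>_def T(2))
    qed
  qed
  moreover have "open {y. m < \<Phi> y}"
    using smooth_continuous_on[OF \<Phi>] by (intro open_Collect_less continuous_on_const)
  ultimately show thesis using m(2) T(3) by (intro that[of "\<lambda>y. T (\<Phi> y)" "{y. m < \<Phi> y}"]) auto
qed

section \<open>The fundamental lemma of the calculus of variations\<close>

lemma integrable_box_integrals_0_imp_AE_0:
  fixes f :: "'a::euclidean_space \<Rightarrow> real"
  assumes f: "integrable lborel f" and 0: "\<And>a b. (LBINT x. indicator (box a b) x * f x) = 0"
  shows "AE x in lborel. f x = 0"
proof -
  have [measurable]: "f \<in> borel_measurable borel" using f by auto
  let ?p = "\<lambda>x. ennreal (max (f x) 0)" and ?n = "\<lambda>x. ennreal (max (- f x) 0)"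
  have int: "integrable lborel (\<lambda>x. max (f x) 0)" "integrable lborel (\<lambda>x. max (- f x) 0)"
    using f by auto
  have fin: "(\<integral>\<^sup>+ x. ?p x \<partial>lborel) \<noteq> \<infinity>"
    using int(1) by (subst nn_integral_eq_integral) auto
  have eq: "emeasure (density lborel ?p) (box a b) = emeasure (density lborel ?n) (box a b)" for a b
  proof -
    have i: "integrable lborel (\<lambda>x. indicator (box a b) x * max (f x) 0)"
        "integrable lborel (\<lambda>x. indicator (box a b) x * max (- f x) 0)"
      using integrable_mult_indicator[OF _ int(1), of "box a b"] integrable_mult_indicator[OF _ int(2), of "box a b"]
      by auto
    have "(LBINT x. indicator (box a b) x * max (f x) 0) - (LBINT x. indicator (box a b) x * max (- f x) 0)
      = (LBINT x. indicator (box a b) x * f x)"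
      by (subst Bochner_Integration.integral_diff[symmetric, OF i])
        (auto intro!: Bochner_Integration.integral_cong simp: max_def algebra_simps)
    then have e: "(LBINT x. indicator (box a b) x * max (f x) 0) = (LBINT x. indicator (box a b) x * max (- f x) 0)"
      by (simp add: 0)
    have "emeasure (density lborel ?p) (box a b) = ennreal (LBINT x. indicator (box a b) x * max (f x) 0)"
      using i(1) by (subst emeasure_density)
        (auto simp: nn_integral_eq_integral[symmetric] intro!: nn_integral_cong split: split_indicator)
    moreover have "emeasure (density lborel ?n) (box a b) = ennreal (LBINT x. indicator (box a b) x * max (- f x) 0)"
      using i(2) by (subst emeasure_density)
        (auto simp: nn_integral_eq_integral[symmetric] intro!: nn_integral_cong split: split_indicator)
    ultimately show ?thesis using e by simp
  qed
  have "density lborel ?p = density lborel ?n"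
  proof (rule measure_eqI_generator_eq)
    let ?E = "range (\<lambda>(a, b). box a b::'a set)"
    show "Int_stable ?E" by (auto simp: Int_stable_def box_Int_box)
    show "?E \<subseteq> Pow UNIV" "sets (density lborel ?p) = sigma_sets UNIV ?E"
      "sets (density lborel ?n) = sigma_sets UNIV ?E" by (simp_all add: borel_eq_box)
    let ?A = "\<lambda>n::nat. box (- (real n *\<^sub>R One)) (real n *\<^sub>R One) :: 'a set"
    show "range ?A \<subseteq> ?E" "(\<Union>i. ?A i) = UNIV" unfolding UN_box_eq_UNIV by auto
    show "emeasure (density lborel ?p) (?A i) \<noteq> \<infinity>" for i
    proof -
      have "emeasure (density lborel ?p) (?A i) \<le> emeasure (density lborel ?p) UNIV"
        by (intro emeasure_mono) auto
      also have "\<dots> = (\<integral>\<^sup>+ x. ?p x \<partial>lborel)" by (subst emeasure_density) auto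
      finally show ?thesis using fin by (auto simp: top_unique)
    qed
    show "emeasure (density lborel ?p) X = emeasure (density lborel ?n) X" if "X \<in> ?E" for X
      using that eq by auto
  qed
  then have "AE x in lborel. ?p x = ?n x"
    using fin by (subst (asm) finite_density_unique) auto
  then show ?thesis by eventually_elim (auto simp: max_def split: if_splits)
qed

lemma lebesgue_box_integrals_0_imp_AE_0:
  fixes f :: "'a::euclidean_space \<Rightarrow> real"
  assumes f: "integrable lebesgue f" and 0: "\<And>a b. (LINT x|lebesgue. indicator (box a b) x * f x) = 0"
  shows "AE x in lebesgue. f x = 0"
proof -
  obtain g where g: "g \<in> borel_measurable lborel" "AE x in lborel. f x = g x"
    using completion_ex_borel_measurable_real[OF borel_measurable_integrable[OF f]] by auto
  then have g': "AE x in lebesgue. f x = g x" by (auto intro: AE_completion)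
  have [measurable]: "f \<in> borel_measurable lebesgue" "g \<in> borel_measurable borel"
    "g \<in> borel_measurable lebesgue"
    using f g(1) by (auto intro: measurable_completion)
  have "integrable lebesgue g" using f g' by (subst integrable_cong_AE[symmetric, of f]) auto
  then have "integrable lborel g" by (simp add: integrable_completion)
  moreover have "(LBINT x. indicator (box a b) x * g x) = 0" for a b
  proof -
    have [measurable]: "box a b \<in> sets lebesgue" by simp
    have "(LBINT x. indicator (box a b) x * g x) = (LINT x|lebesgue. indicator (box a b) x * g x)"
      by (subst integral_completion) auto
    also have "\<dots> = (LINT x|lebesgue. indicator (box a b) x * f x)"
      using g' by (intro integral_cong_AE) auto
    finally show ?thesis by (simp add: 0)
  qed
  ultimately have "AE x in lborel. g x = 0" by (rule integrable_box_integrals_0_imp_AE_0)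
  then have "AE x in lebesgue. g x = 0" by (rule AE_completion)
  with g' show ?thesis by eventually_elim simp
qed

lemma cbox_subset_of_box:
  assumes "box a b \<subseteq> box c d" "box a b \<noteq> {}"
  shows "cbox a b \<subseteq> cbox c d"
proof -
  have "closure (box a b) \<subseteq> cbox c d"
    using assms(1) box_subset_cbox[of c d] by (intro closure_minimal) auto
  then show ?thesis using assms(2) by simp
qed

lemma locally_integrable_indicator:
  assumes "locally_integrable S h" "compact K" "K \<subseteq> S"
  shows "integrable lebesgue (\<lambda>x. indicator K x *\<^sub>R h x)"
  using assms unfolding locally_integrable_def
  by (subst integrable_restrict_space[symmetric]) (auto simp: fmeasurableD lmeasurable_compact)

text \<open>For a box with closure in \<open>S\<close> the box bumps are test functions, and they
  turn into the indicator of the box in the limit. Since \<open>h\<close> is only locally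
  integrable, the conclusion is drawn on one closed box at a time and then for countably many boxes
  that cover \<open>S\<close>.\<close>

lemma fundamental_lemma:
  fixes h :: "'a::euclidean_space \<Rightarrow> real"
  assumes "open S" and h: "locally_integrable S h"
    and 0: "\<And>\<phi>. test_function S \<phi> \<Longrightarrow> (LINT x|lebesgue_on S. h x * \<phi> x) = 0"
  shows "AE x in lebesgue_on S. h x = 0"
proof -
  have box0: "(LINT x|lebesgue. indicator (box a b) x * h x) = 0" if ab: "cbox a b \<subseteq> S" for a b
  proof -
    have i: "integrable lebesgue (\<lambda>x. indicator (cbox a b) x *\<^sub>R h x)"
      using ab by (intro locally_integrable_indicator[OF h]) auto
    have *: "(\<lambda>x. box_bump n a b x * (indicator (cbox a b) x *\<^sub>R h x)) = (\<lambda>x. indicator S x *\<^sub>R (h x * box_bump n a b x))" for n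
      using ab box_subset_cbox[of a b] box_bump_eq_0[of _ a b n]
      by (auto simp: fun_eq_iff subset_iff split: split_indicator)
    have "(\<lambda>n. \<integral>x. box_bump n a b x * (indicator (cbox a b) x *\<^sub>R h x) \<partial>lebesgue) \<longlonglongrightarrow>
      (LINT x|lebesgue. indicator (box a b) x * (indicator (cbox a b) x *\<^sub>R h x))"
    proof (rule integral_dominated_convergence)
      show "integrable lebesgue (\<lambda>x. norm (indicator (cbox a b) x *\<^sub>R h x))" using i by (rule integrable_norm)
      show "AE x in lebesgue. (\<lambda>n. box_bump n a b x * (indicator (cbox a b) x *\<^sub>R h x)) \<longlonglongrightarrow>
          indicator (box a b) x * (indicator (cbox a b) x *\<^sub>R h x)"
        by (intro AE_I2 tendsto_mult box_bump_tendsto tendsto_const)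
      show "AE x in lebesgue. norm (box_bump n a b x * (indicator (cbox a b) x *\<^sub>R h x)) \<le> norm (indicator (cbox a b) x *\<^sub>R h x)" for n
        by (intro AE_I2) (simp add: abs_mult box_bump_nonneg mult_left_le_one_le box_bump_le_1)
      have "continuous_on UNIV (box_bump n a b)" for n by (rule smooth_continuous_on[OF smooth_box_bump])
      then have "box_bump n a b \<in> borel_measurable lebesgue" for n
        by (intro measurable_completion) (auto intro: borel_measurable_continuous_onI)
      then show "(\<lambda>x. box_bump n a b x * (indicator (cbox a b) x *\<^sub>R h x)) \<in> borel_measurable lebesgue" for n
        using borel_measurable_integrable[OF i] by (rule borel_measurable_times)
      have "(indicator (box a b) :: 'a \<Rightarrow> real) \<in> borel_measurable lebesgue"
        by (intro borel_measurable_indicator) simp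
      then show "(\<lambda>x. indicator (box a b) x * (indicator (cbox a b) x *\<^sub>R h x)) \<in> borel_measurable lebesgue"
        using borel_measurable_integrable[OF i] by (rule borel_measurable_times)
    qed
    moreover have "(LINT x|lebesgue. box_bump n a b x * (indicator (cbox a b) x *\<^sub>R h x)) = 0" for n
      unfolding * using 0[OF test_function_box_bump[OF ab]] assms(1)
      by (subst integral_restrict_space[symmetric]) auto
    ultimately have "(LINT x|lebesgue. indicator (box a b) x * (indicator (cbox a b) x *\<^sub>R h x)) = 0"
      by (simp add: LIMSEQ_const_iff)
    also have "(\<lambda>x. indicator (box a b) x * (indicator (cbox a b) x *\<^sub>R h x)) = (\<lambda>x. indicator (box a b) x * h x)"
      using box_subset_cbox[of a b] by (auto simp: fun_eq_iff split: split_indicator)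
    finally show ?thesis .
  qed
  have AEbox: "AE x in lebesgue. x \<in> cbox c d \<longrightarrow> h x = 0" if cd: "cbox c d \<subseteq> S" for c d
  proof -
    have i: "integrable lebesgue (\<lambda>x. indicator (cbox c d) x *\<^sub>R h x)"
      using cd by (intro locally_integrable_indicator[OF h]) auto
    have "integrable lebesgue (\<lambda>x. indicator (box c d) x *\<^sub>R (indicator (cbox c d) x *\<^sub>R h x))"
      by (intro integrable_mult_indicator i) auto
    also have "(\<lambda>x. indicator (box c d) x *\<^sub>R (indicator (cbox c d) x *\<^sub>R h x)) = (\<lambda>x. indicator (box c d) x * h x)"
      using box_subset_cbox[of c d] by (auto simp: fun_eq_iff split: split_indicator)
    finally have "AE x in lebesgue. indicator (box c d) x * h x = 0"
    proof (rule lebesgue_box_integrals_0_imp_AE_0)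
      fix a b
      \<comment> \<open>An open box inside \<open>box c d\<close> is empty or has its closure in
        \<open>S\<close>, so the vanishing of box integrals shown above applies to it.\<close>
      obtain a' b' where ab: "box a b \<inter> box c d = box a' b'"
        by (rule that[OF box_Int_box])
      have "(\<lambda>x. indicator (box a b) x * (indicator (box c d) x * h x)) = (\<lambda>x. indicator (box a' b') x * h x)"
        unfolding ab[symmetric] by (auto simp: fun_eq_iff split: split_indicator)
      moreover have "(LINT x|lebesgue. indicator (box a' b') x * h x) = 0"
      proof (cases "box a' b' = {}")
        case False
        have "box a' b' \<subseteq> box c d" using ab by blast
        then have "cbox a' b' \<subseteq> cbox c d" using False by (rule cbox_subset_of_box)
        then show ?thesis using cd by (intro box0) auto
      qed simp
      ultimately show "(LINT x|lebesgue. indicator (box a b) x * (indicator (box c d) x * h x)) = 0" by simp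
    qed
    moreover have "AE x in lebesgue. x \<notin> cbox c d - box c d"
      using negligible_frontier_interval[of c d] unfolding negligible_iff_null_sets by (rule AE_not_in)
    ultimately show ?thesis by eventually_elim (auto split: split_indicator_asm)
  qed
  obtain D where D: "countable D" "D \<subseteq> Pow S" "\<And>X. X \<in> D \<Longrightarrow> \<exists>a b. X = cbox a b" "\<Union>D = S"
    using open_countable_Union_open_cbox[OF assms(1)] by blast
  have "AE x in lebesgue. \<forall>X\<in>D. x \<in> X \<longrightarrow> h x = 0"
    unfolding AE_ball_countable[OF D(1)]
  proof
    fix X assume X: "X \<in> D"
    then obtain c d where "X = cbox c d" using D(3) by blast
    with X D(2) AEbox[of c d] show "AE x in lebesgue. x \<in> X \<longrightarrow> h x = 0" by auto
  qed
  then have "AE x in lebesgue. x \<in> S \<longrightarrow> h x = 0"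
    by eventually_elim (use D(4) in blast)
  then show ?thesis using assms(1) by (subst AE_restrict_space_iff) auto
qed

section \<open>Weak derivatives as limits of difference quotients\<close>

lemma smooth_borel_measurable: "smooth f \<Longrightarrow> f \<in> borel_measurable borel"
  by (intro borel_measurable_continuous_onI smooth_continuous_on)

lemma smooth_line_derivative:
  assumes "smooth f"
  shows "((\<lambda>s. f (x + s *\<^sub>R i)) has_real_derivative partial i f (x + s *\<^sub>R i)) (at s)"
proof -
  have "((\<lambda>s. x + s *\<^sub>R i) has_derivative (\<lambda>h. h *\<^sub>R i)) (at s)"
    by (auto intro!: derivative_eq_intros)
  from has_derivative_compose[OF this smooth_imp_has_derivative[OF assms]]
  have "((\<lambda>s. f (x + s *\<^sub>R i)) has_derivative (\<lambda>h. frechet_derivative f (at (x + s *\<^sub>R i)) (h *\<^sub>R i))) (at s)" .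
  moreover have "linear (frechet_derivative f (at (x + s *\<^sub>R i)))"
    using smooth_imp_has_derivative[OF assms] by (rule has_derivative_linear)
  ultimately show ?thesis
    by (simp add: has_field_derivative_def linear_scale mult_commute_abs)
qed

lemma test_function_partial:
  assumes "test_function S \<phi>" "i \<in> Basis"
  shows "test_function S (partial i \<phi>)"
proof -
  obtain K where K: "compact K" "K \<subseteq> S" "\<And>x. x \<notin> K \<Longrightarrow> \<phi> x = 0"
    using assms(1) unfolding test_function_def by blast
  show ?thesis
  proof (rule test_functionI[OF _ K(1,2)])
    show "smooth (partial i \<phi>)" using assms by (intro smooth_partial test_functionD)
    show "partial i \<phi> x = 0" if "x \<notin> K" for x
      using that K compact_imp_closed by (intro partial_eq_0_open[of "- K" x \<phi> 0]) auto
  qed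
qed

lemma test_function_bounded:
  assumes "test_function S \<phi>"
  obtains B where "B > 0" "\<And>x. \<bar>\<phi> x\<bar> \<le> B"
proof -
  obtain K where K: "compact K" "\<And>x. x \<notin> K \<Longrightarrow> \<phi> x = 0"
    using assms unfolding test_function_def by blast
  have "compact (\<phi> ` K)"
    using K(1) by (intro compact_continuous_image smooth_continuous_on test_functionD[OF assms])
  then obtain B where B: "\<And>x. x \<in> K \<Longrightarrow> \<bar>\<phi> x\<bar> \<le> B"
    using compact_imp_bounded bounded_iff by (metis image_eqI real_norm_def)
  have "\<bar>\<phi> x\<bar> \<le> max B 1" for x using B[of x] K(2)[of x] by (cases "x \<in> K") auto
  then show thesis by (intro that[of "max B 1"]) auto
qed

lemma integrable_mult_bounded:
  fixes f g :: "'a \<Rightarrow> real"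
  assumes "integrable M f" "g \<in> borel_measurable M" "\<And>x. \<bar>g x\<bar> \<le> B"
  shows "integrable M (\<lambda>x. f x * g x)"
proof -
  have [measurable]: "f \<in> borel_measurable M" "g \<in> borel_measurable M" using assms by auto
  have B: "0 \<le> B" using abs_ge_zero[of "g undefined"] assms(3)[of undefined] by linarith
  show "integrable M (\<lambda>x. f x * g x)"
  proof (rule Bochner_Integration.integrable_bound)
    show "integrable M (\<lambda>x. B * f x)" using assms(1) by simp
    have "norm (f x * g x) \<le> norm (B * f x)" for x
      using mult_right_mono[OF assms(3)[of x] abs_ge_zero[of "f x"]] B by (simp add: abs_mult ac_simps)
    then show "AE x in M. norm (f x * g x) \<le> norm (B * f x)" by simp
  qed simp
qed

lemma integral_abs_mult_le:
  fixes f g :: "'a \<Rightarrow> real"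
  assumes "integrable M f" "g \<in> borel_measurable M" "\<And>x. \<bar>g x\<bar> \<le> B"
  shows "(LINT x|M. \<bar>f x * g x\<bar>) \<le> B * (LINT x|M. \<bar>f x\<bar>)"
proof -
  have "(LINT x|M. \<bar>f x * g x\<bar>) \<le> (LINT x|M. B * \<bar>f x\<bar>)"
  proof (rule integral_mono)
    show "integrable M (\<lambda>x. \<bar>f x * g x\<bar>)"
      by (intro Bochner_Integration.integrable_abs integrable_mult_bounded[OF assms])
    show "\<bar>f x * g x\<bar> \<le> B * \<bar>f x\<bar>" for x
      using mult_right_mono[OF assms(3)[of x] abs_ge_zero[of "f x"]] by (simp add: abs_mult mult.commute)
  qed (use assms(1) in simp)
  then show ?thesis by simp
qed

section \<open>Continuity of translations in L1\<close>

lemma integrable_lborel_translate: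
  fixes f :: "'a::euclidean_space \<Rightarrow> 'b::{banach,second_countable_topology}"
  assumes "integrable lborel f"
  shows "integrable lborel (\<lambda>x. f (x + h))"
proof -
  have "integrable (distr lborel borel ((+) h)) f" using assms by (simp add: lborel_distr_plus)
  then show ?thesis using borel_measurable_integrable[OF assms]
    by (subst (asm) integrable_distr_eq) (auto simp: add.commute)
qed

lemma integral_lborel_translate:
  fixes f :: "'a::euclidean_space \<Rightarrow> 'b::{banach,second_countable_topology}"
  assumes "f \<in> borel_measurable borel"
  shows "(LBINT x. f (x + h)) = (LBINT x. f x)"
proof -
  have "(LBINT x. f x) = (\<integral>x. f x \<partial>distr lborel borel ((+) h))" by (simp add: lborel_distr_plus)
  also have "\<dots> = (LBINT x. f (x + h))"
    using assms by (subst integral_distr) (auto simp: add.commute)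
  finally show ?thesis by simp
qed

text \<open>The L1 modulus of continuity of \<open>f\<close>, as a function of the shift
  \<open>h\<close>.\<close>

definition transl_diff :: "('a::euclidean_space \<Rightarrow> real) \<Rightarrow> 'a \<Rightarrow> real" where
  "transl_diff f h = (LBINT x. \<bar>f (x + h) - f x\<bar>)"

lemma transl_diff_integrable:
  fixes f :: "'a::euclidean_space \<Rightarrow> real"
  shows "integrable lborel f \<Longrightarrow> integrable lborel (\<lambda>x. \<bar>f (x + h) - f x\<bar>)"
  by (intro Bochner_Integration.integrable_abs Bochner_Integration.integrable_diff integrable_lborel_translate)

lemma transl_diff_nonneg: "0 \<le> transl_diff f h"
  unfolding transl_diff_def by (intro Bochner_Integration.integral_nonneg) simp

text \<open>The factor 2 counts \<open>f - g\<close> and its translate, which have the same L1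
  norm.\<close>

lemma transl_diff_approx:
  assumes f: "integrable lborel f" and g: "integrable lborel g"
  shows "transl_diff f h \<le> transl_diff g h + 2 * (LBINT x. \<bar>f x - g x\<bar>)"
proof -
  have [measurable]: "f \<in> borel_measurable borel" "g \<in> borel_measurable borel" using f g by auto
  have i: "integrable lborel (\<lambda>x. \<bar>f x - g x\<bar>)" using f g by auto
  have i': "integrable lborel (\<lambda>x. \<bar>f (x + h) - g (x + h)\<bar>)" using integrable_lborel_translate[OF i] .
  have "transl_diff f h \<le> (LBINT x. \<bar>g (x + h) - g x\<bar> + (\<bar>f (x + h) - g (x + h)\<bar> + \<bar>f x - g x\<bar>))"
    unfolding transl_diff_def
    by (intro integral_mono transl_diff_integrable f Bochner_Integration.integrable_add g i i') auto
  also have "\<dots> = transl_diff g h + ((LBINT x. \<bar>f (x + h) - g (x + h)\<bar>) + (LBINT x. \<bar>f x - g x\<bar>))"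
    unfolding transl_diff_def
    by (subst Bochner_Integration.integral_add; (intro transl_diff_integrable Bochner_Integration.integrable_add g i i')?)+ (rule refl)
  also have "(LBINT x. \<bar>f (x + h) - g (x + h)\<bar>) = (LBINT x. \<bar>f x - g x\<bar>)"
    by (rule integral_lborel_translate) simp
  finally show ?thesis by simp
qed

lemma transl_diff_le: "integrable lborel f \<Longrightarrow> transl_diff f h \<le> 2 * (LBINT x. \<bar>f x\<bar>)"
  using transl_diff_approx[of f "\<lambda>x. 0" h] by (simp add: transl_diff_def)

lemma transl_diff_tendsto_by_approx:
  assumes f: "integrable lborel f"
    and g: "\<And>e. e > 0 \<Longrightarrow> \<exists>g. integrable lborel g \<and> (LBINT x. \<bar>f x - g x\<bar>) < e \<and> (\<lambda>n. transl_diff g (X n)) \<longlonglongrightarrow> 0"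
  shows "(\<lambda>n. transl_diff f (X n)) \<longlonglongrightarrow> 0"
proof (rule LIMSEQ_I)
  fix e :: real assume "e > 0"
  then obtain g where g: "integrable lborel g" "(LBINT x. \<bar>f x - g x\<bar>) < e / 4" "(\<lambda>n. transl_diff g (X n)) \<longlonglongrightarrow> 0"
    using g[of "e / 4"] by auto
  from LIMSEQ_D[OF g(3), of "e / 2"] \<open>e > 0\<close> obtain N where "\<And>n. n \<ge> N \<Longrightarrow> \<bar>transl_diff g (X n)\<bar> < e / 2" by auto
  have "norm (transl_diff f (X n) - 0) < e" if "n \<ge> N" for n
  proof -
    have "\<bar>transl_diff g (X n)\<bar> < e / 2" using \<open>\<And>n. n \<ge> N \<Longrightarrow> \<bar>transl_diff g (X n)\<bar> < e / 2\<close> that .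
    with transl_diff_approx[OF f g(1), of "X n"] g(2) transl_diff_nonneg[of f "X n"]
    have "\<bar>transl_diff f (X n)\<bar> < e" by linarith
    then show ?thesis by simp
  qed
  then show "\<exists>no. \<forall>n\<ge>no. norm (transl_diff f (X n) - 0) < e" by blast
qed

text \<open>Translated indicators need not converge at the boundary of \<open>U\<close>, but at
  points of \<open>U\<close> they do, because \<open>U\<close> is open. The mass that enters
  \<open>U\<close> equals the mass that leaves it by translation invariance, so it suffices to count
  twice what leaves.\<close>

lemma transl_diff_open:
  assumes U: "open U" "emeasure lborel U < \<infinity>" and X: "X \<longlonglongrightarrow> 0"
  shows "(\<lambda>n. transl_diff (indicator U) (X n)) \<longlonglongrightarrow> 0"
proof -
  let ?u = "indicator U :: 'a \<Rightarrow> real"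
  have [measurable]: "U \<in> sets borel" using U by simp
  have i: "integrable lborel ?u" using U by (intro integrable_real_indicator) auto
  have it: "integrable lborel (\<lambda>x. ?u (x + h))" for h using integrable_lborel_translate[OF i] .
  have ip: "integrable lborel (\<lambda>x. ?u x * (1 - ?u (x + h)))" for h
    by (rule integrable_mult_bounded[OF i, where B = 1]) (auto split: split_indicator)
  have eq: "transl_diff ?u h = 2 * (LBINT x. ?u x * (1 - ?u (x + h)))" for h
  proof -
    have "transl_diff ?u h = (LBINT x. 2 * (?u x * (1 - ?u (x + h))) + (?u (x + h) - ?u x))"
      unfolding transl_diff_def
      by (intro Bochner_Integration.integral_cong refl) (auto split: split_indicator)
    also have "\<dots> = (LBINT x. 2 * (?u x * (1 - ?u (x + h)))) + ((LBINT x. ?u (x + h)) - (LBINT x. ?u x))"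
      by (subst Bochner_Integration.integral_add Bochner_Integration.integral_diff;
         (intro Bochner_Integration.integrable_diff i it integrable_mult_right ip)?)+ (rule refl)
    also have "(LBINT x. ?u (x + h)) = (LBINT x. ?u x)" by (rule integral_lborel_translate) simp
    finally show ?thesis by simp
  qed
  have "(\<lambda>n. \<integral>x. ?u x * (1 - ?u (x + X n)) \<partial>lborel) \<longlonglongrightarrow> (\<integral>x. 0 \<partial>(lborel::'a measure))"
  proof (rule integral_dominated_convergence[OF _ _ i])
    show "AE x in lborel. (\<lambda>n. ?u x * (1 - ?u (x + X n))) \<longlonglongrightarrow> 0"
    proof (rule AE_I2)
      fix x
      show "(\<lambda>n. ?u x * (1 - ?u (x + X n))) \<longlonglongrightarrow> 0"
      proof (cases "x \<in> U")
        case True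
        have "(\<lambda>n. x + X n) \<longlonglongrightarrow> x + 0" by (intro tendsto_intros X)
        then have "eventually (\<lambda>n. x + X n \<in> U) sequentially"
          using U(1) True by (simp add: topological_tendstoD)
        then show ?thesis by (intro tendsto_eventually, elim eventually_mono) simp
      qed simp
    qed
  qed (auto split: split_indicator)
  then have "(\<lambda>n. 2 * (LBINT x. ?u x * (1 - ?u (x + X n)))) \<longlonglongrightarrow> 2 * 0"
    by (intro tendsto_intros) simp
  then show ?thesis by (simp add: eq)
qed

text \<open>Open sets are settled by \<open>transl_diff_open\<close>. Outer regularity passes from
  them to Borel sets of finite measure, linearity and L1 approximation from these to all integrable
  functions.\<close>

lemma transl_diff_tendsto_0:
  fixes f :: "'a::euclidean_space \<Rightarrow> real"
  assumes "integrable lborel f" "X \<longlonglongrightarrow> 0"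
  shows "(\<lambda>n. transl_diff f (X n)) \<longlonglongrightarrow> 0"
  using assms(1)
proof (induction rule: integrable_induct)
  case (base A c)
  then have [measurable]: "A \<in> sets borel" by simp
  have "(\<lambda>n. transl_diff (indicator A) (X n)) \<longlonglongrightarrow> 0"
  proof (rule transl_diff_tendsto_by_approx)
    show "integrable lborel (indicator A :: 'a \<Rightarrow> real)" using base by (intro integrable_real_indicator) auto
    fix e :: real assume "e > 0"
    obtain U where U: "open U" "A \<subseteq> U" "emeasure lborel (U - A) < ennreal e"
      using outer_regular_lborel[of A e] \<open>e > 0\<close> by auto
    then have [measurable]: "U \<in> sets borel" by simp
    have fin: "emeasure lborel (U - A) < \<infinity>" using U(3) by (simp add: less_top[symmetric]) (metis ennreal_less_top less_trans top.not_eq_extremum)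
    have "emeasure lborel U = emeasure lborel (A \<union> (U - A))" using U(2) by (simp add: Un_absorb1)
    also have "\<dots> \<le> emeasure lborel A + emeasure lborel (U - A)" by (intro emeasure_subadditive) auto
    also have "\<dots> < \<infinity>" using base fin by (simp add: ennreal_add_less_top)
    finally have Ufin: "emeasure lborel U < \<infinity>" .
    have "(LBINT x. \<bar>indicator A x - indicator U x :: real\<bar>) = (LBINT x. indicator (U - A) x)"
      using U(2) by (intro Bochner_Integration.integral_cong) (auto split: split_indicator)
    also have "\<dots> = measure lborel (U - A)" by simp
    also have "\<dots> < e" using U(3) fin \<open>e > 0\<close>
      by (simp add: emeasure_eq_ennreal_measure ennreal_less_iff)
    finally have "(LBINT x. \<bar>indicator A x - indicator U x :: real\<bar>) < e" .
    with transl_diff_open[OF U(1) Ufin assms(2)] Ufin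
    show "\<exists>g. integrable lborel g \<and> (LBINT x. \<bar>indicator A x - g x\<bar>) < e \<and> (\<lambda>n. transl_diff g (X n)) \<longlonglongrightarrow> 0"
      by (intro exI[of _ "indicator U"]) auto
  qed
  then have "(\<lambda>n. \<bar>c\<bar> * transl_diff (indicator A) (X n)) \<longlonglongrightarrow> \<bar>c\<bar> * 0" by (intro tendsto_intros)
  moreover have "transl_diff (\<lambda>x. indicator A x *\<^sub>R c) h = \<bar>c\<bar> * transl_diff (indicator A) h" for h
    unfolding transl_diff_def
    by (subst integral_mult_right_zero[symmetric])
      (intro Bochner_Integration.integral_cong refl, auto split: split_indicator)
  ultimately show ?case by simp
next
  case (add f g)
  have "transl_diff (\<lambda>x. f x + g x) h \<le> transl_diff f h + transl_diff g h" for h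
    unfolding transl_diff_def
    by (subst Bochner_Integration.integral_add[symmetric])
      (intro transl_diff_integrable integral_mono add.hyps Bochner_Integration.integrable_add; simp)+
  moreover have "(\<lambda>n. transl_diff f (X n) + transl_diff g (X n)) \<longlonglongrightarrow> 0 + 0"
    using add by (intro tendsto_intros) auto
  ultimately show ?case
    by (intro tendsto_sandwich[OF _ _ tendsto_const[of 0], of "\<lambda>n. transl_diff (\<lambda>x. f x + g x) (X n)" _ "\<lambda>n. transl_diff f (X n) + transl_diff g (X n)"])
      (auto intro!: always_eventually transl_diff_nonneg)
next
  case (lim f s)
  show ?case
  proof (rule transl_diff_tendsto_by_approx[OF lim.hyps(4)])
    fix e :: real assume "e > 0"
    have [measurable]: "f \<in> borel_measurable borel" "\<And>i. s i \<in> borel_measurable borel" using lim by auto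
    have "(\<lambda>i. \<integral>x. \<bar>f x - s i x\<bar> \<partial>lborel) \<longlonglongrightarrow> (\<integral>x. 0 \<partial>(lborel::'a measure))"
    proof (rule integral_dominated_convergence)
      \<comment> \<open>The approximants of the induction principle satisfy
        \<open>\<bar>s i x\<bar> \<le> 2 * \<bar>f x\<bar>\<close>; one more
        \<open>\<bar>f x\<bar>\<close> makes 3.\<close>
      show "integrable lborel (\<lambda>x. 3 * \<bar>f x\<bar>)" using lim by simp
      show "AE x in lborel. (\<lambda>i. \<bar>f x - s i x\<bar>) \<longlonglongrightarrow> 0"
      proof (rule AE_I2)
        fix x
        have "(\<lambda>i. \<bar>f x - s i x\<bar>) \<longlonglongrightarrow> \<bar>f x - f x\<bar>" using lim.hyps(2)[of x] by (intro tendsto_intros) auto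
        then show "(\<lambda>i. \<bar>f x - s i x\<bar>) \<longlonglongrightarrow> 0" by simp
      qed
      show "AE x in lborel. norm \<bar>f x - s i x\<bar> \<le> 3 * \<bar>f x\<bar>" for i
      proof (rule AE_I2)
        fix x show "norm \<bar>f x - s i x\<bar> \<le> 3 * \<bar>f x\<bar>" using lim.hyps(3)[of x i] by auto
      qed
    qed auto
    then have "(\<lambda>i. \<integral>x. \<bar>f x - s i x\<bar> \<partial>lborel) \<longlonglongrightarrow> 0" by simp
    from order_tendstoD(2)[OF this \<open>e > 0\<close>]
    obtain i where "(LBINT x. \<bar>f x - s i x\<bar>) < e" by (auto simp: eventually_sequentially)
    then show "\<exists>g. integrable lborel g \<and> (LBINT x. \<bar>f x - g x\<bar>) < e \<and> (\<lambda>n. transl_diff g (X n)) \<longlonglongrightarrow> 0"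
      using lim by (intro exI[of _ "s i"]) auto
  qed
qed

text \<open>A bound on the L1 norms of the slices that is uniform in \<open>s\<close> makes the
  double integral finite once \<open>s\<close> is confined to the unit interval. The confinement is
  a factor \<open>indicator {0..1} s\<close>, so that both measures stay
  \<open>lborel\<close>.\<close>

lemma unit_interval_pair_integrable:
  fixes F :: "real \<Rightarrow> 'a::euclidean_space \<Rightarrow> real"
  assumes m [measurable]: "(\<lambda>(s, x). F s x) \<in> borel_measurable (lborel \<Otimes>\<^sub>M lborel)"
    and F: "\<And>s. integrable lborel (F s)" "\<And>s. (LBINT x. \<bar>F s x\<bar>) \<le> C"
  shows "integrable (lborel \<Otimes>\<^sub>M lborel) (\<lambda>(s, x). indicator {0..1} s * F s x)"
proof (rule lborel_pair.Fubini_integrable)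
  show "(\<lambda>(s, x). indicator {0..1} s * F s x) \<in> borel_measurable (lborel \<Otimes>\<^sub>M lborel)" by measurable
  show "AE s in lborel. integrable lborel (\<lambda>x. case (s, x) of (s, x) \<Rightarrow> indicator {0..1} s * F s x)"
    using F(1) by simp
  have "integrable lborel (\<lambda>s. indicator {0..1} s * (LBINT x. \<bar>F s x\<bar>))"
  proof (rule integrable_mult_bounded[where B = C])
    show "integrable lborel (indicator {0..1} :: real \<Rightarrow> real)" by (intro integrable_real_indicator) auto
    show "(\<lambda>s. \<integral>x. \<bar>F s x\<bar> \<partial>lborel) \<in> borel_measurable lborel" by measurable
    show "\<bar>\<integral>x. \<bar>F s x\<bar> \<partial>lborel\<bar> \<le> C" for s
      using F(2)[of s] by simp
  qed
  then show "integrable lborel (\<lambda>s. \<integral>x. norm (case (s, x) of (s, x) \<Rightarrow> indicator {0..1} s * F s x) \<partial>lborel)"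
    by (simp add: abs_mult)
qed

lemma unit_interval_Fubini:
  fixes F :: "real \<Rightarrow> 'a::euclidean_space \<Rightarrow> real"
  assumes m: "(\<lambda>(s, x). F s x) \<in> borel_measurable (lborel \<Otimes>\<^sub>M lborel)"
    and F: "\<And>s. integrable lborel (F s)" "\<And>s. (LBINT x. \<bar>F s x\<bar>) \<le> C"
  shows "(LBINT x. (LBINT s. indicator {0..1} s * F s x)) = (LBINT s. indicator {0..1} s * (LBINT x. F s x))"
    and "integrable lborel (\<lambda>x. \<integral>s. indicator {0..1} s * F s x \<partial>lborel)"
    and "AE x in lborel. integrable lborel (\<lambda>s. indicator {0..1} s * F s x)"
  using lborel_pair.Fubini_integral[OF unit_interval_pair_integrable[OF assms]]
    lborel_pair.integrable_snd[OF unit_interval_pair_integrable[OF assms]]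
    lborel_pair.AE_integrable_snd[OF unit_interval_pair_integrable[OF assms]]
  by auto

section \<open>Weak derivatives in one direction and averages along segments\<close>

lemma fundamental_lemma_lborel:
  fixes h :: "'a::euclidean_space \<Rightarrow> real"
  assumes h: "integrable lborel h" and 0: "\<And>\<phi>. test_function UNIV \<phi> \<Longrightarrow> (LBINT x. h x * \<phi> x) = 0"
  shows "AE x in lborel. h x = 0"
proof -
  have [measurable]: "h \<in> borel_measurable borel" using h by auto
  have hl: "integrable lebesgue h" using h by (simp add: integrable_completion)
  have "AE x in lebesgue_on UNIV. h x = 0"
  proof (rule fundamental_lemma)
    show "locally_integrable UNIV h" unfolding locally_integrable_def
    proof (intro allI impI)
      fix K :: "'a set" assume "compact K"
      then have "K \<in> sets lebesgue" by (simp add: fmeasurableD lmeasurable_compact)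
      then show "integrable (lebesgue_on K) h"
        using integrable_mult_indicator[OF _ hl, of K] by (subst integrable_restrict_space) auto
    qed
    fix \<phi> :: "'a \<Rightarrow> real" assume \<phi>: "test_function UNIV \<phi>"
    then have [measurable]: "\<phi> \<in> borel_measurable borel" by (intro smooth_borel_measurable test_functionD)
    show "(LINT x|lebesgue_on UNIV. h x * \<phi> x) = 0"
      using 0[OF \<phi>] by (simp add: lebesgue_on_UNIV_eq integral_completion)
  qed simp
  then show ?thesis unfolding lebesgue_on_UNIV_eq by (subst (asm) AE_completion_iff) auto
qed

text \<open>Global and with Borel functions: the difference quotient argument shifts functions over
  the whole space and needs \<open>G (x + s *\<^sub>R v)\<close> to be jointly measurable in
  \<open>s\<close> and \<open>x\<close>. Cutoffs and Borel representatives reduce gradients on open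
  sets to this case.\<close>

definition weak_deriv :: "'a::euclidean_space \<Rightarrow> ('a \<Rightarrow> real) \<Rightarrow> ('a \<Rightarrow> real) \<Rightarrow> bool" where
  "weak_deriv i U G \<longleftrightarrow> integrable lborel U \<and> integrable lborel G \<and>
     (\<forall>\<phi>. test_function UNIV \<phi> \<longrightarrow> (LBINT x. U x * partial i \<phi> x) = - (LBINT x. G x * \<phi> x))"

lemma test_function_translate:
  assumes "test_function UNIV \<phi>"
  shows "test_function UNIV (\<lambda>x. \<phi> (x + c))"
proof -
  obtain K where K: "compact K" "\<And>x. x \<notin> K \<Longrightarrow> \<phi> x = 0"
    using assms unfolding test_function_def by blast
  show ?thesis
  proof (rule test_functionI)
    show "smooth (\<lambda>x. \<phi> (x + c))" by (intro smooth_translate test_functionD[OF assms])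
    show "compact ((+) (- c) ` K)" using K(1) by (rule compact_translation)
    show "\<phi> (x + c) = 0" if "x \<notin> (+) (- c) ` K" for x
      using that by (intro K(2)) (auto simp: image_iff algebra_simps)
  qed simp
qed

text \<open>The average of \<open>G\<close> over the segment from \<open>x\<close> to
  \<open>x + v\<close>.\<close>

definition line_avg :: "'a::euclidean_space \<Rightarrow> ('a \<Rightarrow> real) \<Rightarrow> 'a \<Rightarrow> real" where
  "line_avg v G x = (LBINT s. indicator {0..1} s * G (x + s *\<^sub>R v))"

lemma line_avg_partial:
  assumes "smooth \<phi>" and that: "i \<in> Basis"
  shows "t * line_avg (t *\<^sub>R i) (partial i \<phi>) x = \<phi> (x + t *\<^sub>R i) - \<phi> x"
proof -
  have D: "((\<lambda>s. \<phi> (x + s *\<^sub>R (t *\<^sub>R i))) has_real_derivative t * partial i \<phi> (x + s *\<^sub>R (t *\<^sub>R i))) (at s)" for s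
  proof -
    have "((\<lambda>s. s * t) has_real_derivative t) (at s)" by (auto intro!: derivative_eq_intros)
    from DERIV_chain2[where f = "\<lambda>s. \<phi> (x + s *\<^sub>R i)" and g = "\<lambda>s. s * t", OF smooth_line_derivative[OF assms(1)] this]
    show ?thesis by (simp add: mult.commute)
  qed
  have "isCont (\<lambda>s. t * partial i \<phi> (x + s *\<^sub>R (t *\<^sub>R i))) s" for s
  proof -
    have "continuous_on UNIV (\<lambda>s. partial i \<phi> (x + s *\<^sub>R (t *\<^sub>R i)))"
      by (rule continuous_on_compose2[OF smooth_continuous_on[OF smooth_partial[OF assms], of UNIV]])
        (auto intro!: continuous_intros)
    then show ?thesis by (auto intro!: continuous_intros simp: continuous_on_eq_continuous_at)
  qed
  from integral_FTC_Icc_real[OF _ D this, of 0 1]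
  have "(LBINT s. t * partial i \<phi> (x + s *\<^sub>R (t *\<^sub>R i)) * indicator {0..1} s) = \<phi> (x + t *\<^sub>R i) - \<phi> x" by simp
  also have "(LBINT s. t * partial i \<phi> (x + s *\<^sub>R (t *\<^sub>R i)) * indicator {0..1} s) =
     (LBINT s. t * (indicator {0..1} s * partial i \<phi> (x + s *\<^sub>R (t *\<^sub>R i))))"
    by (intro Bochner_Integration.integral_cong) auto
  finally show ?thesis unfolding line_avg_def by simp
qed

lemma integrable_mult_test_function:
  fixes U :: "'a::euclidean_space \<Rightarrow> real"
  assumes "integrable lborel U" "test_function UNIV \<phi>"
  shows "integrable lborel (\<lambda>x. U x * \<phi> x)"
proof -
  obtain B where "\<And>x. \<bar>\<phi> x\<bar> \<le> B" using test_function_bounded[OF assms(2)] by blast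
  then show ?thesis
    using assms smooth_borel_measurable[OF test_functionD[OF assms(2)]]
    by (intro integrable_mult_bounded) auto
qed

text \<open>A discrete integration by parts: translation invariance moves the quotient to the test
  function and reverses the shift.\<close>

lemma integral_quotient_shift:
  fixes U :: "'a::euclidean_space \<Rightarrow> real"
  assumes U: "integrable lborel U" and \<phi>: "test_function UNIV \<phi>"
  shows "(LBINT x. (U (x + v) - U x) / t * \<phi> x) = (LBINT x. U x * ((\<phi> (x - v) - \<phi> x) / t))"
proof -
  note [measurable] = borel_measurable_integrable[OF U] smooth_borel_measurable[OF test_functionD[OF \<phi>]]
  note I = integrable_mult_test_function[OF integrable_lborel_translate[OF U] \<phi>]
    integrable_mult_test_function[OF U \<phi>]
    integrable_mult_test_function[OF U test_function_translate[OF \<phi>], of "- v"]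
  have "(LBINT x. U (x + v) * \<phi> x) = (LBINT x. (\<lambda>x. U x * \<phi> (x - v)) (x + v))"
    by simp
  also have "\<dots> = (LBINT x. U x * \<phi> (x - v))" by (rule integral_lborel_translate) measurable
  finally have 1: "(LBINT x. U (x + v) * \<phi> x) = (LBINT x. U x * \<phi> (x - v))" .
  have "(LBINT x. (U (x + v) - U x) / t * \<phi> x) = (LBINT x. (U (x + v) * \<phi> x - U x * \<phi> x) / t)"
    by (intro Bochner_Integration.integral_cong) (auto simp: left_diff_distrib)
  also have "\<dots> = (LBINT x. (U x * \<phi> (x - v) - U x * \<phi> x) / t)"
    using I by (simp add: 1)
  also have "\<dots> = (LBINT x. U x * ((\<phi> (x - v) - \<phi> x) / t))"
    by (intro Bochner_Integration.integral_cong) (auto simp: right_diff_distrib)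
  finally show ?thesis .
qed

text \<open>For smooth \<open>U\<close> this is the fundamental theorem of calculus. In general it
  follows by duality: the quotient is moved to the test function, the fundamental theorem is applied
  there, Fubini exchanges the integrals, and the weak derivative is tested with translates of the
  test function.\<close>

lemma quotient_eq_line_avg:
  fixes U G :: "'a::euclidean_space \<Rightarrow> real"
  assumes w: "weak_deriv i U G" and i: "i \<in> Basis" and t: "t \<noteq> 0"
  shows "AE x in lborel. (U (x + t *\<^sub>R i) - U x) / t = line_avg (t *\<^sub>R i) G x"
proof -
  have int: "integrable lborel U" "integrable lborel G" using w by (auto simp: weak_deriv_def)
  then have [measurable]: "U \<in> borel_measurable borel" "G \<in> borel_measurable borel" by auto
  have intt: "integrable lborel (\<lambda>x. U (x + h))" "integrable lborel (\<lambda>x. G (x + h))" for h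
    using int by (auto intro: integrable_lborel_translate)
  have intG: "(LBINT x. \<bar>G (x + h)\<bar>) = (LBINT x. \<bar>G x\<bar>)" for h
    by (rule integral_lborel_translate) simp
  note GF = unit_interval_Fubini[of "\<lambda>s x. G (x + s *\<^sub>R (t *\<^sub>R i))", OF _ intt(2) eq_refl[OF intG]]
  have iavg: "integrable lborel (line_avg (t *\<^sub>R i) G)"
    unfolding line_avg_def [abs_def] by (rule GF(2)) measurable
  have "AE x in lborel. (U (x + t *\<^sub>R i) - U x) / t - line_avg (t *\<^sub>R i) G x = 0"
  proof (rule fundamental_lemma_lborel)
    show "integrable lborel (\<lambda>x. (U (x + t *\<^sub>R i) - U x) / t - line_avg (t *\<^sub>R i) G x)"
      by (intro Bochner_Integration.integrable_diff integrable_divide iavg int intt)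
    fix \<phi> :: "'a \<Rightarrow> real" assume \<phi>: "test_function UNIV \<phi>"
    have sm: "smooth \<phi>" "smooth (partial i \<phi>)" using \<phi> i by (auto intro: test_functionD smooth_partial)
    then have [measurable]: "\<phi> \<in> borel_measurable borel" "partial i \<phi> \<in> borel_measurable borel"
      by (auto intro: smooth_borel_measurable)
    note \<phi>t = test_function_translate[OF \<phi>]
    note d\<phi> = test_function_partial[OF \<phi> i]
    obtain B where B: "B > 0" "\<And>x. \<bar>\<phi> x\<bar> \<le> B" using test_function_bounded[OF \<phi>] by blast
    obtain B' where B': "B' > 0" "\<And>x. \<bar>partial i \<phi> x\<bar> \<le> B'" using test_function_bounded[OF d\<phi>] by blast
    have "(LBINT x. (U (x + t *\<^sub>R i) - U x) / t * \<phi> x) = (LBINT x. U x * ((\<phi> (x - t *\<^sub>R i) - \<phi> x) / t))"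
      by (rule integral_quotient_shift[OF int(1) \<phi>])
    also have "\<dots> = (LBINT x. - (LBINT s. indicator {0..1} s * (U x * partial i \<phi> (x + s *\<^sub>R ((- t) *\<^sub>R i)))))"
    proof (intro Bochner_Integration.integral_cong refl)
      fix x
      have "(LBINT s. indicator {0..1} s * (U x * partial i \<phi> (x + s *\<^sub>R ((- t) *\<^sub>R i)))) = (LBINT s. U x * (indicator {0..1} s * partial i \<phi> (x + s *\<^sub>R ((- t) *\<^sub>R i))))"
        by (intro Bochner_Integration.integral_cong) auto
      also have "\<dots> = U x * line_avg ((- t) *\<^sub>R i) (partial i \<phi>) x"
        unfolding line_avg_def by simp
      also have "line_avg ((- t) *\<^sub>R i) (partial i \<phi>) x = - ((\<phi> (x - t *\<^sub>R i) - \<phi> x) / t)"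
        using line_avg_partial[OF sm(1) i, of "- t" x] t by (simp add: field_simps)
      finally show "U x * ((\<phi> (x - t *\<^sub>R i) - \<phi> x) / t) = - (LBINT s. indicator {0..1} s * (U x * partial i \<phi> (x + s *\<^sub>R ((- t) *\<^sub>R i))))"
        by simp
    qed
    also have "\<dots> = - (LBINT s. indicator {0..1} s * (LBINT x. U x * partial i \<phi> (x + s *\<^sub>R ((- t) *\<^sub>R i))))"
    proof -
      define d where "d = partial i \<phi>"
      have [measurable]: "d \<in> borel_measurable borel"
        unfolding d_def by (intro smooth_borel_measurable sm)
      have m: "(\<lambda>(s, x). U x * d (x + s *\<^sub>R ((- t) *\<^sub>R i))) \<in> borel_measurable (lborel \<Otimes>\<^sub>M lborel)"
        by measurable
      have "(LBINT x. \<bar>U x * partial i \<phi> (x + h)\<bar>) \<le> B' * (LBINT x. \<bar>U x\<bar>)" for h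
        using smooth_borel_measurable[OF test_functionD[OF test_function_translate[OF d\<phi>]]]
        by (intro integral_abs_mult_le int(1) B'(2)) simp
      note * = unit_interval_Fubini(1)[of "\<lambda>s x. U x * partial i \<phi> (x + s *\<^sub>R ((- t) *\<^sub>R i))",
           OF m[unfolded d_def] integrable_mult_test_function[OF int(1) test_function_translate[OF d\<phi>]] this]
      show ?thesis by (subst Bochner_Integration.integral_minus, subst *) (rule refl)
    qed
    also have "\<dots> = (LBINT s. indicator {0..1} s * (LBINT x. G (x + s *\<^sub>R (t *\<^sub>R i)) * \<phi> x))"
    proof -
      \<comment> \<open>For fixed \<open>s\<close> the translate of \<phi> is again a test function;
        afterwards the shift is transferred to \<open>G\<close>.\<close>
      have "- (LBINT x. U x * partial i \<phi> (x + s *\<^sub>R ((- t) *\<^sub>R i))) = (LBINT x. G (x + s *\<^sub>R (t *\<^sub>R i)) * \<phi> x)" for s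
      proof -
        let ?c = "s *\<^sub>R ((- t) *\<^sub>R i)"
        have "- (LBINT x. U x * partial i \<phi> (x + ?c)) = - (LBINT x. U x * partial i (\<lambda>x. \<phi> (x + ?c)) x)"
          by (subst partial_translate[OF sm(1)]) (rule refl)
        also have "\<dots> = (LBINT x. G x * \<phi> (x + ?c))"
          using w \<phi>t[of ?c] unfolding weak_deriv_def by simp
        also have "\<dots> = (LBINT x. (\<lambda>x. G x * \<phi> (x + ?c)) (x + s *\<^sub>R (t *\<^sub>R i)))"
          by (rule integral_lborel_translate[symmetric]) measurable
        finally show ?thesis by simp
      qed
      then show ?thesis
        by (subst Bochner_Integration.integral_minus[symmetric], subst mult_minus_right[symmetric]) presburger
    qed
    also have "\<dots> = (LBINT x. (LBINT s. indicator {0..1} s * (G (x + s *\<^sub>R (t *\<^sub>R i)) * \<phi> x)))"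
    proof -
      have m: "(\<lambda>(s, x). G (x + s *\<^sub>R (t *\<^sub>R i)) * \<phi> x) \<in> borel_measurable (lborel \<Otimes>\<^sub>M lborel)"
        by measurable
      have "(LBINT x. \<bar>G (x + h) * \<phi> x\<bar>) \<le> B * (LBINT x. \<bar>G x\<bar>)" for h
        using integral_abs_mult_le[OF intt(2)[of h] _ B(2)] by (simp add: intG)
      note * = unit_interval_Fubini(1)[of "\<lambda>s x. G (x + s *\<^sub>R (t *\<^sub>R i)) * \<phi> x",
           OF m integrable_mult_test_function[OF intt(2) \<phi>] this]
      show ?thesis by (subst *) (rule refl)
    qed
    also have "\<dots> = (LBINT x. line_avg (t *\<^sub>R i) G x * \<phi> x)"
      unfolding line_avg_def
      by (subst integral_mult_left_zero[symmetric]) (simp add: mult.assoc)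
    finally have "(LBINT x. (U (x + t *\<^sub>R i) - U x) / t * \<phi> x) = (LBINT x. line_avg (t *\<^sub>R i) G x * \<phi> x)" .
    then show "(LBINT x. ((U (x + t *\<^sub>R i) - U x) / t - line_avg (t *\<^sub>R i) G x) * \<phi> x) = 0"
      by (simp add: left_diff_distrib, subst Bochner_Integration.integral_diff)
        (auto intro!: integrable_mult_test_function intt int iavg \<phi> simp: left_diff_distrib diff_divide_distrib)
  qed
  then show ?thesis by eventually_elim simp
qed

text \<open>The deviation of the average from \<open>G x\<close> is at most the average of the
  deviations, and Fubini turns the integral of the latter over \<open>x\<close> into an average of
  L1 moduli of continuity.\<close>

lemma line_avg_L1:
  fixes G :: "'a::euclidean_space \<Rightarrow> real"
  assumes int: "integrable lborel G"
  shows "(LBINT x. \<bar>line_avg v G x - G x\<bar>) \<le> (LBINT s. indicator {0..1} s * transl_diff G (s *\<^sub>R v))"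
proof -
  have [measurable]: "G \<in> borel_measurable borel" using int by auto
  have intt: "integrable lborel (\<lambda>x. G (x + h))" for h
    using int by (auto intro: integrable_lborel_translate)
  have intG: "(LBINT x. \<bar>G (x + h)\<bar>) = (LBINT x. \<bar>G x\<bar>)" for h
    by (rule integral_lborel_translate) simp
  note GF = unit_interval_Fubini[of "\<lambda>s x. G (x + s *\<^sub>R v)", OF _ intt eq_refl[OF intG]]
  have iavg: "integrable lborel (line_avg v G)"
    unfolding line_avg_def [abs_def] by (rule GF(2)) measurable
  have C: "(LBINT x. \<bar>\<bar>G (x + h) - G x\<bar>\<bar>) \<le> 2 * (LBINT x. \<bar>G x\<bar>)" for h
    using transl_diff_le[OF int, of h] by (simp add: transl_diff_def)
  note DF = unit_interval_Fubini[of "\<lambda>s x. \<bar>G (x + s *\<^sub>R v) - G x\<bar>", OF _ transl_diff_integrable[OF int] C]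
  have "AE x in lborel. integrable lborel (\<lambda>s. indicator {0..1} s * G (x + s *\<^sub>R v))"
    by (rule GF(3)) measurable
  then have "AE x in lborel. \<bar>line_avg v G x - G x\<bar> \<le> (LBINT s. indicator {0..1} s * \<bar>G (x + s *\<^sub>R v) - G x\<bar>)"
  proof eventually_elim
    fix x assume i: "integrable lborel (\<lambda>s. indicator {0..1} s * G (x + s *\<^sub>R v))"
    have i1: "integrable lborel (\<lambda>s. indicator {0..1::real} s * G x)" by simp
    have "line_avg v G x - G x = (LBINT s. indicator {0..1} s * G (x + s *\<^sub>R v)) - (LBINT s. indicator {0..1::real} s * G x)"
      unfolding line_avg_def by simp
    also have "\<dots> = (LBINT s. indicator {0..1} s * G (x + s *\<^sub>R v) - indicator {0..1} s * G x)"
      by (rule Bochner_Integration.integral_diff[symmetric, OF i i1])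
    finally have "\<bar>line_avg v G x - G x\<bar> \<le> (LBINT s. \<bar>indicator {0..1} s * G (x + s *\<^sub>R v) - indicator {0..1} s * G x\<bar>)"
      by simp
    also have "\<dots> = (LBINT s. indicator {0..1} s * \<bar>G (x + s *\<^sub>R v) - G x\<bar>)"
      by (intro Bochner_Integration.integral_cong) (auto split: split_indicator)
    finally show "\<bar>line_avg v G x - G x\<bar> \<le> (LBINT s. indicator {0..1} s * \<bar>G (x + s *\<^sub>R v) - G x\<bar>)" .
  qed
  then have "(LBINT x. \<bar>line_avg v G x - G x\<bar>) \<le> (LBINT x. (LBINT s. indicator {0..1} s * \<bar>G (x + s *\<^sub>R v) - G x\<bar>))"
  proof (intro integral_mono_AE)
    show "integrable lborel (\<lambda>x. \<integral>s. indicator {0..1} s * \<bar>G (x + s *\<^sub>R v) - G x\<bar> \<partial>lborel)"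
      by (rule DF(2)) measurable
  qed (use iavg int in auto)
  also have "\<dots> = (LBINT s. indicator {0..1} s * (LBINT x. \<bar>G (x + s *\<^sub>R v) - G x\<bar>))"
    by (rule DF(1)) measurable
  finally show ?thesis by (simp add: transl_diff_def)
qed

text \<open>Dominated convergence in \<open>s\<close>: for each \<open>s\<close> the modulus tends
  to 0 by continuity of translations, and it never exceeds twice the L1 norm of
  \<open>G\<close>.\<close>

lemma line_avg_tendsto_L1:
  fixes G :: "'a::euclidean_space \<Rightarrow> real"
  assumes int: "integrable lborel G" and X: "X \<longlonglongrightarrow> 0"
  shows "(\<lambda>n. \<integral>x. \<bar>line_avg (X n) G x - G x\<bar> \<partial>lborel) \<longlonglongrightarrow> 0"
proof -
  have [measurable]: "G \<in> borel_measurable borel" using int by auto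
  have "(\<lambda>n. \<integral>s. indicator {0..1} s * transl_diff G (s *\<^sub>R X n) \<partial>lborel) \<longlonglongrightarrow> (\<integral>s. 0 \<partial>(lborel::real measure))"
  proof (rule integral_dominated_convergence)
    show "integrable lborel (\<lambda>s. indicator {0..1::real} s * (2 * (LBINT x. \<bar>G x\<bar>)))" by simp
    show "(\<lambda>s. indicator {0..1} s * transl_diff G (s *\<^sub>R X n)) \<in> borel_measurable lborel" for n
      unfolding transl_diff_def by measurable
    show "AE s in lborel. (\<lambda>n. indicator {0..1} s * transl_diff G (s *\<^sub>R X n)) \<longlonglongrightarrow> 0"
    proof (rule AE_I2)
      fix s :: real
      have "(\<lambda>n. s *\<^sub>R X n) \<longlonglongrightarrow> s *\<^sub>R 0" by (intro tendsto_intros X)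
      then have "(\<lambda>n. transl_diff G (s *\<^sub>R X n)) \<longlonglongrightarrow> 0"
        using transl_diff_tendsto_0[OF int] by simp
      then show "(\<lambda>n. indicator {0..1} s * transl_diff G (s *\<^sub>R X n)) \<longlonglongrightarrow> 0"
        by (rule tendsto_mult_right_zero)
    qed
    show "AE s in lborel. norm (indicator {0..1} s * transl_diff G (s *\<^sub>R X n)) \<le> indicator {0..1::real} s * (2 * (LBINT x. \<bar>G x\<bar>))" for n
      using transl_diff_le[OF int] transl_diff_nonneg[of G]
      by (intro AE_I2) (auto simp: abs_mult intro!: mult_left_mono)
  qed simp
  then have "(\<lambda>n. \<integral>s. indicator {0..1} s * transl_diff G (s *\<^sub>R X n) \<partial>lborel) \<longlonglongrightarrow> 0" by simp
  then show ?thesis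
    by (rule tendsto_sandwich[OF _ _ tendsto_const, rotated -1])
      (auto intro!: always_eventually line_avg_L1[OF int])
qed

section \<open>The positive part of a weakly differentiable function\<close>

lemma abs_line_avg_le:
  assumes "\<And>y. \<bar>f y\<bar> \<le> B"
  shows "\<bar>line_avg v f x\<bar> \<le> B"
proof -
  have B: "0 \<le> B" using abs_ge_zero[of "f x"] assms[of x] by linarith
  have "\<bar>line_avg v f x\<bar> \<le> (LBINT s. \<bar>indicator {0..1} s * f (x + s *\<^sub>R v)\<bar>)"
    unfolding line_avg_def by (rule integral_abs_bound)
  also have "\<dots> \<le> (LBINT s. indicator {0..1::real} s * B)"
    using assms B by (intro integral_mono') (auto split: split_indicator)
  finally show ?thesis by simp
qed

lemma abs_pos_part_quotient_le: "\<bar>(max a 0 - max b 0) / t\<bar> \<le> \<bar>(a - b) / (t::real)\<bar>"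
  by (auto simp: abs_divide max_def intro!: divide_right_mono)

text \<open>The sign of \<sigma> is the common sign of the steps \<open>X n\<close>. It matters only
  for \<open>u = 0\<close>, where the positive part has different one-sided derivatives: positive
  steps keep the positive values of the quotient, negative steps keep the negative ones.\<close>

lemma pos_part_quotient_tendsto:
  fixes u g :: real and y X :: "nat \<Rightarrow> real"
  assumes lim: "(\<lambda>n. (y n - u) / X n) \<longlonglongrightarrow> g" and X: "X \<longlonglongrightarrow> 0" and sgn: "\<And>n. 0 < X n * \<sigma>"
  shows "(\<lambda>n. (max (y n) 0 - max u 0) / X n) \<longlonglongrightarrow>
    (if 0 < u then g else if u < 0 then 0 else if 0 < \<sigma> then max g 0 else min g 0)"
proof -
  have X0: "X n \<noteq> 0" for n using sgn[of n] by auto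
  have "(\<lambda>n. u + (y n - u) / X n * X n) \<longlonglongrightarrow> u + g * 0"
    by (intro tendsto_intros lim X)
  then have y: "y \<longlonglongrightarrow> u" by (simp add: X0)
  consider "0 < u" | "u < 0" | "u = 0" "0 < \<sigma>" | "u = 0" "\<sigma> < 0" using sgn[of 0] by fastforce
  then show ?thesis
  proof cases
    case 1
    then have "eventually (\<lambda>n. y n > 0) sequentially" using order_tendstoD(1)[OF y] by simp
    then have "(\<lambda>n. (max (y n) 0 - max u 0) / X n) \<longlonglongrightarrow> g"
      using 1 by (intro Lim_transform_eventually[OF lim]) (auto elim!: eventually_mono)
    with 1 show ?thesis by simp
  next
    case 2
    then have "eventually (\<lambda>n. y n < 0) sequentially" using order_tendstoD(2)[OF y] by simp
    then have "(\<lambda>n. (max (y n) 0 - max u 0) / X n) \<longlonglongrightarrow> 0"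
      using 2 by (intro tendsto_eventually) (auto elim!: eventually_mono)
    with 2 show ?thesis by simp
  next
    case 3
    have "(max (y n) 0 - max u 0) / X n = max ((y n - u) / X n) 0" for n
      using 3 sgn[of n] by (auto simp: max_def zero_less_mult_iff divide_le_0_iff zero_le_divide_iff)
    then show ?thesis using 3 lim by (simp add: tendsto_max)
  next
    case 4
    have "(max (y n) 0 - max u 0) / X n = min ((y n - u) / X n) 0" for n
      using 4 sgn[of n] by (auto simp: max_def min_def zero_less_mult_iff divide_le_0_iff zero_le_divide_iff)
    then show ?thesis using 4 lim by (simp add: tendsto_min)
  qed
qed

lemma test_function_quotient_tendsto:
  assumes "smooth \<phi>" "X \<longlonglongrightarrow> 0" "\<And>n. X n \<noteq> (0::real)"
  shows "(\<lambda>n. (\<phi> (x - X n *\<^sub>R i) - \<phi> x) / X n) \<longlonglongrightarrow> - partial i \<phi> x"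
proof -
  have D: "((\<lambda>h. (\<phi> (x + h *\<^sub>R i) - \<phi> x) / h) \<longlongrightarrow> partial i \<phi> x) (at 0)"
    using smooth_line_derivative[OF assms(1), of x i 0] by (simp add: DERIV_def)
  have "(\<lambda>n. - X n) \<longlonglongrightarrow> - 0" by (intro tendsto_intros assms)
  then have "filterlim (\<lambda>n. - X n) (at 0) sequentially"
    using assms(3) by (auto simp: filterlim_at)
  from filterlim_compose[OF D this]
  have "(\<lambda>n. - ((\<phi> (x + (- X n) *\<^sub>R i) - \<phi> x) / (- X n))) \<longlonglongrightarrow> - partial i \<phi> x"
    by (rule tendsto_minus)
  then show ?thesis by simp
qed

text \<open>The quotients of the positive part are integrated against \<phi> and the limit is
  computed twice: with the quotient moved to \<phi>, and with the pointwise limit \<open>H\<close>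
  of the quotients themselves. The second computation is the delicate one, as the quotients of
  \<open>U\<close> converge to \<open>G\<close> only in L1 and come with no common integrable
  majorant.\<close>

lemma weak_deriv_pos_part_aux:
  fixes U G :: "'a::euclidean_space \<Rightarrow> real" and \<sigma> :: real
  assumes w: "weak_deriv i U G" and i: "i \<in> Basis" and \<sigma>: "\<sigma> \<noteq> 0" and \<phi>: "test_function UNIV \<phi>"
  defines "H \<equiv> \<lambda>x. if 0 < U x then G x else if U x < 0 then 0 else if 0 < \<sigma> then max (G x) 0 else min (G x) 0"
  shows "(LBINT x. max (U x) 0 * partial i \<phi> x) = - (LBINT x. H x * \<phi> x)"
proof -
  have int: "integrable lborel U" "integrable lborel G" using w by (auto simp: weak_deriv_def)
  then have [measurable]: "U \<in> borel_measurable borel" "G \<in> borel_measurable borel" by auto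
  have [measurable]: "H \<in> borel_measurable borel" unfolding H_def by measurable
  have sm: "smooth \<phi>" "smooth (partial i \<phi>)" using \<phi> i by (auto intro: test_functionD smooth_partial)
  then have [measurable]: "\<phi> \<in> borel_measurable borel" by (auto intro: smooth_borel_measurable)
  note d\<phi> = test_function_partial[OF \<phi> i]
  obtain B where B: "B > 0" "\<And>x. \<bar>\<phi> x\<bar> \<le> B" using test_function_bounded[OF \<phi>] by blast
  obtain B' where B': "B' > 0" "\<And>x. \<bar>partial i \<phi> x\<bar> \<le> B'" using test_function_bounded[OF d\<phi>] by blast
  have intp: "integrable lborel (\<lambda>x. max (U x) 0)" using int by auto
  define X where "X n = \<sigma> * inverse (real (Suc n))" for n
  have "X \<longlonglongrightarrow> \<sigma> * 0" unfolding X_def [abs_def] by (intro tendsto_intros LIMSEQ_inverse_real_of_nat)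
  then have X: "X \<longlonglongrightarrow> 0" by simp
  have sgn: "0 < X n * \<sigma>" for n
  proof -
    have "0 < \<sigma> * \<sigma>" using \<sigma> not_real_square_gt_zero[of \<sigma>] by blast
    then have "0 < (\<sigma> * \<sigma>) * inverse (real (Suc n))" by (rule mult_pos_pos) simp
    then show ?thesis by (simp add: X_def ac_simps)
  qed
  have X0: "X n \<noteq> 0" for n using sgn[of n] by auto
  define D where "D n x = (U (x + X n *\<^sub>R i) - U x) / X n" for n x
  define f where "f n x = (max (U (x + X n *\<^sub>R i)) 0 - max (U x) 0) / X n" for n x
  \<comment> \<open>\<open>k n\<close> is \<open>f n\<close> cut off at height
    \<open>\<bar>G\<bar>\<close>, which supplies the missing majorant. Since
    \<open>\<bar>f n x\<bar> \<le> \<bar>D n x\<bar>\<close>, the part cut off is at most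
    \<open>\<bar>D n x - G x\<bar>\<close> and so disappears in L1.\<close>
  define k where "k n x = max (- \<bar>G x\<bar>) (min \<bar>G x\<bar> (f n x))" for n x
  have [measurable]: "D n \<in> borel_measurable borel" "f n \<in> borel_measurable borel" "k n \<in> borel_measurable borel" for n
    unfolding D_def f_def k_def by measurable
  have intD: "integrable lborel (D n)" for n unfolding D_def
    by (intro integrable_divide Bochner_Integration.integrable_diff integrable_lborel_translate int)
  have intf: "integrable lborel (f n)" for n unfolding f_def
    by (intro integrable_divide Bochner_Integration.integrable_diff integrable_lborel_translate[OF intp] intp)
  have intk: "integrable lborel (k n)" for n
    by (rule Bochner_Integration.integrable_bound[OF int(2)]) (auto simp: k_def)

  have L1: "(\<lambda>n. \<integral>x. \<bar>D n x - G x\<bar> \<partial>lborel) \<longlonglongrightarrow> 0"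
  proof -
    have "(\<lambda>n. X n *\<^sub>R i) \<longlonglongrightarrow> 0 *\<^sub>R i" by (intro tendsto_intros X)
    then have "(\<lambda>n. \<integral>x. \<bar>line_avg (X n *\<^sub>R i) G x - G x\<bar> \<partial>lborel) \<longlonglongrightarrow> 0"
      by (intro line_avg_tendsto_L1 int) simp
    moreover have "(LBINT x. \<bar>D n x - G x\<bar>) = (LBINT x. \<bar>line_avg (X n *\<^sub>R i) G x - G x\<bar>)" for n
    proof (rule integral_cong_AE)
      show "AE x in lborel. \<bar>D n x - G x\<bar> = \<bar>line_avg (X n *\<^sub>R i) G x - G x\<bar>"
        using quotient_eq_line_avg[OF w i X0[of n]] by eventually_elim (simp add: D_def)
      show "(\<lambda>x. \<bar>line_avg (X n *\<^sub>R i) G x - G x\<bar>) \<in> borel_measurable lborel"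
        unfolding line_avg_def by measurable
    qed simp
    ultimately show ?thesis by simp
  qed
  \<comment> \<open>L1 convergence gives pointwise convergence only along a subsequence; both
    computations of the limit are restricted to it.\<close>
  have "\<exists>r::nat\<Rightarrow>nat. strict_mono r \<and> (AE x in lborel. (\<lambda>n. D (r n) x - G x) \<longlonglongrightarrow> 0)"
    using L1 intD int by (intro tendsto_L1_AE_subseq) auto
  then obtain r :: "nat \<Rightarrow> nat" where r: "strict_mono r" "AE x in lborel. (\<lambda>n. D (r n) x - G x) \<longlonglongrightarrow> 0"
    by blast
  have Xr: "(\<lambda>n. X (r n)) \<longlonglongrightarrow> 0" using LIMSEQ_subseq_LIMSEQ[OF X r(1)] by (simp add: o_def)
  have kH: "AE x in lborel. (\<lambda>n. k (r n) x) \<longlonglongrightarrow> H x"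
    using r(2)
  proof eventually_elim
    fix x assume "(\<lambda>n. D (r n) x - G x) \<longlonglongrightarrow> 0"
    then have "(\<lambda>n. D (r n) x) \<longlonglongrightarrow> G x" by (simp add: LIM_zero_iff)
    then have "(\<lambda>n. f (r n) x) \<longlonglongrightarrow> H x" unfolding D_def f_def H_def
      by (rule pos_part_quotient_tendsto[OF _ Xr sgn])
    then have "(\<lambda>n. k (r n) x) \<longlonglongrightarrow> max (- \<bar>G x\<bar>) (min \<bar>G x\<bar> (H x))"
      unfolding k_def by (intro tendsto_intros)
    \<comment> \<open>The limit \<open>H x\<close> already lies between the two cut-off
      levels.\<close>
    also have "max (- \<bar>G x\<bar>) (min \<bar>G x\<bar> (H x)) = H x" by (auto simp: H_def)
    finally show "(\<lambda>n. k (r n) x) \<longlonglongrightarrow> H x" .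
  qed
  have lim_k: "(\<lambda>n. \<integral>x. k (r n) x * \<phi> x \<partial>lborel) \<longlonglongrightarrow> (LBINT x. H x * \<phi> x)"
  proof (rule integral_dominated_convergence)
    show "integrable lborel (\<lambda>x. B * \<bar>G x\<bar>)" using int by simp
    show "AE x in lborel. (\<lambda>n. k (r n) x * \<phi> x) \<longlonglongrightarrow> H x * \<phi> x"
      using kH by eventually_elim (intro tendsto_intros)
    show "AE x in lborel. norm (k (r n) x * \<phi> x) \<le> B * \<bar>G x\<bar>" for n
    proof (rule AE_I2)
      fix x
      have "\<bar>k (r n) x\<bar> \<le> \<bar>G x\<bar>" by (auto simp: k_def)
      from mult_mono[OF this B(2)[of x]] show "norm (k (r n) x * \<phi> x) \<le> B * \<bar>G x\<bar>"
        by (simp add: abs_mult mult.commute)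
    qed
  qed measurable
  have "(\<lambda>n. (LBINT x. f n x * \<phi> x) - (LBINT x. k n x * \<phi> x)) \<longlonglongrightarrow> 0"
  proof (rule Lim_null_comparison)
    show "(\<lambda>n. B * (LBINT x. \<bar>D n x - G x\<bar>)) \<longlonglongrightarrow> 0"
      using L1 by (rule tendsto_mult_right_zero)
    show "\<forall>\<^sub>F n in sequentially. norm ((LBINT x. f n x * \<phi> x) - (LBINT x. k n x * \<phi> x)) \<le> B * (LBINT x. \<bar>D n x - G x\<bar>)"
    proof (intro always_eventually allI)
      fix n
      have "(LBINT x. f n x * \<phi> x) - (LBINT x. k n x * \<phi> x) = (LBINT x. f n x * \<phi> x - k n x * \<phi> x)"
        by (intro Bochner_Integration.integral_diff[symmetric] integrable_mult_test_function intf intk \<phi>)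
      then have "norm ((LBINT x. f n x * \<phi> x) - (LBINT x. k n x * \<phi> x)) \<le> (LBINT x. \<bar>f n x * \<phi> x - k n x * \<phi> x\<bar>)"
        by simp
      also have "\<dots> \<le> (LBINT x. B * \<bar>D n x - G x\<bar>)"
      proof (rule integral_mono)
        show "integrable lborel (\<lambda>x. \<bar>f n x * \<phi> x - k n x * \<phi> x\<bar>)"
          by (intro Bochner_Integration.integrable_abs Bochner_Integration.integrable_diff integrable_mult_test_function intf intk \<phi>)
        fix x
        have "\<bar>f n x\<bar> \<le> \<bar>D n x\<bar>" unfolding f_def D_def by (rule abs_pos_part_quotient_le)
        then have "\<bar>f n x - k n x\<bar> \<le> \<bar>D n x - G x\<bar>" unfolding k_def by linarith
        then have "\<bar>f n x - k n x\<bar> * \<bar>\<phi> x\<bar> \<le> \<bar>D n x - G x\<bar> * B"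
          by (intro mult_mono B(2)) auto
        then show "\<bar>f n x * \<phi> x - k n x * \<phi> x\<bar> \<le> B * \<bar>D n x - G x\<bar>"
          by (simp only: left_diff_distrib[symmetric] abs_mult mult.commute[of B])
      qed (use intD int in simp)
      finally show "norm ((LBINT x. f n x * \<phi> x) - (LBINT x. k n x * \<phi> x)) \<le> B * (LBINT x. \<bar>D n x - G x\<bar>)"
        by simp
    qed
  qed
  from LIMSEQ_subseq_LIMSEQ[OF this r(1)]
  have "(\<lambda>n. (LBINT x. f (r n) x * \<phi> x) - (LBINT x. k (r n) x * \<phi> x)) \<longlonglongrightarrow> 0"
    by (simp add: o_def)
  from tendsto_add[OF this lim_k]
  have 1: "(\<lambda>n. \<integral>x. f (r n) x * \<phi> x \<partial>lborel) \<longlonglongrightarrow> (LBINT x. H x * \<phi> x)" by simp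

  have f\<phi>: "(LBINT x. f n x * \<phi> x) = (LBINT x. max (U x) 0 * ((\<phi> (x - X n *\<^sub>R i) - \<phi> x) / X n))" for n
    unfolding f_def by (rule integral_quotient_shift[OF intp \<phi>])
  have dmeas: "(\<lambda>x. max (U x) 0 * (- partial i \<phi> x)) \<in> borel_measurable lborel"
    using smooth_borel_measurable[OF sm(2)] by (intro borel_measurable_times borel_measurable_uminus) auto
  have "(\<lambda>n. \<integral>x. max (U x) 0 * ((\<phi> (x - X n *\<^sub>R i) - \<phi> x) / X n) \<partial>lborel) \<longlonglongrightarrow> (LBINT x. max (U x) 0 * (- partial i \<phi> x))"
  proof (rule integral_dominated_convergence[OF dmeas])
    show "integrable lborel (\<lambda>x. max (U x) 0 * B')" using intp by simp
    show "AE x in lborel. (\<lambda>n. max (U x) 0 * ((\<phi> (x - X n *\<^sub>R i) - \<phi> x) / X n)) \<longlonglongrightarrow> max (U x) 0 * (- partial i \<phi> x)"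
      by (intro AE_I2 tendsto_mult tendsto_const test_function_quotient_tendsto sm X X0)
    show "AE x in lborel. norm (max (U x) 0 * ((\<phi> (x - X n *\<^sub>R i) - \<phi> x) / X n)) \<le> max (U x) 0 * B'" for n
    proof (rule AE_I2)
      fix x
      \<comment> \<open>The quotient of \<phi> is an average of its partial derivative and inherits
        the bound \<open>B'\<close>.\<close>
      have "\<phi> (x - X n *\<^sub>R i) - \<phi> x = - X n * line_avg ((- X n) *\<^sub>R i) (partial i \<phi>) x"
        using line_avg_partial[OF sm(1) i, of "- X n" x] by simp
      then have "\<bar>(\<phi> (x - X n *\<^sub>R i) - \<phi> x) / X n\<bar> = \<bar>line_avg ((- X n) *\<^sub>R i) (partial i \<phi>) x\<bar>"
        using X0[of n] by simp
      also have "\<dots> \<le> B'" by (rule abs_line_avg_le[OF B'(2)])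
      finally have "max (U x) 0 * \<bar>(\<phi> (x - X n *\<^sub>R i) - \<phi> x) / X n\<bar> \<le> max (U x) 0 * B'"
        by (rule mult_left_mono) simp
      then show "norm (max (U x) 0 * ((\<phi> (x - X n *\<^sub>R i) - \<phi> x) / X n)) \<le> max (U x) 0 * B'"
        by (simp only: real_norm_def abs_mult[of "max (U x) 0"] abs_of_nonneg max.cobounded2)
    qed
  qed measurable
  from LIMSEQ_subseq_LIMSEQ[OF this r(1)]
  have "(\<lambda>n. \<integral>x. f (r n) x * \<phi> x \<partial>lborel) \<longlonglongrightarrow> (LBINT x. max (U x) 0 * (- partial i \<phi> x))"
    by (simp add: o_def f\<phi>)
  from LIMSEQ_unique[OF this 1] show ?thesis by simp
qed

text \<open>On {U = 0} the two limits differ by \<open>max (G x) 0 - min (G x) 0\<close>, which is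
  \<open>\<bar>G x\<bar>\<close>. So uniqueness of weak derivatives gives the second claim, and this
  in turn allows \<open>H1\<close> to be replaced by the function in the first.\<close>

lemma weak_deriv_pos_part:
  fixes U G :: "'a::euclidean_space \<Rightarrow> real"
  assumes w: "weak_deriv i U G" and i: "i \<in> Basis"
  shows "weak_deriv i (\<lambda>x. max (U x) 0) (\<lambda>x. if 0 < U x then G x else 0)"
    and "AE x in lborel. U x = 0 \<longrightarrow> G x = 0"
proof -
  have int: "integrable lborel U" "integrable lborel G" using w by (auto simp: weak_deriv_def)
  then have [measurable]: "U \<in> borel_measurable borel" "G \<in> borel_measurable borel" by auto
  define H1 where "H1 x = (if 0 < U x then G x else if U x < 0 then 0 else max (G x) 0)" for x
  define H2 where "H2 x = (if 0 < U x then G x else if U x < 0 then 0 else min (G x) 0)" for x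
  have intH: "integrable lborel H1" "integrable lborel H2"
    unfolding H1_def H2_def
    by (rule Bochner_Integration.integrable_bound[OF int(2)]; auto)+
  have eq1: "(LBINT x. max (U x) 0 * partial i \<phi> x) = - (LBINT x. H1 x * \<phi> x)"
    and eq2: "(LBINT x. max (U x) 0 * partial i \<phi> x) = - (LBINT x. H2 x * \<phi> x)"
    if "test_function UNIV \<phi>" for \<phi>
  proof -
    show "(LBINT x. max (U x) 0 * partial i \<phi> x) = - (LBINT x. H1 x * \<phi> x)"
      by (subst weak_deriv_pos_part_aux[OF w i _ that, of 1])
        (auto simp: H1_def intro!: Bochner_Integration.integral_cong)
    show "(LBINT x. max (U x) 0 * partial i \<phi> x) = - (LBINT x. H2 x * \<phi> x)"
      by (subst weak_deriv_pos_part_aux[OF w i _ that, of "- 1"])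
        (auto simp: H2_def intro!: Bochner_Integration.integral_cong)
  qed
  have "AE x in lborel. H1 x - H2 x = 0"
  proof (rule fundamental_lemma_lborel)
    fix \<phi> :: "'a \<Rightarrow> real" assume \<phi>: "test_function UNIV \<phi>"
    have "(LBINT x. (H1 x - H2 x) * \<phi> x) = (LBINT x. H1 x * \<phi> x) - (LBINT x. H2 x * \<phi> x)"
      using integrable_mult_test_function[OF intH(1) \<phi>] integrable_mult_test_function[OF intH(2) \<phi>]
      by (simp add: left_diff_distrib)
    also have "\<dots> = 0" using eq1[OF \<phi>] eq2[OF \<phi>] by simp
    finally show "(LBINT x. (H1 x - H2 x) * \<phi> x) = 0" .
  qed (use intH in simp)
  then show AE: "AE x in lborel. U x = 0 \<longrightarrow> G x = 0"
    by eventually_elim (auto simp: H1_def H2_def max_def min_def split: if_splits)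
  show "weak_deriv i (\<lambda>x. max (U x) 0) (\<lambda>x. if 0 < U x then G x else 0)"
    unfolding weak_deriv_def
  proof (intro conjI allI impI)
    show "integrable lborel (\<lambda>x. max (U x) 0)" using int by simp
    show "integrable lborel (\<lambda>x. if 0 < U x then G x else 0)"
      by (rule Bochner_Integration.integrable_bound[OF int(2)]) auto
    fix \<phi> :: "'a \<Rightarrow> real" assume \<phi>: "test_function UNIV \<phi>"
    then have [measurable]: "\<phi> \<in> borel_measurable borel" by (intro smooth_borel_measurable test_functionD)
    have [measurable]: "H1 \<in> borel_measurable borel" using intH by auto
    have "(LBINT x. H1 x * \<phi> x) = (LBINT x. (if 0 < U x then G x else 0) * \<phi> x)"
      using AE by (intro integral_cong_AE) (auto simp: H1_def elim!: eventually_mono)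
    with eq1[OF \<phi>] show "(LBINT x. max (U x) 0 * partial i \<phi> x) = - (LBINT x. (if 0 < U x then G x else 0) * \<phi> x)"
      by simp
  qed
qed

section \<open>Distributional gradients on open sets\<close>

lemma smooth_measurable_lebesgue_on: "smooth f \<Longrightarrow> f \<in> borel_measurable (lebesgue_on T)"
  by (intro measurable_restrict_space1 measurable_completion) (simp add: smooth_borel_measurable)

lemma smooth_measurable_lebesgue: "smooth f \<Longrightarrow> f \<in> borel_measurable lebesgue"
  by (intro measurable_completion) (simp add: smooth_borel_measurable)

text \<open>Lebesgue measurable functions are exchanged for Borel representatives, to which
  \<open>weak_deriv\<close> applies; neither the integrals nor the second claim notice the null sets
  involved.\<close>

lemma lebesgue_pos_part:
  fixes U G :: "'a::euclidean_space \<Rightarrow> real"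
  assumes U: "integrable lebesgue U" and G: "integrable lebesgue G" and i: "i \<in> Basis"
    and w: "\<And>\<phi>. test_function UNIV \<phi> \<Longrightarrow> (LINT x|lebesgue. U x * partial i \<phi> x) = - (LINT x|lebesgue. G x * \<phi> x)"
  shows "\<And>\<phi>. test_function UNIV \<phi> \<Longrightarrow>
      (LINT x|lebesgue. max (U x) 0 * partial i \<phi> x) = - (LINT x|lebesgue. (if 0 < U x then G x else 0) * \<phi> x)"
    and "AE x in lebesgue. U x = 0 \<longrightarrow> G x = 0"
proof -
  obtain U' where U': "U' \<in> borel_measurable lborel" "AE x in lborel. U x = U' x"
    using completion_ex_borel_measurable_real[OF borel_measurable_integrable[OF U]] by auto
  obtain G' where G': "G' \<in> borel_measurable lborel" "AE x in lborel. G x = G' x"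
    using completion_ex_borel_measurable_real[OF borel_measurable_integrable[OF G]] by auto
  have AE: "AE x in lebesgue. U x = U' x" "AE x in lebesgue. G x = G' x"
    using U' G' by (auto intro: AE_completion)
  have [measurable]: "U \<in> borel_measurable lebesgue" "U' \<in> borel_measurable borel" "U' \<in> borel_measurable lebesgue"
     "G \<in> borel_measurable lebesgue" "G' \<in> borel_measurable borel" "G' \<in> borel_measurable lebesgue"
    using U G U' G' by (auto intro: measurable_completion)
  have "integrable lebesgue U'" using U AE by (subst integrable_cong_AE[symmetric, of U]) auto
  then have iU: "integrable lborel U'" by (simp add: integrable_completion)
  have "integrable lebesgue G'" using G AE by (subst integrable_cong_AE[symmetric, of G]) auto
  then have iG: "integrable lborel G'" by (simp add: integrable_completion)
  have eq: "(LINT x|lebesgue. f x * \<phi> x) = (LBINT x. f' x * \<phi> x)"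
    if f: "AE x in lebesgue. f x = f' x" "f \<in> borel_measurable lebesgue" "f' \<in> borel_measurable borel" and \<phi>: "smooth \<phi>"
    for f f' \<phi> :: "'a \<Rightarrow> real"
  proof -
    note [measurable] = f(2,3) smooth_measurable_lebesgue[OF \<phi>] smooth_borel_measurable[OF \<phi>]
    have [measurable]: "f' \<in> borel_measurable lebesgue" by (intro measurable_completion) simp
    have "(LINT x|lebesgue. f x * \<phi> x) = (LINT x|lebesgue. f' x * \<phi> x)"
      using f(1) by (intro integral_cong_AE) (auto elim: eventually_mono)
    also have "\<dots> = (LBINT x. f' x * \<phi> x)" by (intro integral_completion) simp
    finally show ?thesis .
  qed
  have wd: "weak_deriv i U' G'"
    unfolding weak_deriv_def
  proof (intro conjI allI impI iU iG)
    fix \<phi> :: "'a \<Rightarrow> real" assume \<phi>: "test_function UNIV \<phi>"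
    then have sm: "smooth \<phi>" "smooth (partial i \<phi>)" using i by (auto intro: test_functionD smooth_partial)
    show "(LBINT x. U' x * partial i \<phi> x) = - (LBINT x. G' x * \<phi> x)"
      using w[OF \<phi>] eq[OF AE(1) _ _ sm(2)] eq[OF AE(2) _ _ sm(1)] by simp
  qed
  have "AE x in lebesgue. U' x = 0 \<longrightarrow> G' x = 0"
    using weak_deriv_pos_part(2)[OF wd i] by (rule AE_completion)
  with AE show "AE x in lebesgue. U x = 0 \<longrightarrow> G x = 0" by eventually_elim auto
  fix \<phi> :: "'a \<Rightarrow> real" assume \<phi>: "test_function UNIV \<phi>"
  then have sm: "smooth \<phi>" "smooth (partial i \<phi>)" using i by (auto intro: test_functionD smooth_partial)
  have "(LINT x|lebesgue. max (U x) 0 * partial i \<phi> x) = (LBINT x. max (U' x) 0 * partial i \<phi> x)"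
    using AE(1) by (intro eq sm) (auto elim: eventually_mono)
  also have "\<dots> = - (LBINT x. (if 0 < U' x then G' x else 0) * \<phi> x)"
    using weak_deriv_pos_part(1)[OF wd i] \<phi> unfolding weak_deriv_def by blast
  also have "(LBINT x. (if 0 < U' x then G' x else 0) * \<phi> x) = (LINT x|lebesgue. (if 0 < U x then G x else 0) * \<phi> x)"
  proof (rule eq[symmetric, OF _ _ _ sm(1)])
    show "AE x in lebesgue. (if 0 < U x then G x else 0) = (if 0 < U' x then G' x else 0)"
      using AE by eventually_elim simp
  qed measurable
  finally show "(LINT x|lebesgue. max (U x) 0 * partial i \<phi> x) = - (LINT x|lebesgue. (if 0 < U x then G x else 0) * \<phi> x)" .
qed

section \<open>Calculus of distributional gradients\<close>

lemma locally_integrable_lincomb: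
  assumes "locally_integrable S u" "locally_integrable S v"
  shows "locally_integrable S (\<lambda>x. a *\<^sub>R u x + b *\<^sub>R v x)"
  using assms unfolding locally_integrable_def by auto

lemma locally_integrable_inner:
  "locally_integrable S g \<Longrightarrow> locally_integrable S (\<lambda>x. g x \<bullet> i)"
  unfolding locally_integrable_def by auto

lemma locally_integrable_mono: "locally_integrable S u \<Longrightarrow> S' \<subseteq> S \<Longrightarrow> locally_integrable S' u"
  unfolding locally_integrable_def by blast

lemma integrable_indicator_mult_test_function:
  assumes u: "locally_integrable S u" and \<phi>: "test_function S \<phi>"
  shows "integrable lebesgue (\<lambda>x. indicator S x * (u x * \<phi> x))"
proof -
  obtain K where K: "compact K" "K \<subseteq> S" "\<And>x. x \<notin> K \<Longrightarrow> \<phi> x = 0"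
    using \<phi> unfolding test_function_def by blast
  obtain B where B: "\<And>x. \<bar>\<phi> x\<bar> \<le> B" using test_function_bounded[OF \<phi>] by blast
  have "integrable lebesgue (\<lambda>x. (indicator K x *\<^sub>R u x) * \<phi> x)"
    by (rule integrable_mult_bounded[OF locally_integrable_indicator[OF u K(1,2)]
          smooth_measurable_lebesgue[OF test_functionD[OF \<phi>]] B])
  also have "(\<lambda>x. (indicator K x *\<^sub>R u x) * \<phi> x) = (\<lambda>x. indicator S x * (u x * \<phi> x))"
    using K(2,3) by (auto simp: fun_eq_iff split: split_indicator)
  finally show ?thesis .
qed

lemma integrable_on_mult_test_function:
  assumes "open S" "locally_integrable S u" "test_function S \<phi>"
  shows "integrable (lebesgue_on S) (\<lambda>x. u x * \<phi> x)"
  using integrable_indicator_mult_test_function[OF assms(2,3)] assms(1)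
  by (subst integrable_restrict_space) auto

lemma integral_lebesgue_on_open:
  fixes f :: "'a::euclidean_space \<Rightarrow> real"
  shows "open S \<Longrightarrow> (LINT x|lebesgue_on S. f x) = (LINT x|lebesgue. indicator S x * f x)"
  by (subst integral_restrict_space) auto

lemma AE_lebesgue_on_open: "open S \<Longrightarrow> (AE x in lebesgue_on S. P x) \<longleftrightarrow> (AE x in lebesgue. x \<in> S \<longrightarrow> P x)"
  by (subst AE_restrict_space_iff) auto

lemma distributional_gradientD:
  "distributional_gradient S u g \<Longrightarrow> test_function S \<phi> \<Longrightarrow> i \<in> Basis \<Longrightarrow>
    (LINT x|lebesgue_on S. u x * partial i \<phi> x) = - (LINT x|lebesgue_on S. (g x \<bullet> i) * \<phi> x)"
  unfolding distributional_gradient_def by blast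

lemma distributional_gradient_lincomb:
  assumes "open S" and u: "distributional_gradient S u gu" and v: "distributional_gradient S v gv"
  shows "distributional_gradient S (\<lambda>x. a * u x + b * v x) (\<lambda>x. a *\<^sub>R gu x + b *\<^sub>R gv x)"
  unfolding distributional_gradient_def
proof (intro conjI allI impI ballI)
  have li: "locally_integrable S u" "locally_integrable S v" "locally_integrable S gu" "locally_integrable S gv"
    using u v by (auto simp: distributional_gradient_def)
  show "locally_integrable S (\<lambda>x. a * u x + b * v x)"
    using locally_integrable_lincomb[OF li(1,2), of a b] by simp
  show "locally_integrable S (\<lambda>x. a *\<^sub>R gu x + b *\<^sub>R gv x)"
    using locally_integrable_lincomb[OF li(3,4)] .
  fix \<phi> :: "'a \<Rightarrow> real" and i :: 'a assume \<phi>: "test_function S \<phi>" and i: "i \<in> Basis"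
  note d\<phi> = test_function_partial[OF \<phi> i]
  note I = integrable_on_mult_test_function[OF assms(1) li(1) d\<phi>] integrable_on_mult_test_function[OF assms(1) li(2) d\<phi>]
    integrable_on_mult_test_function[OF assms(1) locally_integrable_inner[OF li(3), of i] \<phi>]
    integrable_on_mult_test_function[OF assms(1) locally_integrable_inner[OF li(4), of i] \<phi>]
  have "(LINT x|lebesgue_on S. (a * u x + b * v x) * partial i \<phi> x) =
     (LINT x|lebesgue_on S. a * (u x * partial i \<phi> x) + b * (v x * partial i \<phi> x))"
    by (intro Bochner_Integration.integral_cong) (auto simp: algebra_simps)
  also have "\<dots> = a * (LINT x|lebesgue_on S. u x * partial i \<phi> x) + b * (LINT x|lebesgue_on S. v x * partial i \<phi> x)"
    using I(1,2) by simp
  also have "\<dots> = a * - (LINT x|lebesgue_on S. (gu x \<bullet> i) * \<phi> x) + b * - (LINT x|lebesgue_on S. (gv x \<bullet> i) * \<phi> x)"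
    by (simp only: distributional_gradientD[OF u \<phi> i] distributional_gradientD[OF v \<phi> i])
  also have "\<dots> = - (LINT x|lebesgue_on S. a * ((gu x \<bullet> i) * \<phi> x) + b * ((gv x \<bullet> i) * \<phi> x))"
    using I(3,4) by simp
  also have "(LINT x|lebesgue_on S. a * ((gu x \<bullet> i) * \<phi> x) + b * ((gv x \<bullet> i) * \<phi> x)) =
     (LINT x|lebesgue_on S. ((a *\<^sub>R gu x + b *\<^sub>R gv x) \<bullet> i) * \<phi> x)"
    by (intro Bochner_Integration.integral_cong) (auto simp: algebra_simps inner_simps)
  finally show "(LINT x|lebesgue_on S. (a * u x + b * v x) * partial i \<phi> x) =
     - (LINT x|lebesgue_on S. ((a *\<^sub>R gu x + b *\<^sub>R gv x) \<bullet> i) * \<phi> x)" .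
qed

lemma distributional_gradient_diff:
  assumes "open S" "distributional_gradient S u gu" "distributional_gradient S v gv"
  shows "distributional_gradient S (\<lambda>x. u x - v x) (\<lambda>x. gu x - gv x)"
  using distributional_gradient_lincomb[OF assms, of 1 "- 1"] by simp

lemma AE_Basis_eqI:
  fixes g g' :: "'a \<Rightarrow> 'b::euclidean_space"
  assumes "\<And>i. i \<in> Basis \<Longrightarrow> AE x in M. P x \<longrightarrow> g x \<bullet> i = g' x \<bullet> i"
  shows "AE x in M. P x \<longrightarrow> g x = g' x"
proof -
  have "AE x in M. \<forall>i\<in>Basis. P x \<longrightarrow> g x \<bullet> i = g' x \<bullet> i"
    using assms by (intro AE_finite_allI) auto
  then show ?thesis by eventually_elim (auto intro: euclidean_eqI)
qed

lemma distributional_gradient_unique: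
  fixes g g' :: "'a::euclidean_space \<Rightarrow> 'a"
  assumes "open S" "distributional_gradient S u g" "distributional_gradient S u g'"
  shows "AE x in lebesgue_on S. g x = g' x"
proof -
  have "AE x in lebesgue_on S. True \<longrightarrow> g x = g' x"
  proof (rule AE_Basis_eqI)
    fix i :: 'a assume i: "i \<in> Basis"
    have li: "locally_integrable S g" "locally_integrable S g'"
      using assms by (auto simp: distributional_gradient_def)
    note li' = locally_integrable_inner[OF li(1), of i] locally_integrable_inner[OF li(2), of i]
    have "AE x in lebesgue_on S. g x \<bullet> i - g' x \<bullet> i = 0"
    proof (rule fundamental_lemma[OF assms(1)])
      show "locally_integrable S (\<lambda>x. g x \<bullet> i - g' x \<bullet> i)"
        using locally_integrable_lincomb[OF li', of 1 "- 1"] by simp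
      fix \<phi> :: "'a \<Rightarrow> real" assume \<phi>: "test_function S \<phi>"
      have "(LINT x|lebesgue_on S. (g x \<bullet> i - g' x \<bullet> i) * \<phi> x) =
         (LINT x|lebesgue_on S. (g x \<bullet> i) * \<phi> x) - (LINT x|lebesgue_on S. (g' x \<bullet> i) * \<phi> x)"
        using integrable_on_mult_test_function[OF assms(1) li'(1) \<phi>] integrable_on_mult_test_function[OF assms(1) li'(2) \<phi>]
        by (simp add: left_diff_distrib)
      moreover have "- (LINT x|lebesgue_on S. (g x \<bullet> i) * \<phi> x) = - (LINT x|lebesgue_on S. (g' x \<bullet> i) * \<phi> x)"
        using distributional_gradientD[OF assms(2) \<phi> i] distributional_gradientD[OF assms(3) \<phi> i] by simp
      ultimately show "(LINT x|lebesgue_on S. (g x \<bullet> i - g' x \<bullet> i) * \<phi> x) = 0" by simp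
    qed
    then show "AE x in lebesgue_on S. True \<longrightarrow> g x \<bullet> i = g' x \<bullet> i" by eventually_elim simp
  qed
  then show ?thesis by simp
qed

text \<open>\<open>grad\<close> is an arbitrary choice; this identity allows every estimate of
  \<open>grad S u\<close> to be made with whichever measurable gradient is at hand.\<close>

lemma grad_eq:
  assumes "open S" "distributional_gradient S u g"
  shows "AE x in lebesgue_on S. grad S u x = g x"
  unfolding grad_def
  by (rule distributional_gradient_unique[OF assms(1) someI[of "distributional_gradient S u", OF assms(2)] assms(2)])

lemma distributional_gradient_restrict:
  assumes "open S" "open S'" "S \<subseteq> S'" and u: "distributional_gradient S' u g"
  shows "distributional_gradient S u g"
  unfolding distributional_gradient_def
proof (intro conjI allI impI ballI)
  show "locally_integrable S u" "locally_integrable S g"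
    using u assms(3) by (auto simp: distributional_gradient_def intro: locally_integrable_mono)
  fix \<phi> :: "'a \<Rightarrow> real" and i :: 'a assume \<phi>: "test_function S \<phi>" and i: "i \<in> Basis"
  have eq: "(LINT x|lebesgue_on S. f x * \<psi> x) = (\<integral>x. f x * \<psi> x \<partial>lebesgue_on S')"
    if \<psi>: "test_function S \<psi>" for f \<psi> :: "'a \<Rightarrow> real"
  proof -
    have "\<psi> x = 0" if "x \<notin> S" for x using \<psi> that by (auto simp: test_function_def)
    then have "(\<lambda>x. indicator S x * (f x * \<psi> x)) = (\<lambda>x. indicator S' x * (f x * \<psi> x))"
      using assms(3) by (auto simp: fun_eq_iff split: split_indicator)
    then show ?thesis using assms(1,2) by (simp add: integral_lebesgue_on_open)
  qed
  show "(LINT x|lebesgue_on S. u x * partial i \<phi> x) = - (LINT x|lebesgue_on S. (g x \<bullet> i) * \<phi> x)"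
    unfolding eq[OF \<phi>] eq[OF test_function_partial[OF \<phi> i]]
    by (rule distributional_gradientD[OF u test_function_mono[OF \<phi> assms(3)] i])
qed

text \<open>The product rule as a passage from \<open>S\<close> to the whole space: the product with
  a cutoff is globally integrable and has the integrable weak derivative \<open>G\<close>. The
  identity holds for every smooth \<phi>, whatever its support, because the product of \<zeta> and
  \<phi> is a test function on \<open>S\<close>.\<close>

lemma cutoff_product:
  fixes u :: "'a::euclidean_space \<Rightarrow> real"
  assumes "open S" and u: "distributional_gradient S u g" and \<zeta>: "test_function S \<zeta>" and i: "i \<in> Basis"
  defines "U \<equiv> \<lambda>x. indicator S x * (u x * \<zeta> x)"
    and "G \<equiv> \<lambda>x. indicator S x * ((g x \<bullet> i) * \<zeta> x) + indicator S x * (u x * partial i \<zeta> x)"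
  shows "integrable lebesgue U" "integrable lebesgue G"
    and "\<And>\<phi>. smooth \<phi> \<Longrightarrow> (LINT x|lebesgue. U x * partial i \<phi> x) = - (LINT x|lebesgue. G x * \<phi> x)"
proof -
  have li: "locally_integrable S u" "locally_integrable S (\<lambda>x. g x \<bullet> i)"
    using u by (auto simp: distributional_gradient_def intro: locally_integrable_inner)
  note d\<zeta> = test_function_partial[OF \<zeta> i]
  note I = integrable_indicator_mult_test_function
  show "integrable lebesgue U" "integrable lebesgue G" unfolding U_def G_def
    by (intro Bochner_Integration.integrable_add I li \<zeta> d\<zeta>)+
  fix \<phi> :: "'a \<Rightarrow> real" assume \<phi>: "smooth \<phi>"
  note d\<phi> = smooth_partial[OF \<phi> i]
  note t = test_function_mult[OF \<zeta> \<phi>] test_function_mult[OF d\<zeta> \<phi>]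
  have "(LINT x|lebesgue. U x * partial i \<phi> x) =
    (LINT x|lebesgue. indicator S x * (u x * partial i (\<lambda>x. \<zeta> x * \<phi> x) x) - indicator S x * (u x * (partial i \<zeta> x * \<phi> x)))"
    unfolding U_def partial_mult[OF test_functionD[OF \<zeta>] \<phi>]
    by (intro Bochner_Integration.integral_cong) (auto simp: algebra_simps)
  also have "\<dots> = (LINT x|lebesgue. indicator S x * (u x * partial i (\<lambda>x. \<zeta> x * \<phi> x) x)) - (LINT x|lebesgue. indicator S x * (u x * (partial i \<zeta> x * \<phi> x)))"
    by (intro Bochner_Integration.integral_diff I li t test_function_partial[OF t(1) i])
  also have "(LINT x|lebesgue. indicator S x * (u x * partial i (\<lambda>x. \<zeta> x * \<phi> x) x)) = - (LINT x|lebesgue. indicator S x * ((g x \<bullet> i) * (\<zeta> x * \<phi> x)))"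
    using distributional_gradientD[OF u t(1) i] unfolding integral_lebesgue_on_open[OF assms(1)] .
  also have "\<dots> - (LINT x|lebesgue. indicator S x * (u x * (partial i \<zeta> x * \<phi> x))) =
     - ((LINT x|lebesgue. indicator S x * ((g x \<bullet> i) * (\<zeta> x * \<phi> x))) + (LINT x|lebesgue. indicator S x * (u x * (partial i \<zeta> x * \<phi> x))))"
    by simp
  also have "(LINT x|lebesgue. indicator S x * ((g x \<bullet> i) * (\<zeta> x * \<phi> x))) + (LINT x|lebesgue. indicator S x * (u x * (partial i \<zeta> x * \<phi> x))) =
     (LINT x|lebesgue. indicator S x * ((g x \<bullet> i) * (\<zeta> x * \<phi> x)) + indicator S x * (u x * (partial i \<zeta> x * \<phi> x)))"
    by (intro Bochner_Integration.integral_add[symmetric] I li t)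
  also have "\<dots> = (LINT x|lebesgue. G x * \<phi> x)" unfolding G_def
    by (intro Bochner_Integration.integral_cong) (auto simp: algebra_simps)
  finally show "(LINT x|lebesgue. U x * partial i \<phi> x) = - (LINT x|lebesgue. G x * \<phi> x)" .
qed

lemma locally_integrable_bound:
  fixes u :: "'a::euclidean_space \<Rightarrow> 'b::euclidean_space" and v :: "'a \<Rightarrow> 'c::euclidean_space"
  assumes "locally_integrable S u" "v \<in> borel_measurable (lebesgue_on S)" "open S" "\<And>x. norm (v x) \<le> norm (u x)"
  shows "locally_integrable S v"
  unfolding locally_integrable_def
proof (intro allI impI)
  fix K assume K: "compact K" "K \<subseteq> S"
  then have "integrable (lebesgue_on K) u" using assms(1) unfolding locally_integrable_def by blast
  moreover have "v \<in> borel_measurable (lebesgue_on K)"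
    using K assms(2,3) measurable_restrict_mono by blast
  ultimately show "integrable (lebesgue_on K) v"
    by (rule Bochner_Integration.integrable_bound) (use assms(4) in auto)
qed

text \<open>Both claims are local: a cutoff that is 1 around a compact set changes nothing there,
  and the product lives on the whole space, where \<open>lebesgue_pos_part\<close> applies. The
  compact set is a support of the test function in the first claim, and one of countably many closed
  boxes in the second.\<close>

lemma distributional_gradient_pos_part:
  fixes u :: "'a::euclidean_space \<Rightarrow> real"
  assumes "open S" and u: "distributional_gradient S u g"
    and m: "u \<in> borel_measurable (lebesgue_on S)" "g \<in> borel_measurable (lebesgue_on S)"
  shows "distributional_gradient S (\<lambda>x. max (u x) 0) (\<lambda>x. if 0 < u x then g x else 0)"
    and "AE x in lebesgue_on S. u x = 0 \<longrightarrow> g x = 0"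
proof -
  note [measurable] = m
  have li: "locally_integrable S u" "locally_integrable S g"
    using u by (auto simp: distributional_gradient_def)
  have "AE x in lebesgue_on S. u x = 0 \<longrightarrow> g x = 0"
  proof (rule AE_Basis_eqI)
    fix i :: 'a assume i: "i \<in> Basis"
    have cb: "AE x in lebesgue. x \<in> cbox c d \<longrightarrow> u x = 0 \<longrightarrow> g x \<bullet> i = 0" if cd: "cbox c d \<subseteq> S" for c d
    proof -
      obtain \<zeta> V where \<zeta>: "test_function S \<zeta>" "open V" "cbox c d \<subseteq> V" "\<And>x. x \<in> V \<Longrightarrow> \<zeta> x = 1"
        using cutoff_exists[OF compact_cbox assms(1) cd] by blast
      note C = cutoff_product[OF assms(1) u \<zeta>(1) i]
      have "AE x in lebesgue. indicator S x * (u x * \<zeta> x) = 0 \<longrightarrow>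
          indicator S x * ((g x \<bullet> i) * \<zeta> x) + indicator S x * (u x * partial i \<zeta> x) = 0"
        by (rule lebesgue_pos_part(2)[OF C(1,2) i C(3)]) (auto intro: test_functionD)
      then show ?thesis
      proof eventually_elim
        fix x assume *: "indicator S x * (u x * \<zeta> x) = 0 \<longrightarrow>
          indicator S x * ((g x \<bullet> i) * \<zeta> x) + indicator S x * (u x * partial i \<zeta> x) = 0"
        \<comment> \<open>The term with the derivative of \<zeta> carries the factor
          \<open>u x\<close>, which is 0 in this case.\<close>
        show "x \<in> cbox c d \<longrightarrow> u x = 0 \<longrightarrow> g x \<bullet> i = 0"
          using * \<zeta>(3,4) cd by auto
      qed
    qed
    obtain D where D: "countable D" "D \<subseteq> Pow S" "\<And>X. X \<in> D \<Longrightarrow> \<exists>a b. X = cbox a b" "\<Union>D = S"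
      using open_countable_Union_open_cbox[OF assms(1)] by blast
    have "AE x in lebesgue. \<forall>X\<in>D. x \<in> X \<longrightarrow> u x = 0 \<longrightarrow> g x \<bullet> i = 0"
      unfolding AE_ball_countable[OF D(1)]
    proof
      fix X assume X: "X \<in> D"
      then obtain c d where "X = cbox c d" using D(3) by blast
      with X D(2) cb[of c d] show "AE x in lebesgue. x \<in> X \<longrightarrow> u x = 0 \<longrightarrow> g x \<bullet> i = 0" by auto
    qed
    then have "AE x in lebesgue. x \<in> S \<longrightarrow> u x = 0 \<longrightarrow> g x \<bullet> i = 0"
      by eventually_elim (use D(4) in blast)
    then show "AE x in lebesgue_on S. u x = 0 \<longrightarrow> g x \<bullet> i = 0 \<bullet> i"
      using assms(1) by (simp add: AE_lebesgue_on_open)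
  qed
  then show "AE x in lebesgue_on S. u x = 0 \<longrightarrow> g x = 0" .
  show "distributional_gradient S (\<lambda>x. max (u x) 0) (\<lambda>x. if 0 < u x then g x else 0)"
    unfolding distributional_gradient_def
  proof (intro conjI allI impI ballI)
    show "locally_integrable S (\<lambda>x. max (u x) 0)"
      by (rule locally_integrable_bound[OF li(1) _ assms(1)]) auto
    show "locally_integrable S (\<lambda>x. if 0 < u x then g x else 0)"
      by (rule locally_integrable_bound[OF li(2) _ assms(1)]) auto
    fix \<phi> :: "'a \<Rightarrow> real" and i :: 'a assume \<phi>: "test_function S \<phi>" and i: "i \<in> Basis"
    obtain K where K: "compact K" "K \<subseteq> S" "\<And>x. x \<notin> K \<Longrightarrow> \<phi> x = 0"
      using \<phi> unfolding test_function_def by blast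
    have K': "partial i \<phi> x = 0" if "x \<notin> K" for x
      using that K compact_imp_closed by (intro partial_eq_0_open[of "- K" x \<phi> 0]) auto
    obtain \<zeta> V where \<zeta>: "test_function S \<zeta>" "open V" "K \<subseteq> V" "\<And>x. x \<in> V \<Longrightarrow> \<zeta> x = 1"
      using cutoff_exists[OF K(1) assms(1) K(2)] by blast
    have d\<zeta>: "partial i \<zeta> x = 0" if "x \<in> K" for x
      using that \<zeta> by (intro partial_eq_0_open[of V x \<zeta> 1]) auto
    note C = cutoff_product[OF assms(1) u \<zeta>(1) i]
    let ?U = "\<lambda>x. indicator S x * (u x * \<zeta> x)"
    let ?G = "\<lambda>x. indicator S x * ((g x \<bullet> i) * \<zeta> x) + indicator S x * (u x * partial i \<zeta> x)"
    have "(LINT x|lebesgue. max (?U x) 0 * partial i \<phi> x) = - (LINT x|lebesgue. (if 0 < ?U x then ?G x else 0) * \<phi> x)"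
      by (rule lebesgue_pos_part(1)[OF C(1,2) i C(3)]) (auto intro: test_functionD test_function_mono[OF \<phi>])
    moreover have "max (?U x) 0 * partial i \<phi> x = indicator S x * (max (u x) 0 * partial i \<phi> x)" for x
      using K K' \<zeta>(3,4) by (cases "x \<in> K") (auto split: split_indicator)
    moreover have "(if 0 < ?U x then ?G x else 0) * \<phi> x = indicator S x * (((if 0 < u x then g x else 0) \<bullet> i) * \<phi> x)" for x
      using K \<zeta>(3,4) d\<zeta> by (cases "x \<in> K") (auto split: split_indicator)
    ultimately show "(LINT x|lebesgue_on S. max (u x) 0 * partial i \<phi> x) = - (LINT x|lebesgue_on S. ((if 0 < u x then g x else 0) \<bullet> i) * \<phi> x)"
      using assms(1) by (simp add: integral_lebesgue_on_open)
  qed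
qed

lemma integrable_lebesgue_imp_locally_integrable:
  fixes f :: "'a::euclidean_space \<Rightarrow> 'b::euclidean_space"
  assumes "integrable lebesgue f"
  shows "locally_integrable S f"
  unfolding locally_integrable_def
proof (intro allI impI)
  fix K :: "'a set" assume "compact K"
  then have "K \<in> sets lebesgue" by (simp add: fmeasurableD lmeasurable_compact)
  then show "integrable (lebesgue_on K) f"
    using integrable_mult_indicator[OF _ assms, of K] by (subst integrable_restrict_space) auto
qed

text \<open>Outside \<open>K\<close> not only \<open>v\<close> but also \<open>g\<close> vanishes
  almost everywhere, because gradients vanish on zero sets. A cutoff that is 1 around
  \<open>K\<close> therefore changes neither of them, and \<open>cutoff_product\<close> integrates
  by parts against test functions that are not supported in \<open>S\<close>.\<close>

lemma distributional_gradient_zero_extension: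
  fixes v :: "'a::euclidean_space \<Rightarrow> real"
  assumes "open S" and v: "distributional_gradient S v g"
    and m: "v \<in> borel_measurable (lebesgue_on S)" "g \<in> borel_measurable (lebesgue_on S)"
    and K: "compact K" "K \<subseteq> S" and 0: "AE x in lebesgue_on S. x \<notin> K \<longrightarrow> v x = 0"
  shows "distributional_gradient UNIV (\<lambda>x. indicator S x * v x) (\<lambda>x. indicator S x *\<^sub>R g x)"
proof -
  have [measurable]: "S \<in> sets lebesgue" using assms(1) by simp
  have mv [measurable]: "(\<lambda>x. indicator S x * v x) \<in> borel_measurable lebesgue"
    using borel_measurable_restrict_space_iff[of S lebesgue v] m(1) by (simp add: mult.commute)
  have mg [measurable]: "(\<lambda>x. indicator S x *\<^sub>R g x) \<in> borel_measurable lebesgue"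
    using borel_measurable_restrict_space_iff[of S lebesgue g] m(2) by simp
  obtain \<zeta> V where \<zeta>: "test_function S \<zeta>" "open V" "K \<subseteq> V" "\<And>x. x \<in> V \<Longrightarrow> \<zeta> x = 1"
    using cutoff_exists[OF K(1) assms(1) K(2)] by blast
  let ?V = "\<lambda>x. indicator S x * (v x * \<zeta> x)"
  let ?G = "\<lambda>i x. indicator S x * ((g x \<bullet> i) * \<zeta> x) + indicator S x * (v x * partial i \<zeta> x)"
  have "AE x in lebesgue_on S. v x = 0 \<longrightarrow> g x = 0"
    by (rule distributional_gradient_pos_part(2)[OF assms(1) v m])
  with 0 have 0: "AE x in lebesgue. x \<in> S \<longrightarrow> x \<notin> K \<longrightarrow> v x = 0 \<and> g x = 0"
    using assms(1) unfolding AE_lebesgue_on_open[OF assms(1)] by eventually_elim auto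
  have AE_v: "AE x in lebesgue. ?V x = indicator S x * v x"
    using 0 by eventually_elim (use \<zeta>(3,4) in \<open>auto split: split_indicator\<close>)
  have AE_g: "AE x in lebesgue. ?G i x = (indicator S x *\<^sub>R g x) \<bullet> i"
    for i
  proof -
    have d\<zeta>: "partial i \<zeta> x = 0" if "x \<in> K" for x
      using that \<zeta> by (intro partial_eq_0_open[of V x \<zeta> 1]) auto
    show ?thesis using 0 by eventually_elim (use \<zeta>(3,4) d\<zeta> in \<open>auto split: split_indicator\<close>)
  qed
  \<comment> \<open>The integrability of the product does not involve a direction, so any basis
    vector serves.\<close>
  have iv: "integrable lebesgue (\<lambda>x. indicator S x * v x)"
    by (rule integrable_cong_AE_imp[OF cutoff_product(1)[OF assms(1) v \<zeta>(1) SOME_Basis] mv AE_v])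
  have igi: "integrable lebesgue (\<lambda>x. (indicator S x *\<^sub>R g x) \<bullet> i)" if i: "i \<in> Basis" for i
  proof (rule integrable_cong_AE_imp[OF cutoff_product(2)[OF assms(1) v \<zeta>(1) i] _ AE_g])
    show "(\<lambda>x. (indicator S x *\<^sub>R g x) \<bullet> i) \<in> borel_measurable lebesgue"
      by (intro borel_measurable_inner mg borel_measurable_const)
  qed
  have "integrable lebesgue (\<lambda>x. \<Sum>i\<in>Basis. ((indicator S x *\<^sub>R g x) \<bullet> i) *\<^sub>R i)"
    by (intro Bochner_Integration.integrable_sum integrable_scaleR_left igi)
  then have ig: "integrable lebesgue (\<lambda>x. indicator S x *\<^sub>R g x)"
    by (simp only: euclidean_representation)
  show ?thesis
    unfolding distributional_gradient_def
  proof (intro conjI allI impI ballI integrable_lebesgue_imp_locally_integrable iv ig)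
    fix \<phi> :: "'a \<Rightarrow> real" and i :: 'a assume \<phi>: "test_function UNIV \<phi>" and i: "i \<in> Basis"
    have sm: "smooth \<phi>" "smooth (partial i \<phi>)" using \<phi> i by (auto intro: test_functionD smooth_partial)
    note C = cutoff_product[OF assms(1) v \<zeta>(1) i]
    have "(LINT x|lebesgue. indicator S x * v x * partial i \<phi> x) = (LINT x|lebesgue. ?V x * partial i \<phi> x)"
    proof (rule integral_cong_AE)
      show "(\<lambda>x. indicator S x * v x * partial i \<phi> x) \<in> borel_measurable lebesgue"
        by (intro borel_measurable_times mv smooth_measurable_lebesgue sm)
      show "(\<lambda>x. ?V x * partial i \<phi> x) \<in> borel_measurable lebesgue"
        by (intro borel_measurable_times[OF borel_measurable_integrable[OF C(1)]] smooth_measurable_lebesgue sm)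
    qed (use AE_v in \<open>eventually_elim, simp\<close>)
    also have "\<dots> = - (LINT x|lebesgue. (?G i x) * \<phi> x)"
      by (rule C(3)[OF sm(1)])
    also have "(LINT x|lebesgue. (?G i x) * \<phi> x) =
      (LINT x|lebesgue. ((indicator S x *\<^sub>R g x) \<bullet> i) * \<phi> x)"
    proof (rule integral_cong_AE)
      show "(\<lambda>x. (?G i x) * \<phi> x) \<in> borel_measurable lebesgue"
        by (intro borel_measurable_times[OF borel_measurable_integrable[OF C(2)]] smooth_measurable_lebesgue sm)
      show "(\<lambda>x. ((indicator S x *\<^sub>R g x) \<bullet> i) * \<phi> x) \<in> borel_measurable lebesgue"
        using smooth_measurable_lebesgue[OF sm(1)] by (intro borel_measurable_times borel_measurable_inner mg) auto
    qed (use AE_g[of i] in \<open>eventually_elim, simp\<close>)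
    finally show "(LINT x|lebesgue_on UNIV. indicator S x * v x * partial i \<phi> x) = - (LINT x|lebesgue_on UNIV. ((indicator S x *\<^sub>R g x) \<bullet> i) * \<phi> x)"
      by (simp add: lebesgue_on_UNIV_eq)
  qed
qed

section \<open>Variable exponent spaces\<close>

text \<open>A sum is at most twice the maximum, and the power of a maximum is at most the sum of the
  powers. Raising the constant to the exponent \<open>P\<close> makes it independent of
  \<open>q\<close>.\<close>

lemma powr_add_bound:
  fixes a b c q :: real
  assumes "0 \<le> a" "a \<le> C * (b + c)" "0 \<le> b" "0 \<le> c" "1 \<le> C" "0 \<le> q" "q \<le> P"
  shows "a powr q \<le> (2 * C) powr P * (b powr q + c powr q)"
proof -
  have "a \<le> (2 * C) * max b c"
  proof -
    have "C * (b + c) \<le> C * (2 * max b c)" using assms(5) by (intro mult_left_mono) auto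
    with assms(2) show ?thesis by simp
  qed
  then have "a powr q \<le> ((2 * C) * max b c) powr q"
    using assms by (intro powr_mono2) auto
  also have "\<dots> = (2 * C) powr q * max b c powr q"
    by (rule powr_mult)
  also have "\<dots> \<le> (2 * C) powr P * (b powr q + c powr q)"
    using assms by (intro mult_mono powr_mono) (auto simp: max_def)
  finally show ?thesis .
qed

text \<open>With these bounds the modular is finite exactly when the norm is, and both have the same
  null sequences.\<close>

locale bounded_exponent =
  fixes p :: "'a::euclidean_space \<Rightarrow> real" and P :: real
  assumes p_measurable: "p \<in> borel_measurable lebesgue"
    and p_ge_1: "\<And>x. 1 \<le> p x"
    and p_le: "AE x in lebesgue. p x \<le> P"
    and P_ge_1: "1 \<le> P"
begin

lemma p_measurable_on [measurable]: "p \<in> borel_measurable (lebesgue_on S)"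
  using p_measurable by (rule measurable_restrict_space1)

lemma p_le_on: "open S \<Longrightarrow> AE x in lebesgue_on S. p x \<le> P"
  unfolding AE_lebesgue_on_open using p_le by eventually_elim simp

lemma p_pos: "0 < p x"
  using p_ge_1[of x] by linarith

lemma modular_mono:
  assumes "AE x in lebesgue_on S. norm (u x) \<le> norm (v x)"
  shows "modular p S u \<le> modular p S v"
  unfolding modular_def
proof (rule nn_integral_mono_AE)
  show "AE x in lebesgue_on S. ennreal (norm (u x) powr p x) \<le> ennreal (norm (v x) powr p x)"
    using assms by eventually_elim (intro ennreal_leI powr_mono2, use p_pos in \<open>auto intro: less_imp_le\<close>)
qed

lemma modular_cong:
  assumes "AE x in lebesgue_on S. u x = v x"
  shows "modular p S u = modular p S v"
  unfolding modular_def
proof (rule nn_integral_cong_AE)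
  show "AE x in lebesgue_on S. ennreal (norm (u x) powr p x) = ennreal (norm (v x) powr p x)"
    using assms by eventually_elim simp
qed

lemma lux_norm_cong:
  assumes "AE x in lebesgue_on S. u x = v x"
  shows "lux_norm p S u = lux_norm p S v"
proof -
  have "modular p S (\<lambda>x. u x /\<^sub>R l) = modular p S (\<lambda>x. v x /\<^sub>R l)" for l
    by (rule modular_cong) (use assms in \<open>eventually_elim, simp\<close>)
  then show ?thesis by (simp add: lux_norm_def)
qed

text \<open>This quasi-triangle inequality takes the place of subadditivity, which the modular
  lacks. Its pointwise hypothesis also covers truncated functions and functions with values in
  different spaces.\<close>

lemma modular_bound:
  fixes u :: "'a \<Rightarrow> 'b::real_normed_vector" and v :: "'a \<Rightarrow> 'c::euclidean_space" and w :: "'a \<Rightarrow> 'd::euclidean_space"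
  assumes "open S" and [measurable]: "v \<in> borel_measurable (lebesgue_on S)" "w \<in> borel_measurable (lebesgue_on S)"
    and C: "1 \<le> C" and bd: "AE x in lebesgue_on S. norm (u x) \<le> C * (norm (v x) + norm (w x))"
  shows "modular p S u \<le> ennreal ((2 * C) powr P) * (modular p S v + modular p S w)"
proof -
  have "modular p S u \<le> (\<integral>\<^sup>+ x. ennreal ((2 * C) powr P) * (ennreal (norm (v x) powr p x) + ennreal (norm (w x) powr p x)) \<partial>lebesgue_on S)"
    unfolding modular_def
  proof (rule nn_integral_mono_AE)
    show "AE x in lebesgue_on S. ennreal (norm (u x) powr p x) \<le>
       ennreal ((2 * C) powr P) * (ennreal (norm (v x) powr p x) + ennreal (norm (w x) powr p x))"
      using bd p_le_on[OF assms(1)]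
    proof eventually_elim
      fix x assume *: "norm (u x) \<le> C * (norm (v x) + norm (w x))" "p x \<le> P"
      have "norm (u x) powr p x \<le> (2 * C) powr P * (norm (v x) powr p x + norm (w x) powr p x)"
        using * C p_pos[of x] by (intro powr_add_bound) auto
      then show "ennreal (norm (u x) powr p x) \<le>
       ennreal ((2 * C) powr P) * (ennreal (norm (v x) powr p x) + ennreal (norm (w x) powr p x))"
        by (simp add: ennreal_leI flip: ennreal_plus ennreal_mult)
    qed
  qed
  also have "\<dots> = ennreal ((2 * C) powr P) * (modular p S v + modular p S w)"
    unfolding modular_def
    by (subst nn_integral_cmult, measurable, subst nn_integral_add) auto
  finally show ?thesis .
qed

lemma modular_scaleR:
  assumes "0 < l"
  shows "modular p S (\<lambda>x. u x /\<^sub>R l) = (\<integral>\<^sup>+ x. ennreal (norm (u x) powr p x / l powr p x) \<partial>lebesgue_on S)"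
  unfolding modular_def using assms
  by (intro nn_integral_cong) (simp add: powr_divide flip: divide_inverse_commute)

text \<open>Some admissible \<open>l\<close> lies below \<open>c \<le> 1\<close>. As the exponent is
  at least 1, \<open>l powr p x \<le> l\<close>, so undoing the scaling multiplies the modular by at
  most \<open>c\<close>.\<close>

lemma modular_le_of_lux_norm_less:
  fixes u :: "'a \<Rightarrow> 'b::euclidean_space"
  assumes [measurable]: "u \<in> borel_measurable (lebesgue_on S)" and "0 < c" "c \<le> 1" "lux_norm p S u < ennreal c"
  shows "modular p S u \<le> ennreal c"
proof -
  obtain l where l: "0 < l" "modular p S (\<lambda>x. u x /\<^sub>R l) \<le> 1" "ennreal l < ennreal c"
    using assms(4) unfolding lux_norm_def INF_less_iff by blast
  then have lc: "l < c" by (simp add: ennreal_less_iff)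
  have "modular p S u \<le> (\<integral>\<^sup>+ x. ennreal c * ennreal (norm (u x) powr p x / l powr p x) \<partial>lebesgue_on S)"
    unfolding modular_def
  proof (rule nn_integral_mono)
    fix x
    have "l powr p x \<le> l powr 1"
      using l lc assms(3) p_ge_1[of x] by (intro powr_mono') auto
    then have "l powr p x \<le> c" using l lc by simp
    then have "norm (u x) powr p x \<le> c * (norm (u x) powr p x / l powr p x)"
      using l(1) mult_right_mono[of "l powr p x" c "norm (u x) powr p x"] by (simp add: field_simps)
    then show "ennreal (norm (u x) powr p x) \<le> ennreal c * ennreal (norm (u x) powr p x / l powr p x)"
      using assms(2) by (simp add: ennreal_leI flip: ennreal_mult)
  qed
  also have "\<dots> = ennreal c * modular p S (\<lambda>x. u x /\<^sub>R l)"
    unfolding modular_scaleR[OF l(1)] by (rule nn_integral_cmult) measurable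
  also have "\<dots> \<le> ennreal c * 1" using l(2) by (intro mult_left_mono) auto
  finally show ?thesis by simp
qed

text \<open>Here \<open>c\<close> itself is admissible in the infimum, since
  \<open>c powr p x\<close> is at least \<open>c powr P\<close> for
  \<open>c \<le> 1\<close>.\<close>

lemma lux_norm_le_of_modular_le:
  fixes u :: "'a \<Rightarrow> 'b::euclidean_space"
  assumes "open S" and [measurable]: "u \<in> borel_measurable (lebesgue_on S)"
    and c: "0 < c" "c \<le> 1" and m: "modular p S u \<le> ennreal (c powr P)"
  shows "lux_norm p S u \<le> ennreal c"
proof -
  have "modular p S (\<lambda>x. u x /\<^sub>R c) \<le> (\<integral>\<^sup>+ x. ennreal (1 / c powr P) * ennreal (norm (u x) powr p x) \<partial>lebesgue_on S)"
    unfolding modular_scaleR[OF c(1)]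
  proof (rule nn_integral_mono_AE)
    show "AE x in lebesgue_on S. ennreal (norm (u x) powr p x / c powr p x) \<le> ennreal (1 / c powr P) * ennreal (norm (u x) powr p x)"
      using p_le_on[OF assms(1)]
    proof eventually_elim
      fix x assume "p x \<le> P"
      then have "c powr P \<le> c powr p x" using c by (intro powr_mono') auto
      then have "norm (u x) powr p x / c powr p x \<le> norm (u x) powr p x / c powr P"
        using c(1) by (intro divide_left_mono mult_pos_pos) auto
      then show "ennreal (norm (u x) powr p x / c powr p x) \<le> ennreal (1 / c powr P) * ennreal (norm (u x) powr p x)"
        by (simp add: ennreal_leI flip: ennreal_mult)
    qed
  qed
  also have "\<dots> = ennreal (1 / c powr P) * modular p S u"
    unfolding modular_def by (rule nn_integral_cmult) measurable
  also have "\<dots> \<le> ennreal (1 / c powr P) * ennreal (c powr P)" by (intro mult_left_mono m) auto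
  also have "\<dots> = 1" using c(1) by (simp flip: ennreal_mult)
  finally show ?thesis
    unfolding lux_norm_def using c(1) by (intro INF_lower) auto
qed

lemma lux_norm_finite_iff:
  fixes u :: "'a \<Rightarrow> 'b::euclidean_space"
  assumes "open S" and [measurable]: "u \<in> borel_measurable (lebesgue_on S)"
  shows "lux_norm p S u < \<infinity> \<longleftrightarrow> modular p S u < \<infinity>"
proof
  assume "lux_norm p S u < \<infinity>"
  then obtain l where l: "0 < l" "modular p S (\<lambda>x. u x /\<^sub>R l) \<le> 1"
    unfolding lux_norm_def INF_less_iff by blast
  have "modular p S u \<le> ennreal ((2 * max 1 l) powr P) * (modular p S (\<lambda>x. u x /\<^sub>R l) + modular p S (\<lambda>x. 0::real))"
  proof (rule modular_bound[OF assms(1)])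
    have "norm (u x) \<le> max 1 l * (norm (u x) / l)" for x
      using l(1) mult_right_mono[of l "max 1 l" "norm (u x) / l"] by (simp add: field_simps)
    then show "AE x in lebesgue_on S. norm (u x) \<le> max 1 l * (norm (u x /\<^sub>R l) + norm (0::real))"
      using l(1) by (intro AE_I2) (simp add: divide_inverse_commute)
  qed auto
  also have "\<dots> < \<infinity>" using l(2) by (auto simp: modular_def ennreal_mult_less_top intro: le_less_trans)
  finally show "modular p S u < \<infinity>" .
next
  assume fin: "modular p S u < \<infinity>"
  \<comment> \<open>For \<open>l \<ge> 1\<close> scaling by \<open>l\<close> divides the modular by
    at least \<open>l\<close>, so a number that is at least 1 and at least the modular is
    admissible.\<close>
  define l where "l = max 1 (enn2real (modular p S u))"
  have l: "1 \<le> l" "modular p S u \<le> ennreal l"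
    using fin by (auto simp: l_def intro: order_trans[OF _ ennreal_leI, of _ "enn2real (modular p S u)"])
  have "modular p S (\<lambda>x. u x /\<^sub>R l) \<le> (\<integral>\<^sup>+ x. ennreal (1 / l) * ennreal (norm (u x) powr p x) \<partial>lebesgue_on S)"
    unfolding modular_scaleR[OF less_le_trans[OF zero_less_one l(1)]]
  proof (rule nn_integral_mono)
    fix x
    have "l powr 1 \<le> l powr p x" using l(1) p_ge_1 by (intro powr_mono) auto
    then have "l \<le> l powr p x" using l(1) by simp
    then have "norm (u x) powr p x / l powr p x \<le> norm (u x) powr p x / l"
      using l(1) by (intro divide_left_mono mult_pos_pos) auto
    then show "ennreal (norm (u x) powr p x / l powr p x) \<le> ennreal (1 / l) * ennreal (norm (u x) powr p x)"
      using l(1) by (simp add: ennreal_leI flip: ennreal_mult)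
  qed
  also have "\<dots> = ennreal (1 / l) * modular p S u"
    unfolding modular_def by (rule nn_integral_cmult) measurable
  also have "\<dots> \<le> ennreal (1 / l) * ennreal l" by (intro mult_left_mono l) auto
  also have "\<dots> = 1" using l(1) by (simp flip: ennreal_mult)
  finally have "lux_norm p S u \<le> ennreal l"
    unfolding lux_norm_def using l(1) by (intro INF_lower) auto
  then show "lux_norm p S u < \<infinity>" by (rule le_less_trans) simp
qed

lemma Lp_var_iff:
  fixes u :: "'a \<Rightarrow> 'b::euclidean_space"
  assumes "open S"
  shows "u \<in> Lp_var p S \<longleftrightarrow> u \<in> borel_measurable (lebesgue_on S) \<and> modular p S u < \<infinity>"
  using lux_norm_finite_iff[OF assms] by (auto simp: Lp_var_def)

lemma Lp_var_measurable: "u \<in> Lp_var p S \<Longrightarrow> u \<in> borel_measurable (lebesgue_on S)"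
  by (simp add: Lp_var_def)

lemma Lp_var_bound:
  fixes u :: "'a \<Rightarrow> 'b::euclidean_space" and v :: "'a \<Rightarrow> 'c::euclidean_space" and w :: "'a \<Rightarrow> 'd::euclidean_space"
  assumes "open S" "v \<in> Lp_var p S" "w \<in> Lp_var p S" "u \<in> borel_measurable (lebesgue_on S)"
    and "1 \<le> C" "\<And>x. x \<in> S \<Longrightarrow> norm (u x) \<le> C * (norm (v x) + norm (w x))"
  shows "u \<in> Lp_var p S"
proof -
  have "AE x in lebesgue_on S. norm (u x) \<le> C * (norm (v x) + norm (w x))"
    using assms(6) by (intro AE_I2) simp
  from modular_bound[OF assms(1) Lp_var_measurable[OF assms(2)] Lp_var_measurable[OF assms(3)] assms(5) this]
  have "modular p S u \<le> ennreal ((2 * C) powr P) * (modular p S v + modular p S w)" .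
  also have "\<dots> < \<infinity>"
    using assms(2,3) by (simp add: Lp_var_iff[OF assms(1)] ennreal_mult_less_top)
  finally show ?thesis using assms(1,4) by (simp add: Lp_var_iff)
qed

lemma Lp_var_lincomb:
  fixes u v :: "'a \<Rightarrow> 'b::euclidean_space"
  assumes "open S" "u \<in> Lp_var p S" "v \<in> Lp_var p S"
  shows "(\<lambda>x. a *\<^sub>R u x + b *\<^sub>R v x) \<in> Lp_var p S"
proof (rule Lp_var_bound[OF assms])
  note [measurable] = Lp_var_measurable[OF assms(2)] Lp_var_measurable[OF assms(3)]
  show "(\<lambda>x. a *\<^sub>R u x + b *\<^sub>R v x) \<in> borel_measurable (lebesgue_on S)" by measurable
  show "1 \<le> max 1 (max \<bar>a\<bar> \<bar>b\<bar>)" by simp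
  fix x
  have "norm (a *\<^sub>R u x + b *\<^sub>R v x) \<le> \<bar>a\<bar> * norm (u x) + \<bar>b\<bar> * norm (v x)"
    by (rule norm_triangle_le) simp
  also have "\<dots> \<le> max 1 (max \<bar>a\<bar> \<bar>b\<bar>) * norm (u x) + max 1 (max \<bar>a\<bar> \<bar>b\<bar>) * norm (v x)"
    by (intro add_mono mult_right_mono) auto
  finally show "norm (a *\<^sub>R u x + b *\<^sub>R v x) \<le> max 1 (max \<bar>a\<bar> \<bar>b\<bar>) * (norm (u x) + norm (v x))"
    by (simp add: distrib_left)
qed

section \<open>Sobolev functions with variable exponent\<close>

lemma W1pI: "u \<in> Lp_var p S \<Longrightarrow> g \<in> Lp_var p S \<Longrightarrow> distributional_gradient S u g \<Longrightarrow> u \<in> W1p p S"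
  unfolding W1p_def by blast

lemma W1pE:
  assumes "u \<in> W1p p S"
  obtains g where "u \<in> Lp_var p S" "g \<in> Lp_var p S" "distributional_gradient S u g"
  using assms unfolding W1p_def by blast

lemma W1p_lincomb:
  assumes "open S" "u \<in> W1p p S" "v \<in> W1p p S"
  shows "(\<lambda>x. a * u x + b * v x) \<in> W1p p S"
proof -
  obtain g where g: "u \<in> Lp_var p S" "g \<in> Lp_var p S" "distributional_gradient S u g"
    using W1pE[OF assms(2)] .
  obtain g' where g': "v \<in> Lp_var p S" "g' \<in> Lp_var p S" "distributional_gradient S v g'"
    using W1pE[OF assms(3)] .
  show ?thesis
    using Lp_var_lincomb[OF assms(1) g(1) g'(1), of a b] Lp_var_lincomb[OF assms(1) g(2) g'(2), of a b]
      distributional_gradient_lincomb[OF assms(1) g(3) g'(3), of a b]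
    by (intro W1pI) auto
qed

lemma Lp_var_restrict:
  fixes u :: "'a \<Rightarrow> 'b::euclidean_space"
  assumes "open S" "u \<in> Lp_var p UNIV"
  shows "u \<in> Lp_var p S"
proof -
  have [measurable]: "S \<in> sets lebesgue" using assms(1) by simp
  have m: "u \<in> borel_measurable lebesgue" "modular p UNIV u < \<infinity>"
    using assms(2) by (auto simp: Lp_var_iff lebesgue_on_UNIV_eq)
  have "modular p S u = (\<integral>\<^sup>+ x. ennreal (norm (u x) powr p x) * indicator S x \<partial>lebesgue)"
    unfolding modular_def by (rule nn_integral_restrict_space) simp
  also have "\<dots> \<le> modular p UNIV u"
    unfolding modular_def lebesgue_on_UNIV_eq by (intro nn_integral_mono) (auto split: split_indicator)
  finally show ?thesis using m assms(1)
    by (auto simp: Lp_var_iff intro: measurable_restrict_space1 le_less_trans)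
qed

lemma Lp_var_zero_extension:
  fixes u :: "'a \<Rightarrow> 'b::euclidean_space"
  assumes "open S" "u \<in> Lp_var p S"
  shows "(\<lambda>x. indicator S x *\<^sub>R u x) \<in> Lp_var p UNIV"
proof -
  have [measurable]: "S \<in> sets lebesgue" using assms(1) by simp
  have m: "u \<in> borel_measurable (lebesgue_on S)" "modular p S u < \<infinity>"
    using assms by (auto simp: Lp_var_iff)
  have "(\<lambda>x. indicator S x *\<^sub>R u x) \<in> borel_measurable lebesgue"
    using borel_measurable_restrict_space_iff[of S lebesgue u] m(1) by simp
  moreover have "modular p UNIV (\<lambda>x. indicator S x *\<^sub>R u x) = modular p S u"
  proof -
    have "modular p S u = (\<integral>\<^sup>+ x. ennreal (norm (u x) powr p x) * indicator S x \<partial>lebesgue)"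
      unfolding modular_def by (rule nn_integral_restrict_space) simp
    also have "\<dots> = modular p UNIV (\<lambda>x. indicator S x *\<^sub>R u x)"
      unfolding modular_def lebesgue_on_UNIV_eq by (intro nn_integral_cong) (auto split: split_indicator)
    finally show ?thesis by simp
  qed
  ultimately show ?thesis using m by (simp add: Lp_var_iff lebesgue_on_UNIV_eq)
qed

text \<open>Convergence in the modular is L1 convergence of the powers, which gives an almost
  everywhere convergent subsequence; the root with exponent \<open>1 / p x\<close> leads back to
  \<open>f\<close>.\<close>

lemma modular_tendsto_0_subseq:
  fixes f :: "nat \<Rightarrow> 'a \<Rightarrow> 'b::euclidean_space"
  assumes "open S" "\<And>k. f k \<in> Lp_var p S" "(\<lambda>k. modular p S (f k)) \<longlonglongrightarrow> 0"
  obtains r :: "nat \<Rightarrow> nat" where "strict_mono r" "AE x in lebesgue_on S. (\<lambda>k. f (r k) x) \<longlonglongrightarrow> 0"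
proof -
  have m [measurable]: "f k \<in> borel_measurable (lebesgue_on S)" for k using assms(2) by (simp add: Lp_var_measurable)
  have fin: "modular p S (f k) < \<infinity>" for k using assms(1,2) by (simp add: Lp_var_iff)
  let ?F = "\<lambda>k x. norm (f k x) powr p x"
  have int: "integrable (lebesgue_on S) (?F k)" for k
    using fin[of k] by (intro integrableI_bounded) (auto simp: modular_def)
  have "(\<lambda>k. \<integral>x. norm (?F k x) \<partial>lebesgue_on S) \<longlonglongrightarrow> 0"
  proof -
    have "(LINT x|lebesgue_on S. norm (?F k x)) = enn2real (modular p S (f k))" for k
      unfolding modular_def by (subst integral_eq_nn_integral) auto
    moreover have "(\<lambda>k. enn2real (modular p S (f k))) \<longlonglongrightarrow> enn2real 0"
      using assms(3) by (intro tendsto_enn2real) auto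
    ultimately show ?thesis by simp
  qed
  from tendsto_L1_AE_subseq[OF int this]
  obtain r :: "nat \<Rightarrow> nat" where r: "strict_mono r" "AE x in lebesgue_on S. (\<lambda>k. ?F (r k) x) \<longlonglongrightarrow> 0" by blast
  have "AE x in lebesgue_on S. (\<lambda>k. f (r k) x) \<longlonglongrightarrow> 0"
    using r(2)
  proof eventually_elim
    fix x assume "(\<lambda>k. ?F (r k) x) \<longlonglongrightarrow> 0"
    then have "(\<lambda>k. (?F (r k) x) powr (1 / p x)) \<longlonglongrightarrow> 0"
      by (rule tendsto_zero_powrI[OF _ tendsto_const _ divide_pos_pos[OF zero_less_one p_pos]]) simp
    moreover have "(?F (r k) x) powr (1 / p x) = norm (f (r k) x)" for k
      using p_pos[of x] by (simp add: powr_powr)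
    ultimately have "(\<lambda>k. norm (f (r k) x)) \<longlonglongrightarrow> 0" by (simp only:)
    then show "(\<lambda>k. f (r k) x) \<longlonglongrightarrow> 0" by (rule tendsto_norm_zero_cancel)
  qed
  with r(1) show thesis by (rule that)
qed

lemma modular_dominated_tendsto_0:
  fixes E :: "nat \<Rightarrow> 'a \<Rightarrow> 'b::euclidean_space" and e :: "'a \<Rightarrow> 'c::euclidean_space"
  assumes "open S" and [measurable]: "\<And>k. E k \<in> borel_measurable (lebesgue_on S)" and e: "e \<in> Lp_var p S"
    and le: "\<And>k x. norm (E k x) \<le> norm (e x)" and lim: "AE x in lebesgue_on S. (\<lambda>k. E k x) \<longlonglongrightarrow> 0"
  shows "(\<lambda>k. modular p S (E k)) \<longlonglongrightarrow> 0"
proof -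
  note [measurable] = Lp_var_measurable[OF e]
  have "(\<lambda>k. \<integral>\<^sup>+ x. ennreal (norm (E k x) powr p x) \<partial>lebesgue_on S) \<longlonglongrightarrow> (\<integral>\<^sup>+ x. 0 \<partial>lebesgue_on S)"
  proof (rule nn_integral_dominated_convergence[where w = "\<lambda>x. ennreal (norm (e x) powr p x)"])
    show "(\<integral>\<^sup>+ x. ennreal (norm (e x) powr p x) \<partial>lebesgue_on S) < \<infinity>"
      using e assms(1) by (simp add: Lp_var_iff modular_def)
    show "AE x in lebesgue_on S. ennreal (norm (E k x) powr p x) \<le> ennreal (norm (e x) powr p x)" for k
      using le p_pos by (intro AE_I2 ennreal_leI powr_mono2) (auto intro: less_imp_le)
    show "AE x in lebesgue_on S. (\<lambda>k. ennreal (norm (E k x) powr p x)) \<longlonglongrightarrow> 0"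
      using lim
    proof eventually_elim
      fix x assume "(\<lambda>k. E k x) \<longlonglongrightarrow> 0"
      then have "(\<lambda>k. norm (E k x) powr p x) \<longlonglongrightarrow> 0"
        using p_pos[of x] by (intro tendsto_zero_powrI[OF _ tendsto_const] tendsto_norm_zero) auto
      then have "(\<lambda>k. ennreal (norm (E k x) powr p x)) \<longlonglongrightarrow> ennreal 0" by (rule tendsto_ennrealI)
      then show "(\<lambda>k. ennreal (norm (E k x) powr p x)) \<longlonglongrightarrow> 0" by simp
    qed
  qed measurable
  then show ?thesis by (simp add: modular_def)
qed

lemma modular_tendsto_0_bound:
  fixes u :: "nat \<Rightarrow> 'a \<Rightarrow> 'b::euclidean_space" and v :: "nat \<Rightarrow> 'a \<Rightarrow> 'c::euclidean_space" and w :: "nat \<Rightarrow> 'a \<Rightarrow> 'd::euclidean_space"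
  assumes "open S" "\<And>k. v k \<in> borel_measurable (lebesgue_on S)" "\<And>k. w k \<in> borel_measurable (lebesgue_on S)"
    and "1 \<le> C" "\<And>k. AE x in lebesgue_on S. norm (u k x) \<le> C * (norm (v k x) + norm (w k x))"
    and v: "(\<lambda>k. modular p S (v k)) \<longlonglongrightarrow> 0" and w: "(\<lambda>k. modular p S (w k)) \<longlonglongrightarrow> 0"
  shows "(\<lambda>k. modular p S (u k)) \<longlonglongrightarrow> 0"
proof (rule tendsto_sandwich[OF _ _ tendsto_const])
  have "(\<lambda>k. ennreal ((2 * C) powr P) * (modular p S (v k) + modular p S (w k))) \<longlonglongrightarrow> ennreal ((2 * C) powr P) * (0 + 0)"
    by (intro ennreal_tendsto_cmult tendsto_add v w) auto
  then show "(\<lambda>k. ennreal ((2 * C) powr P) * (modular p S (v k) + modular p S (w k))) \<longlonglongrightarrow> 0" by simp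
  show "\<forall>\<^sub>F k in sequentially. modular p S (u k) \<le> ennreal ((2 * C) powr P) * (modular p S (v k) + modular p S (w k))"
    by (intro always_eventually allI modular_bound assms)
qed auto

end

section \<open>Zero boundary values\<close>

lemma norm_lincomb_diff_le:
  fixes s t s' t' :: "'a::real_normed_vector"
  assumes "\<bar>a\<bar> \<le> C" "\<bar>b\<bar> \<le> C"
  shows "norm ((a *\<^sub>R s + b *\<^sub>R t) - (a *\<^sub>R s' + b *\<^sub>R t')) \<le> C * (norm (s - s') + norm (t - t'))"
proof -
  have "(a *\<^sub>R s + b *\<^sub>R t) - (a *\<^sub>R s' + b *\<^sub>R t') = a *\<^sub>R (s - s') + b *\<^sub>R (t - t')" by (simp add: algebra_simps)
  then have "norm ((a *\<^sub>R s + b *\<^sub>R t) - (a *\<^sub>R s' + b *\<^sub>R t')) \<le> \<bar>a\<bar> * norm (s - s') + \<bar>b\<bar> * norm (t - t')"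
    using norm_triangle_ineq[of "a *\<^sub>R (s - s')" "b *\<^sub>R (t - t')"] by simp
  also have "\<dots> \<le> C * norm (s - s') + C * norm (t - t')" using assms by (intro add_mono mult_right_mono) auto
  finally show ?thesis by (simp add: distrib_left)
qed

context bounded_exponent
begin

lemma Lp_var_UNIV_measurable:
  fixes u :: "'a \<Rightarrow> 'b::euclidean_space"
  shows "open S \<Longrightarrow> u \<in> Lp_var p UNIV \<Longrightarrow> u \<in> borel_measurable (lebesgue_on S)"
  by (rule Lp_var_measurable[OF Lp_var_restrict])

text \<open>Together with \<open>W1p_0_approx\<close> this replaces the closure in the norm by
  sequences that converge in the modular, with explicit gradients instead of those chosen by
  \<open>grad\<close>.\<close>

lemma W1p_0I:
  assumes "open S" and u: "u \<in> W1p p S" "distributional_gradient S u g" "g \<in> borel_measurable (lebesgue_on S)"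
    and w: "\<And>k. w k \<in> W1p_compact_support p S" "\<And>k. distributional_gradient S (w k) (gw k)"
      "\<And>k. gw k \<in> borel_measurable (lebesgue_on S)"
    and lim: "(\<lambda>k. modular p S (\<lambda>x. u x - w k x)) \<longlonglongrightarrow> 0" "(\<lambda>k. modular p S (\<lambda>x. g x - gw k x)) \<longlonglongrightarrow> 0"
  shows "u \<in> W1p_0 p S"
  unfolding W1p_0_def
proof (intro CollectI conjI allI impI u(1))
  fix \<epsilon> :: real assume "\<epsilon> > 0"
  \<comment> \<open>The norm is a sum of two terms, each at most \<open>c\<close>; the bound 1 is a
    condition of \<open>lux_norm_le_of_modular_le\<close>.\<close>
  define c where "c = min (\<epsilon> / 3) 1"
  have c: "0 < c" "c \<le> 1" "c + c < \<epsilon>" using \<open>\<epsilon> > 0\<close> by (auto simp: c_def)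
  have um: "u \<in> borel_measurable (lebesgue_on S)" using u(1) by (simp add: W1p_def Lp_var_def)
  have wm: "w k \<in> borel_measurable (lebesgue_on S)" for k
  proof -
    have "w k \<in> Lp_var p UNIV" using w(1)[of k] by (simp add: W1p_compact_support_def W1p_def)
    then show ?thesis by (rule Lp_var_UNIV_measurable[OF assms(1)])
  qed
  have "0 < ennreal (c powr P)" using c by simp
  then have "eventually (\<lambda>k. modular p S (\<lambda>x. u x - w k x) < ennreal (c powr P) \<and> modular p S (\<lambda>x. g x - gw k x) < ennreal (c powr P)) sequentially"
    by (intro eventually_conj order_tendstoD(2)[OF lim(1)] order_tendstoD(2)[OF lim(2)])
  then obtain k where k: "modular p S (\<lambda>x. u x - w k x) < ennreal (c powr P)" "modular p S (\<lambda>x. g x - gw k x) < ennreal (c powr P)"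
    by (auto simp: eventually_sequentially)
  have "lux_norm p S (\<lambda>x. u x - w k x) \<le> ennreal c"
    using k(1) um wm[of k] by (intro lux_norm_le_of_modular_le assms(1) c) auto
  moreover have "lux_norm p S (grad S (\<lambda>x. u x - w k x)) \<le> ennreal c"
  proof -
    have "lux_norm p S (grad S (\<lambda>x. u x - w k x)) = lux_norm p S (\<lambda>x. g x - gw k x)"
      by (intro lux_norm_cong grad_eq distributional_gradient_diff assms(1) u(2) w(2))
    also have "\<dots> \<le> ennreal c"
      using k(2) u(3) w(3)[of k] by (intro lux_norm_le_of_modular_le assms(1) c) auto
    finally show ?thesis .
  qed
  ultimately have "W1p_norm p S (\<lambda>x. u x - w k x) \<le> ennreal c + ennreal c"
    unfolding W1p_norm_def by (rule add_mono)
  also have "\<dots> < ennreal \<epsilon>" using c by (simp add: ennreal_less_iff flip: ennreal_plus)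
  finally show "\<exists>w\<in>W1p_compact_support p S. W1p_norm p S (\<lambda>x. u x - w x) < ennreal \<epsilon>"
    using w(1) by blast
qed

lemma W1p_0_approx:
  assumes "open S" and u: "u \<in> W1p_0 p S" "distributional_gradient S u g" "g \<in> borel_measurable (lebesgue_on S)"
  shows "\<exists>w gw. (\<forall>k::nat. w k \<in> W1p_compact_support p S \<and> w k \<in> Lp_var p UNIV \<and> gw k \<in> Lp_var p UNIV \<and>
      distributional_gradient UNIV (w k) (gw k)) \<and>
    (\<lambda>k. modular p S (\<lambda>x. u x - w k x)) \<longlonglongrightarrow> 0 \<and> (\<lambda>k. modular p S (\<lambda>x. g x - gw k x)) \<longlonglongrightarrow> 0"
proof -
  have "\<exists>w. w \<in> W1p_compact_support p S \<and> W1p_norm p S (\<lambda>x. u x - w x) < ennreal (inverse (real (Suc k)))" for k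
  proof -
    have "inverse (real (Suc k)) > 0" by simp
    then show ?thesis using u(1) unfolding W1p_0_def by blast
  qed
  then have "\<exists>w. \<forall>k. w k \<in> W1p_compact_support p S \<and> W1p_norm p S (\<lambda>x. u x - w k x) < ennreal (inverse (real (Suc k)))"
    by (intro choice allI)
  then obtain w where w: "\<And>k. w k \<in> W1p_compact_support p S"
      "\<And>k. W1p_norm p S (\<lambda>x. u x - w k x) < ennreal (inverse (real (Suc k)))"
    by blast
  have "\<exists>g. w k \<in> Lp_var p UNIV \<and> g \<in> Lp_var p UNIV \<and> distributional_gradient UNIV (w k) g" for k
    using w(1)[of k] by (auto simp: W1p_compact_support_def W1p_def)
  then have "\<exists>gw. \<forall>k. w k \<in> Lp_var p UNIV \<and> gw k \<in> Lp_var p UNIV \<and> distributional_gradient UNIV (w k) (gw k)"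
    by (intro choice allI)
  then obtain gw where gw: "\<And>k. w k \<in> Lp_var p UNIV" "\<And>k. gw k \<in> Lp_var p UNIV" "\<And>k. distributional_gradient UNIV (w k) (gw k)"
    by blast
  have um: "u \<in> borel_measurable (lebesgue_on S)"
    using u(1) by (simp add: W1p_0_def W1p_def Lp_var_def)
  have wm: "w k \<in> borel_measurable (lebesgue_on S)" "gw k \<in> borel_measurable (lebesgue_on S)" for k
    using gw by (simp_all add: Lp_var_UNIV_measurable assms(1))
  have lim: "(\<lambda>k. ennreal (inverse (real (Suc k)))) \<longlonglongrightarrow> 0"
    using tendsto_ennrealI[OF LIMSEQ_inverse_real_of_nat] by simp
  have le1: "inverse (real (Suc k)) \<le> 1" for k by (simp add: inverse_le_1_iff)
  have *: "modular p S (\<lambda>x. u x - w k x) \<le> ennreal (inverse (real (Suc k)))" for k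
  proof (rule modular_le_of_lux_norm_less[OF _ _ le1])
    show "lux_norm p S (\<lambda>x. u x - w k x) < ennreal (inverse (real (Suc k)))"
      using w(2)[of k] unfolding W1p_norm_def by (rule le_less_trans[rotated]) simp
  qed (use um wm in auto)
  have **: "modular p S (\<lambda>x. g x - gw k x) \<le> ennreal (inverse (real (Suc k)))" for k
  proof (rule modular_le_of_lux_norm_less[OF _ _ le1])
    have "distributional_gradient S (w k) (gw k)"
      using gw(3) by (rule distributional_gradient_restrict[OF assms(1) open_UNIV subset_UNIV])
    then have "lux_norm p S (\<lambda>x. g x - gw k x) = lux_norm p S (grad S (\<lambda>x. u x - w k x))"
      by (intro lux_norm_cong[symmetric] grad_eq distributional_gradient_diff assms(1) u(2))
    also have "\<dots> < ennreal (inverse (real (Suc k)))"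
      using w(2)[of k] unfolding W1p_norm_def by (rule le_less_trans[rotated]) simp
    finally show "lux_norm p S (\<lambda>x. g x - gw k x) < ennreal (inverse (real (Suc k)))" .
  qed (use u(3) wm in auto)
  have "(\<lambda>k. modular p S (\<lambda>x. u x - w k x)) \<longlonglongrightarrow> 0" "(\<lambda>k. modular p S (\<lambda>x. g x - gw k x)) \<longlonglongrightarrow> 0"
    by (rule tendsto_sandwich[OF _ _ tendsto_const lim]; use * ** in simp)+
  with w(1) gw show ?thesis by blast
qed

lemma W1p_compact_support_lincomb:
  assumes "u \<in> W1p_compact_support p S" "v \<in> W1p_compact_support p S"
  shows "(\<lambda>x. a * u x + b * v x) \<in> W1p_compact_support p S"
proof -
  obtain K where K: "u \<in> W1p p UNIV" "compact K" "K \<subseteq> S" "AE x in lebesgue. x \<notin> K \<longrightarrow> u x = 0"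
    using assms(1) by (auto simp: W1p_compact_support_def)
  obtain L where L: "v \<in> W1p p UNIV" "compact L" "L \<subseteq> S" "AE x in lebesgue. x \<notin> L \<longrightarrow> v x = 0"
    using assms(2) by (auto simp: W1p_compact_support_def)
  have "AE x in lebesgue. x \<notin> K \<union> L \<longrightarrow> a * u x + b * v x = 0"
    using K(4) L(4) by eventually_elim auto
  moreover have "compact (K \<union> L)" "K \<union> L \<subseteq> S" using K L by (auto intro: compact_Un)
  ultimately show ?thesis
    using W1p_lincomb[OF open_UNIV K(1) L(1)] unfolding W1p_compact_support_def by blast
qed

lemma W1p_0_lincomb:
  assumes "open S" "u \<in> W1p_0 p S" "v \<in> W1p_0 p S"
  shows "(\<lambda>x. a * u x + b * v x) \<in> W1p_0 p S"
proof -
  have W: "u \<in> W1p p S" "v \<in> W1p p S" using assms by (auto simp: W1p_0_def)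
  obtain gu where gu: "u \<in> Lp_var p S" "gu \<in> Lp_var p S" "distributional_gradient S u gu" using W1pE[OF W(1)] .
  obtain gv where gv: "v \<in> Lp_var p S" "gv \<in> Lp_var p S" "distributional_gradient S v gv" using W1pE[OF W(2)] .
  obtain w gw where w: "\<And>k::nat. w k \<in> W1p_compact_support p S" "\<And>k. w k \<in> Lp_var p UNIV" "\<And>k. gw k \<in> Lp_var p UNIV"
    "\<And>k. distributional_gradient UNIV (w k) (gw k)"
    "(\<lambda>k. modular p S (\<lambda>x. u x - w k x)) \<longlonglongrightarrow> 0" "(\<lambda>k. modular p S (\<lambda>x. gu x - gw k x)) \<longlonglongrightarrow> 0"
    using W1p_0_approx[OF assms(1,2) gu(3) Lp_var_measurable[OF gu(2)]] by blast
  obtain w' gw' where w': "\<And>k::nat. w' k \<in> W1p_compact_support p S" "\<And>k. w' k \<in> Lp_var p UNIV" "\<And>k. gw' k \<in> Lp_var p UNIV"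
    "\<And>k. distributional_gradient UNIV (w' k) (gw' k)"
    "(\<lambda>k. modular p S (\<lambda>x. v x - w' k x)) \<longlonglongrightarrow> 0" "(\<lambda>k. modular p S (\<lambda>x. gv x - gw' k x)) \<longlonglongrightarrow> 0"
    using W1p_0_approx[OF assms(1,3) gv(3) Lp_var_measurable[OF gv(2)]] by blast
  have m [measurable]: "w k \<in> borel_measurable (lebesgue_on S)" "gw k \<in> borel_measurable (lebesgue_on S)"
     "w' k \<in> borel_measurable (lebesgue_on S)" "gw' k \<in> borel_measurable (lebesgue_on S)" for k
    using w w' by (simp_all add: Lp_var_UNIV_measurable assms(1))
  have m' [measurable]: "u \<in> borel_measurable (lebesgue_on S)" "gu \<in> borel_measurable (lebesgue_on S)"
     "v \<in> borel_measurable (lebesgue_on S)" "gv \<in> borel_measurable (lebesgue_on S)"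
    using gu gv by (auto intro!: Lp_var_measurable)
  define C where "C = max 1 (max \<bar>a\<bar> \<bar>b\<bar>)"
  have C: "1 \<le> C" "\<bar>a\<bar> \<le> C" "\<bar>b\<bar> \<le> C" by (auto simp: C_def)
  show ?thesis
  proof (rule W1p_0I[OF assms(1), where w = "\<lambda>k x. a * w k x + b * w' k x" and gw = "\<lambda>k x. a *\<^sub>R gw k x + b *\<^sub>R gw' k x"])
    show "(\<lambda>x. a * u x + b * v x) \<in> W1p p S" by (rule W1p_lincomb[OF assms(1) W])
    show "distributional_gradient S (\<lambda>x. a * u x + b * v x) (\<lambda>x. a *\<^sub>R gu x + b *\<^sub>R gv x)"
      by (rule distributional_gradient_lincomb[OF assms(1) gu(3) gv(3)])
    show "(\<lambda>x. a * w k x + b * w' k x) \<in> W1p_compact_support p S" for k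
      by (rule W1p_compact_support_lincomb[OF w(1) w'(1)])
    show "distributional_gradient S (\<lambda>x. a * w k x + b * w' k x) (\<lambda>x. a *\<^sub>R gw k x + b *\<^sub>R gw' k x)" for k
      by (rule distributional_gradient_lincomb[OF assms(1)
            distributional_gradient_restrict[OF assms(1) open_UNIV subset_UNIV w(4)]
            distributional_gradient_restrict[OF assms(1) open_UNIV subset_UNIV w'(4)]])
    show "(\<lambda>k. modular p S (\<lambda>x. (a * u x + b * v x) - (a * w k x + b * w' k x))) \<longlonglongrightarrow> 0"
      using norm_lincomb_diff_le[OF C(2,3), where 'a = real]
      by (intro modular_tendsto_0_bound[OF assms(1) _ _ C(1) _ w(5) w'(5)]) auto
    show "(\<lambda>k. modular p S (\<lambda>x. (a *\<^sub>R gu x + b *\<^sub>R gv x) - (a *\<^sub>R gw k x + b *\<^sub>R gw' k x))) \<longlonglongrightarrow> 0"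
      using norm_lincomb_diff_le[OF C(2,3), where 'a = 'a]
      by (intro modular_tendsto_0_bound[OF assms(1) _ _ C(1) _ w(6) w'(6)]) auto
  qed measurable
qed

text \<open>The approximants are the positive parts of min(v, w k), at distance at most
  \<open>\<bar>h x - w k x\<bar>\<close> from that of \<open>v\<close>. The gradients differ only
  where \<open>0 < v x\<close> and \<open>w k x < v x\<close>; there the error is bounded by the
  gradient of \<open>h - w k\<close> and a remainder \<open>E k\<close>, which is dominated and
  tends to 0 almost everywhere.\<close>

lemma W1p_0_truncate:
  assumes "open S" and v: "v \<in> W1p p S" and h: "h \<in> W1p_0 p S" and le: "AE x in lebesgue_on S. v x \<le> h x"
  shows "(\<lambda>x. max (v x) 0) \<in> W1p_0 p S"
proof -
  have hW: "h \<in> W1p p S" using h by (auto simp: W1p_0_def)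
  obtain gv where gv: "v \<in> Lp_var p S" "gv \<in> Lp_var p S" "distributional_gradient S v gv" using W1pE[OF v] .
  obtain gh where gh: "h \<in> Lp_var p S" "gh \<in> Lp_var p S" "distributional_gradient S h gh" using W1pE[OF hW] .
  obtain w0 gw0 where w0: "\<And>k::nat. w0 k \<in> W1p_compact_support p S" "\<And>k. w0 k \<in> Lp_var p UNIV" "\<And>k. gw0 k \<in> Lp_var p UNIV"
    "\<And>k. distributional_gradient UNIV (w0 k) (gw0 k)"
    "(\<lambda>k. modular p S (\<lambda>x. h x - w0 k x)) \<longlonglongrightarrow> 0" "(\<lambda>k. modular p S (\<lambda>x. gh x - gw0 k x)) \<longlonglongrightarrow> 0"
    using W1p_0_approx[OF assms(1) h gh(3) Lp_var_measurable[OF gh(2)]] by blast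
  \<comment> \<open>The remainder is treated pointwise, so a subsequence that converges almost
    everywhere is chosen first.\<close>
  have "(\<lambda>x. h x - w0 k x) \<in> Lp_var p S" for k
    using Lp_var_lincomb[OF assms(1) gh(1) Lp_var_restrict[OF assms(1) w0(2)], of 1 "- 1"] by simp
  then obtain r where r: "strict_mono r" "AE x in lebesgue_on S. (\<lambda>k. h x - w0 (r k) x) \<longlonglongrightarrow> 0"
    using modular_tendsto_0_subseq[OF assms(1) _ w0(5)] by blast
  define w where "w k = w0 (r k)" for k
  define gw where "gw k = gw0 (r k)" for k
  have w: "\<And>k. w k \<in> W1p_compact_support p S" "\<And>k. w k \<in> Lp_var p S" "\<And>k. gw k \<in> Lp_var p S"
    "\<And>k. distributional_gradient S (w k) (gw k)"
    unfolding w_def gw_def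
    by (rule w0(1) Lp_var_restrict[OF assms(1) w0(2)] Lp_var_restrict[OF assms(1) w0(3)]
      distributional_gradient_restrict[OF assms(1) open_UNIV subset_UNIV w0(4)])+
  have lim: "(\<lambda>k. modular p S (\<lambda>x. h x - w k x)) \<longlonglongrightarrow> 0" "(\<lambda>k. modular p S (\<lambda>x. gh x - gw k x)) \<longlonglongrightarrow> 0"
    using LIMSEQ_subseq_LIMSEQ[OF w0(5) r(1)] LIMSEQ_subseq_LIMSEQ[OF w0(6) r(1)]
    by (simp_all add: w_def gw_def o_def)
  have wh: "AE x in lebesgue_on S. (\<lambda>k. w k x) \<longlonglongrightarrow> h x"
    using r(2)
  proof eventually_elim
    fix x assume "(\<lambda>k. h x - w0 (r k) x) \<longlonglongrightarrow> 0"
    from tendsto_diff[OF tendsto_const[of "h x"] this] show "(\<lambda>k. w k x) \<longlonglongrightarrow> h x"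
      by (simp add: w_def)
  qed
  have m [measurable]: "w k \<in> borel_measurable (lebesgue_on S)" "gw k \<in> borel_measurable (lebesgue_on S)" for k
    using w by (auto intro!: Lp_var_measurable)
  have m' [measurable]: "v \<in> borel_measurable (lebesgue_on S)" "gv \<in> borel_measurable (lebesgue_on S)"
     "h \<in> borel_measurable (lebesgue_on S)" "gh \<in> borel_measurable (lebesgue_on S)"
    using gv gh by (auto intro!: Lp_var_measurable)

  define G where "G x = (if 0 < v x then gv x else 0)" for x
  have G: "distributional_gradient S (\<lambda>x. max (v x) 0) G"
    unfolding G_def [abs_def] by (rule distributional_gradient_pos_part(1)[OF assms(1) gv(3) m'(1,2)])
  have Gm [measurable]: "G \<in> borel_measurable (lebesgue_on S)" unfolding G_def [abs_def] by measurable
  \<comment> \<open>\<open>q k\<close> is \<open>min v (w k)\<close>; its positive part vanishes wherever \<open>w k\<close> does.\<close>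
  define q where "q k x = v x - max (v x - w k x) 0" for k x
  define gq where "gq k x = gv x - (if 0 < v x - w k x then gv x - gw k x else 0)" for k x
  define gm where "gm k x = (if 0 < q k x then gq k x else 0)" for k x
  have qm [measurable]: "q k \<in> borel_measurable (lebesgue_on S)" "gq k \<in> borel_measurable (lebesgue_on S)" for k
    unfolding q_def [abs_def] gq_def [abs_def] by measurable
  have gmm [measurable]: "gm k \<in> borel_measurable (lebesgue_on S)" for k unfolding gm_def [abs_def] by measurable
  have "distributional_gradient S (q k) (gq k)" for k
    unfolding q_def [abs_def] gq_def [abs_def]
    by (intro distributional_gradient_diff assms(1) gv(3) distributional_gradient_pos_part(1) w(4)) measurable
  then have dm: "distributional_gradient S (\<lambda>x. max (q k x) 0) (gm k)" for k
    unfolding gm_def [abs_def] by (intro distributional_gradient_pos_part(1) assms(1) qm)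
  have LpG: "(\<lambda>x. max (v x) 0) \<in> Lp_var p S" "G \<in> Lp_var p S"
    by (rule Lp_var_bound[OF assms(1) gv(1) gv(1), where C = 1]; simp)
      (rule Lp_var_bound[OF assms(1) gv(2) gv(2), where C = 1]; simp add: G_def)
  have Lpq: "(\<lambda>x. max (q k x) 0) \<in> Lp_var p S" for k
    by (rule Lp_var_bound[OF assms(1) gv(1) gv(1), where C = 1]) (auto simp: q_def max_def)
  have Lpgm: "gm k \<in> Lp_var p S" for k
    by (rule Lp_var_bound[OF assms(1) gv(2) w(3)[of k], where C = 1]) (auto simp: gm_def gq_def)
  \<comment> \<open>The values of \<open>v\<close> outside \<open>S\<close> are arbitrary, so the
    approximants are set to 0 there to become functions on the whole space.\<close>
  define z where "z k x = indicator S x * max (q k x) 0" for k x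
  define gz where "gz k x = indicator S x *\<^sub>R gm k x" for k x
  have dz: "z k \<in> W1p_compact_support p S" "distributional_gradient UNIV (z k) (gz k)" for k
  proof -
    obtain K where K: "compact K" "K \<subseteq> S" "AE x in lebesgue. x \<notin> K \<longrightarrow> w k x = 0"
      using w(1)[of k] by (auto simp: W1p_compact_support_def)
    have q0: "AE x in lebesgue. x \<notin> K \<longrightarrow> max (q k x) 0 = 0"
      using K(3) by eventually_elim (auto simp: q_def)
    show "distributional_gradient UNIV (z k) (gz k)"
      unfolding z_def [abs_def] gz_def [abs_def]
    proof (rule distributional_gradient_zero_extension[OF assms(1) dm _ gmm K(1,2)])
      show "AE x in lebesgue_on S. x \<notin> K \<longrightarrow> max (q k x) 0 = 0"
        unfolding AE_lebesgue_on_open[OF assms(1)] using q0 by eventually_elim simp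
    qed simp
    then have "z k \<in> W1p p UNIV"
      using Lp_var_zero_extension[OF assms(1) Lpq[of k]] Lp_var_zero_extension[OF assms(1) Lpgm[of k]]
      by (intro W1pI[of _ _ "gz k"]) (auto simp: z_def [abs_def] gz_def [abs_def])
    moreover have "AE x in lebesgue. x \<notin> K \<longrightarrow> z k x = 0"
      using q0 by eventually_elim (simp add: z_def)
    ultimately show "z k \<in> W1p_compact_support p S"
      using K unfolding W1p_compact_support_def by blast
  qed
  have zm: "gz k \<in> borel_measurable (lebesgue_on S)" for k
  proof -
    have "gz k \<in> Lp_var p UNIV"
      using Lp_var_zero_extension[OF assms(1) Lpgm[of k]] by (simp add: gz_def [abs_def])
    then show ?thesis by (rule Lp_var_UNIV_measurable[OF assms(1)])
  qed

  \<comment> \<open>The first summand lives where the minimum follows \<open>w k\<close> instead of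
    \<open>v\<close>. The second lives where truncation at 0 has, in addition, switched off the
    gradient of \<open>w k\<close>.\<close>
  define E where "E k x = (if 0 < v x \<and> w k x < v x then norm (gv x - gh x) else 0) +
      (if 0 < v x \<and> w k x \<le> 0 then norm (gh x) else 0)" for k x
  have Em [measurable]: "E k \<in> borel_measurable (lebesgue_on S)" for k unfolding E_def [abs_def] by measurable
  have "AE x in lebesgue_on S. v x - h x = 0 \<longrightarrow> gv x - gh x = 0"
    by (intro distributional_gradient_pos_part(2) assms(1) distributional_gradient_diff gv(3) gh(3)) measurable
  then have E0: "AE x in lebesgue_on S. (\<lambda>k. E k x) \<longlonglongrightarrow> 0"
    using le wh
  proof eventually_elim
    fix x assume g: "v x - h x = 0 \<longrightarrow> gv x - gh x = 0" and le: "v x \<le> h x" and lim: "(\<lambda>k. w k x) \<longlonglongrightarrow> h x"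
    \<comment> \<open>For \<open>v x < h x\<close> eventually \<open>v x < w k x\<close>, and for
      \<open>v x = h x\<close> the gradients agree. If \<open>0 < v x\<close>, then
      \<open>0 < h x\<close> and eventually \<open>w k x\<close> is positive.\<close>
    show "(\<lambda>k. E k x) \<longlonglongrightarrow> 0"
    proof (cases "0 < v x")
      case True
      then have "eventually (\<lambda>k. 0 < w k x) sequentially" using le order_tendstoD(1)[OF lim] by simp
      moreover have "eventually (\<lambda>k. norm (gv x - gh x) = 0 \<or> v x < w k x) sequentially"
      proof (cases "v x = h x")
        case False
        then have "eventually (\<lambda>k. v x < w k x) sequentially" using le order_tendstoD(1)[OF lim] by simp
        then show ?thesis by eventually_elim simp
      qed (use g in simp)
      ultimately have "eventually (\<lambda>k. E k x = 0) sequentially"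
        by eventually_elim (auto simp: E_def)
      then show ?thesis by (rule tendsto_eventually)
    qed (simp add: E_def)
  qed
  have "(\<lambda>x. norm (gv x - gh x) + norm (gh x)) \<in> Lp_var p S"
  proof (rule Lp_var_bound[OF assms(1) gv(2) gh(2), where C = 2])
    show "norm (norm (gv x - gh x) + norm (gh x)) \<le> 2 * (norm (gv x) + norm (gh x))" for x
    proof -
      have "norm (gv x - gh x) + norm (gh x) \<le> (norm (gv x) + norm (gh x)) + (norm (gv x) + norm (gh x))"
        by (intro add_mono norm_triangle_ineq4) simp
      then show ?thesis by simp
    qed
  qed auto
  then have E_lim: "(\<lambda>k. modular p S (E k)) \<longlonglongrightarrow> 0"
    by (rule modular_dominated_tendsto_0[OF assms(1) Em _ _ E0]) (auto simp: E_def)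

  show ?thesis
  proof (rule W1p_0I[OF assms(1) W1pI[OF LpG G] G Gm, of z gz])
    show "distributional_gradient S (z k) (gz k)" for k
      using dz(2) by (rule distributional_gradient_restrict[OF assms(1) open_UNIV subset_UNIV])
    show "(\<lambda>k. modular p S (\<lambda>x. max (v x) 0 - z k x)) \<longlonglongrightarrow> 0"
    proof (rule tendsto_sandwich[OF _ _ tendsto_const lim(1)])
      have "AE x in lebesgue_on S. norm (max (v x) 0 - z k x) \<le> norm (h x - w k x)" for k
        using le AE_space by eventually_elim (auto simp: z_def q_def max_def)
      then have "modular p S (\<lambda>x. max (v x) 0 - z k x) \<le> modular p S (\<lambda>x. h x - w k x)" for k
        by (rule modular_mono)
      then show "\<forall>\<^sub>F k in sequentially. modular p S (\<lambda>x. max (v x) 0 - z k x) \<le> modular p S (\<lambda>x. h x - w k x)"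
        by simp
    qed simp
    show "(\<lambda>k. modular p S (\<lambda>x. G x - gz k x)) \<longlonglongrightarrow> 0"
    proof (rule modular_tendsto_0_bound[OF assms(1) _ Em order_refl _ lim(2) E_lim])
      show "AE x in lebesgue_on S. norm (G x - gz k x) \<le> 1 * (norm (gh x - gw k x) + norm (E k x))" for k
      proof (rule AE_I2)
        fix x assume "x \<in> space (lebesgue_on S)"
        then have x: "x \<in> S" by simp
        consider "v x \<le> 0" | "0 < v x" "v x \<le> w k x" | "0 < v x" "w k x < v x" "0 < w k x" | "0 < v x" "w k x < v x" "w k x \<le> 0"
          by linarith
        then show "norm (G x - gz k x) \<le> 1 * (norm (gh x - gw k x) + norm (E k x))"
        proof cases
          case 1
          then show ?thesis by (auto simp: G_def gz_def gm_def q_def)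
        next
          case 2
          then show ?thesis using x by (auto simp: G_def gz_def gm_def gq_def q_def)
        next
          case 3
          then have "G x - gz k x = (gh x - gw k x) + (gv x - gh x)" "E k x = norm (gv x - gh x)"
            using x by (auto simp: G_def gz_def gm_def gq_def q_def E_def)
          then show ?thesis using norm_triangle_ineq[of "gh x - gw k x" "gv x - gh x"] by simp
        next
          case 4
          then have "G x - gz k x = (gv x - gh x) + gh x" "E k x = norm (gv x - gh x) + norm (gh x)"
            using x by (auto simp: G_def gz_def gm_def gq_def q_def E_def)
          then show ?thesis using norm_triangle_ineq[of "gv x - gh x" "gh x"] by (simp add: add_increasing)
        qed
      qed
    qed measurable
  qed (use dz zm in auto)
qed

end

section \<open>The comparison principle\<close>

text \<open>The mean value theorem on the two halves of the interval compares slopes, and the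
  derivative of the power is strictly increasing since \<open>q - 1 > 0\<close>.\<close>

lemma powr_midpoint_less:
  fixes x y q :: real
  assumes "0 \<le> x" "x < y" "1 < q"
  shows "2 * ((x + y) / 2) powr q < x powr q + y powr q"
proof -
  define m where "m = (x + y) / 2"
  have m: "x < m" "m < y" "m - x = y - m" using assms by (auto simp: m_def field_simps)
  \<comment> \<open>At the left endpoint only continuity enters, so \<open>a = 0\<close> is
    allowed.\<close>
  have mvt: "\<exists>\<xi>. a < \<xi> \<and> \<xi> < b \<and> b powr q - a powr q = (b - a) * (q * \<xi> powr (q - 1))" if ab: "0 \<le> a" "a < b" for a b
  proof -
    have "continuous_on {a..b} (\<lambda>t. t powr q)"
      using ab assms(3) by (intro continuous_on_powr' continuous_intros) auto
    moreover have "((\<lambda>t. t powr q) has_real_derivative q * t powr (q - 1)) (at t)" if "a < t" for t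
      using that ab(1) by (intro has_real_derivative_powr) auto
    ultimately obtain l z where z: "a < z" "z < b" "((\<lambda>t. t powr q) has_real_derivative l) (at z)" "b powr q - a powr q = (b - a) * l"
      using MVT[of a b "\<lambda>t. t powr q"] ab(2) real_differentiable_def by blast
    have "l = q * z powr (q - 1)"
      using z(1) ab(1) by (intro DERIV_unique[OF z(3)] has_real_derivative_powr) auto
    with z show ?thesis by blast
  qed
  obtain s where s: "x < s" "s < m" "m powr q - x powr q = (m - x) * (q * s powr (q - 1))"
    using mvt[of x m] assms m by blast
  obtain t where t: "m < t" "t < y" "y powr q - m powr q = (y - m) * (q * t powr (q - 1))"
    using mvt[of m y] assms m by auto
  have "s powr (q - 1) < t powr (q - 1)" using s t assms by (intro powr_less_mono2) auto
  then have "m powr q - x powr q < y powr q - m powr q"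
    unfolding s(3) t(3) m(3) using m(2) assms(3) by (intro mult_strict_left_mono) auto
  then show ?thesis unfolding m_def[symmetric] by simp
qed

text \<open>Strictness has two sources. Different vectors of equal length have a strictly shorter
  midpoint by the parallelogram law; for different lengths the scalar inequality is strict.\<close>

lemma norm_powr_midpoint_less:
  fixes a b :: "'a::real_inner"
  assumes "a \<noteq> b" "1 < q"
  shows "2 * norm ((1 / 2) *\<^sub>R (a + b)) powr q < norm a powr q + norm b powr q"
proof (cases "norm a = norm b")
  case True
  have "norm (a + b) ^ 2 + norm (a - b) ^ 2 = 2 * norm a ^ 2 + 2 * norm b ^ 2"
    by (simp add: power2_norm_eq_inner inner_simps inner_commute)
  moreover have "0 < norm (a - b) ^ 2" using assms(1) by simp
  moreover have "(2 * norm a) ^ 2 = 2 * norm a ^ 2 + 2 * norm b ^ 2" using True by (simp add: power_mult_distrib)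
  ultimately have "norm (a + b) ^ 2 < (2 * norm a) ^ 2" by linarith
  then have "norm (a + b) < 2 * norm a" by (rule power2_less_imp_less) simp
  then have "norm ((1 / 2) *\<^sub>R (a + b)) powr q < norm a powr q"
    using assms(2) by (intro powr_less_mono2) auto
  then show ?thesis using True by simp
next
  case False
  have "norm ((1 / 2) *\<^sub>R (a + b)) powr q \<le> ((norm a + norm b) / 2) powr q"
    using norm_triangle_ineq[of a b] assms(2) by (intro powr_mono2) auto
  moreover have "2 * ((norm a + norm b) / 2) powr q < norm a powr q + norm b powr q"
    using powr_midpoint_less[of "norm a" "norm b" q] powr_midpoint_less[of "norm b" "norm a" q] False assms(2)
    by (cases "norm a < norm b") (auto simp: add.commute)
  ultimately show ?thesis by simp
qed

text \<open>A bump that decreases radially from a centre \<open>c\<close> has a negative derivative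
  in direction \<open>i\<close> wherever it is positive and \<open>x\<close> lies further along
  \<open>i\<close> than \<open>c\<close>. If \<open>S\<close> lies in the open ball of radius \<rho>
  around 0, then the centre \<open>- \<rho> *\<^sub>R i\<close> and the radius
  \<open>2 * \<rho>\<close> place all of \<open>S\<close> on that side and inside the ball.\<close>

lemma monotone_test_function_exists:
  fixes S :: "'a::euclidean_space set"
  assumes "bounded S" and i: "i \<in> Basis"
  obtains \<phi> where "test_function UNIV \<phi>" "\<And>x. x \<in> S \<Longrightarrow> partial i \<phi> x < 0"
proof -
  obtain \<rho> where \<rho>: "0 < \<rho>" "\<And>x. x \<in> S \<Longrightarrow> norm x < \<rho>"
    using assms(1) unfolding bounded_pos_less by blast
  define c where "c = - \<rho> *\<^sub>R i"
  have nc: "norm c = \<rho>" using \<rho>(1) i by (simp add: c_def)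
  define q where "q x = (2 * \<rho>)\<^sup>2 - (x - c) \<bullet> (x - c)" for x
  have q': "(q has_derivative (\<lambda>h. - 2 * ((x - c) \<bullet> h))) (at x)" for x
    unfolding q_def [abs_def] by (auto intro!: derivative_eq_intros simp: inner_commute)
  have sq': "smooth (\<lambda>x. - 2 * ((x - c) \<bullet> b))" for b
  proof -
    have "smooth (\<lambda>x. (- 2) * (x \<bullet> b - c \<bullet> b))" by (intro smooth_mult smooth_const smooth_shift_inner)
    then show ?thesis by (simp add: inner_diff_left)
  qed
  have "smooth q" by (rule smoothI[of q "\<lambda>x h. - 2 * ((x - c) \<bullet> h)", OF q' sq'])
  then have sm: "smooth (\<lambda>x. bump 0 1 (q x))"
    by (rule smooth_compose[OF smooth_bump[OF zero_less_one]])
  have d: "partial i (\<lambda>x. bump 0 1 (q x)) x = bump 2 1 (q x) * (- 2 * ((x - c) \<bullet> i))" for x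
  proof -
    have "(bump 0 1 has_derivative (\<lambda>h. bump 2 1 (q x) * h)) (at (q x))"
      using bump_has_derivative[of 1 0 "q x"] by (simp add: has_field_derivative_def numeral_2_eq_2)
    from partial_eq[OF has_derivative_compose[OF q' this], of i] show ?thesis .
  qed
  have "test_function UNIV (\<lambda>x. bump 0 1 (q x))"
  proof (rule test_functionI[OF sm])
    show "compact (cball c (2 * \<rho>))" by simp
    show "bump 0 1 (q x) = 0" if "x \<notin> cball c (2 * \<rho>)" for x
    proof -
      have "2 * \<rho> < norm (x - c)" using that by (simp add: dist_norm norm_minus_commute)
      then have "(2 * \<rho>)\<^sup>2 < (norm (x - c))\<^sup>2" using \<rho>(1) by (intro power_strict_mono) auto
      then show ?thesis by (simp add: bump_def q_def power2_norm_eq_inner)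
    qed
  qed simp
  moreover have "partial i (\<lambda>x. bump 0 1 (q x)) x < 0" if "x \<in> S" for x
  proof -
    have "norm (x - c) < 2 * \<rho>" using \<rho>(2)[OF that] nc norm_triangle_ineq4[of x c] by simp
    then have "(norm (x - c))\<^sup>2 < (2 * \<rho>)\<^sup>2" by (intro power_strict_mono) auto
    then have "0 < q x" by (simp add: q_def power2_norm_eq_inner)
    then have "0 < bump 2 1 (q x)" by (simp add: bump_def)
    moreover have "0 < (x - c) \<bullet> i"
    proof -
      have "\<bar>x \<bullet> i\<bar> \<le> norm x" using i by (rule Basis_le_norm)
      then show ?thesis using \<rho>(2)[OF that] i by (simp add: c_def inner_simps)
    qed
    ultimately show ?thesis unfolding d by (simp add: mult_less_0_iff)
  qed
  ultimately show thesis by (rule that)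
qed

text \<open>Above the threshold \<open>s\<close> one has
  \<open>a = s * (a / s) \<le> s * (a / s) powr q\<close>. The additive \<open>s\<close> is
  integrated over a set of finite measure and can be made small, which is how modular convergence
  yields L1 convergence.\<close>

lemma le_add_powr:
  fixes a s q P :: real
  assumes "0 \<le> a" "0 < s" "s \<le> 1" "1 \<le> q" "q \<le> P"
  shows "a \<le> s + s powr (1 - P) * a powr q"
proof (cases "a \<le> s")
  case True
  then show ?thesis by (simp add: add_increasing2)
next
  case False
  have "a = s * (a / s) powr 1" using assms False by simp
  also have "\<dots> \<le> s * (a / s) powr q" using assms False by (intro mult_left_mono powr_mono) auto
  also have "\<dots> = s powr 1 * (a powr q / s powr q)" using assms by (simp add: powr_divide)
  also have "\<dots> = s powr (1 - q) * a powr q" by (simp add: powr_diff)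
  also have "\<dots> \<le> s powr (1 - P) * a powr q"
    using assms by (intro mult_right_mono powr_mono') auto
  finally show ?thesis using assms by simp
qed

section \<open>From the modular to L1, and functions with vanishing gradient\<close>

context bounded_exponent
begin

lemma Lp_var_powr_integrable:
  fixes f :: "'a \<Rightarrow> 'b::euclidean_space"
  assumes "open S" "f \<in> Lp_var p S"
  shows "integrable (lebesgue_on S) (\<lambda>x. norm (f x) powr p x)"
    and "modular p S f = ennreal (LINT x|lebesgue_on S. norm (f x) powr p x)"
proof -
  note [measurable] = Lp_var_measurable[OF assms(2)]
  show *: "integrable (lebesgue_on S) (\<lambda>x. norm (f x) powr p x)"
    using assms by (intro integrableI_bounded) (auto simp: modular_def Lp_var_iff)
  show "modular p S f = ennreal (LINT x|lebesgue_on S. norm (f x) powr p x)"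
    unfolding modular_def by (rule nn_integral_eq_integral[OF *]) simp
qed

lemma Lp_var_L1_bound:
  fixes f :: "'a \<Rightarrow> 'b::euclidean_space"
  assumes "open S" "bounded S" "f \<in> Lp_var p S" and s: "0 < s" "s \<le> 1"
  shows "integrable (lebesgue_on S) f"
    and "(LINT x|lebesgue_on S. norm (f x)) \<le> s * measure lebesgue S + s powr (1 - P) * enn2real (modular p S f)"
proof -
  note m [measurable] = Lp_var_measurable[OF assms(3)]
  note I = Lp_var_powr_integrable[OF assms(1,3)]
  have S: "S \<in> lmeasurable" using assms by (intro lmeasurable_open)
  have c: "integrable (lebesgue_on S) (\<lambda>x. s)"
    by (rule finite_measure.integrable_const[OF finite_measure_lebesgue_on[OF S]])
  have bd: "AE x in lebesgue_on S. norm (f x) \<le> s + s powr (1 - P) * norm (f x) powr p x"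
    using p_le_on[OF assms(1)]
  proof eventually_elim
    fix x assume "p x \<le> P"
    then show "norm (f x) \<le> s + s powr (1 - P) * norm (f x) powr p x"
      using s p_ge_1 by (intro le_add_powr) auto
  qed
  have J: "integrable (lebesgue_on S) (\<lambda>x. s + s powr (1 - P) * norm (f x) powr p x)"
    using c I(1) by auto
  show *: "integrable (lebesgue_on S) f"
    by (rule Bochner_Integration.integrable_bound[OF J m]) (use bd in \<open>eventually_elim, simp\<close>)
  have "(LINT x|lebesgue_on S. norm (f x)) \<le> (LINT x|lebesgue_on S. s + s powr (1 - P) * norm (f x) powr p x)"
    by (intro integral_mono_AE integrable_norm * J bd)
  also have "\<dots> = s * measure lebesgue S + s powr (1 - P) * (LINT x|lebesgue_on S. norm (f x) powr p x)"
    using c I(1) assms(1) by (simp add: measure_restrict_space)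
  finally show "(LINT x|lebesgue_on S. norm (f x)) \<le> s * measure lebesgue S + s powr (1 - P) * enn2real (modular p S f)"
    using I by simp
qed

lemma modular_tendsto_0_imp_L1:
  fixes f :: "nat \<Rightarrow> 'a \<Rightarrow> 'b::euclidean_space"
  assumes "open S" "bounded S" "\<And>k. f k \<in> Lp_var p S" and lim: "(\<lambda>k. modular p S (f k)) \<longlonglongrightarrow> 0"
  shows "(\<lambda>k. \<integral>x. norm (f k x) \<partial>lebesgue_on S) \<longlonglongrightarrow> 0"
proof (rule LIMSEQ_I)
  fix e :: real assume e: "0 < e"
  define \<mu> where "\<mu> = measure lebesgue S"
  have \<mu>: "0 \<le> \<mu>" by (simp add: \<mu>_def)
  \<comment> \<open>First \<open>s\<close> is fixed so that the measure term is at most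
    \<open>e / 2\<close>, then \<open>k\<close> is taken large. Adding 1 to \<mu> avoids a division
    by 0.\<close>
  define s where "s = min 1 (e / (2 * (\<mu> + 1)))"
  have s: "0 < s" "s \<le> 1" using e \<mu> by (auto simp: s_def)
  have "s * \<mu> \<le> e / (2 * (\<mu> + 1)) * (\<mu> + 1)" using e \<mu> s by (intro mult_mono) (auto simp: s_def)
  also have "\<dots> = e / 2" using \<mu> by (simp add: field_simps)
  finally have s\<mu>: "s * \<mu> \<le> e / 2" .
  have "(\<lambda>k. enn2real (modular p S (f k))) \<longlonglongrightarrow> 0" using lim by (intro tendsto_enn2real) auto
  then have "(\<lambda>k. s powr (1 - P) * enn2real (modular p S (f k))) \<longlonglongrightarrow> 0" by (rule tendsto_mult_right_zero)
  then have "eventually (\<lambda>k. s powr (1 - P) * enn2real (modular p S (f k)) < e / 2) sequentially"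
    using e by (intro order_tendstoD(2)) auto
  then obtain N where N: "\<And>k. k \<ge> N \<Longrightarrow> s powr (1 - P) * enn2real (modular p S (f k)) < e / 2"
    by (auto simp: eventually_sequentially)
  have "norm ((LINT x|lebesgue_on S. norm (f k x)) - 0) < e" if "k \<ge> N" for k
  proof -
    have "(LINT x|lebesgue_on S. norm (f k x)) < e"
      using Lp_var_L1_bound(2)[OF assms(1-3) s, of k] N[OF that] s\<mu> unfolding \<mu>_def by linarith
    then show ?thesis by simp
  qed
  then show "\<exists>no. \<forall>k\<ge>no. norm ((LINT x|lebesgue_on S. norm (f k x)) - 0) < e" by blast
qed

text \<open>This takes the place of a Poincare inequality. For the approximants integration by parts
  over \<open>S\<close> is exact even though \<phi> is not supported in \<open>S\<close>. In the
  limit the integral of \<open>u\<close> against \<open>- partial i \<phi>\<close>, which is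
  strictly positive on \<open>S\<close>, is 0, and \<open>u\<close> is nonnegative.\<close>

lemma W1p_0_gradient_0_imp_0:
  assumes "open S" "bounded S" and u: "u \<in> W1p_0 p S" "distributional_gradient S u g" "g \<in> borel_measurable (lebesgue_on S)"
    and nonneg: "\<And>x. 0 \<le> u x" and g0: "AE x in lebesgue_on S. g x = 0"
  shows "AE x in lebesgue_on S. u x = 0"
proof -
  obtain w gw where w: "\<And>k::nat. w k \<in> W1p_compact_support p S" "\<And>k. w k \<in> Lp_var p UNIV" "\<And>k. gw k \<in> Lp_var p UNIV"
    "\<And>k. distributional_gradient UNIV (w k) (gw k)"
    "(\<lambda>k. modular p S (\<lambda>x. u x - w k x)) \<longlonglongrightarrow> 0" "(\<lambda>k. modular p S (\<lambda>x. g x - gw k x)) \<longlonglongrightarrow> 0"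
    using W1p_0_approx[OF assms(1) u] by blast
  have uL: "u \<in> Lp_var p S" using u(1) by (simp add: W1p_0_def W1p_def)
  have wL: "w k \<in> Lp_var p S" "gw k \<in> Lp_var p S" for k
    by (rule Lp_var_restrict[OF assms(1) w(2)] Lp_var_restrict[OF assms(1) w(3)])+
  have dL: "(\<lambda>x. u x - w k x) \<in> Lp_var p S" for k
    using Lp_var_lincomb[OF assms(1) uL wL(1)[of k], of 1 "- 1"] by simp
  have "modular p S (\<lambda>x. g x - gw k x) = modular p S (gw k)" for k
  proof -
    have "modular p S (\<lambda>x. g x - gw k x) = modular p S (\<lambda>x. - gw k x)"
      by (rule modular_cong) (use g0 in \<open>eventually_elim, simp\<close>)
    then show ?thesis by (simp add: modular_def)
  qed
  then have lim_gw: "(\<lambda>k. modular p S (gw k)) \<longlonglongrightarrow> 0" using w(6) by simp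
  obtain i :: 'a where i: "i \<in> Basis" using nonempty_Basis by blast
  obtain \<phi> where \<phi>: "test_function UNIV \<phi>" "\<And>x. x \<in> S \<Longrightarrow> partial i \<phi> x < 0"
    using monotone_test_function_exists[OF assms(2) i] by blast
  note d\<phi> = test_function_partial[OF \<phi>(1) i]
  obtain B where B: "B > 0" "\<And>x. \<bar>\<phi> x\<bar> \<le> B" using test_function_bounded[OF \<phi>(1)] by blast
  obtain B' where B': "B' > 0" "\<And>x. \<bar>partial i \<phi> x\<bar> \<le> B'" using test_function_bounded[OF d\<phi>] by blast
  have sm: "\<phi> \<in> borel_measurable (lebesgue_on S)" "partial i \<phi> \<in> borel_measurable (lebesgue_on S)"
    using \<phi>(1) d\<phi> by (auto intro: smooth_measurable_lebesgue_on test_functionD)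
  have uI: "integrable (lebesgue_on S) u" using Lp_var_L1_bound(1)[OF assms(1,2) uL, of 1] by simp
  have wI: "integrable (lebesgue_on S) (w k)" "integrable (lebesgue_on S) (gw k)" for k
    using Lp_var_L1_bound(1)[OF assms(1,2) wL(1), of 1] Lp_var_L1_bound(1)[OF assms(1,2) wL(2), of 1] by simp_all
  have gwI: "integrable (lebesgue_on S) (\<lambda>x. gw k x \<bullet> i)" for k using wI by simp
  note I = integrable_mult_bounded[OF _ sm(2) B'(2)] integrable_mult_bounded[OF _ sm(1) B(2)]
  \<comment> \<open>The integrals over \<open>S\<close> and over the whole space agree because
    almost everywhere outside \<open>K\<close> both \<open>w k\<close> and, by the zero-set
    property, \<open>gw k\<close> vanish.\<close>
  have parts: "(LINT x|lebesgue_on S. w k x * partial i \<phi> x) = - (LINT x|lebesgue_on S. (gw k x \<bullet> i) * \<phi> x)" for k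
  proof -
    obtain K where K: "compact K" "K \<subseteq> S" "AE x in lebesgue. x \<notin> K \<longrightarrow> w k x = 0"
      using w(1)[of k] by (auto simp: W1p_compact_support_def)
    have "AE x in lebesgue_on UNIV. w k x = 0 \<longrightarrow> gw k x = 0"
      by (intro distributional_gradient_pos_part(2)[OF open_UNIV w(4)] Lp_var_measurable w)
    then have g0: "AE x in lebesgue. w k x = 0 \<longrightarrow> gw k x = 0" unfolding lebesgue_on_UNIV_eq .
    have m: "w k \<in> borel_measurable lebesgue" "gw k \<in> borel_measurable lebesgue"
      using Lp_var_measurable[OF w(2)[of k]] Lp_var_measurable[OF w(3)[of k]] by (simp_all add: lebesgue_on_UNIV_eq)
    have [measurable]: "S \<in> sets lebesgue" using assms(1) by simp
    have eq: "(LINT x|lebesgue_on S. f x * \<psi> x) = (LINT x|lebesgue_on UNIV. f x * \<psi> x)"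
      if f: "f \<in> borel_measurable lebesgue" "AE x in lebesgue. x \<notin> K \<longrightarrow> f x = 0" and \<psi>: "smooth \<psi>" for f \<psi> :: "'a \<Rightarrow> real"
    proof -
      have [measurable]: "\<psi> \<in> borel_measurable lebesgue" using \<psi> by (rule smooth_measurable_lebesgue)
      note [measurable] = f(1)
      have "(LINT x|lebesgue_on S. f x * \<psi> x) = (LINT x|lebesgue. indicator S x * (f x * \<psi> x))"
        by (rule integral_lebesgue_on_open[OF assms(1)])
      also have "\<dots> = (LINT x|lebesgue. f x * \<psi> x)"
      proof (rule integral_cong_AE)
        show "AE x in lebesgue. indicator S x * (f x * \<psi> x) = f x * \<psi> x"
          using f(2) by eventually_elim (use K(2) in \<open>auto split: split_indicator\<close>)
      qed measurable
      finally show ?thesis by (simp add: lebesgue_on_UNIV_eq)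
    qed
    have "(LINT x|lebesgue_on S. w k x * partial i \<phi> x) = (LINT x|lebesgue_on UNIV. w k x * partial i \<phi> x)"
      using m K(3) by (intro eq test_functionD[OF d\<phi>])
    also have "\<dots> = - (LINT x|lebesgue_on UNIV. (gw k x \<bullet> i) * \<phi> x)"
      by (rule distributional_gradientD[OF w(4) \<phi>(1) i])
    also have "(LINT x|lebesgue_on UNIV. (gw k x \<bullet> i) * \<phi> x) = (LINT x|lebesgue_on S. (gw k x \<bullet> i) * \<phi> x)"
    proof (rule eq[symmetric, OF _ _ test_functionD[OF \<phi>(1)]])
      show "(\<lambda>x. gw k x \<bullet> i) \<in> borel_measurable lebesgue"
        using m(2) by (intro borel_measurable_inner) auto
      show "AE x in lebesgue. x \<notin> K \<longrightarrow> gw k x \<bullet> i = 0"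
        using K(3) g0 by eventually_elim auto
    qed
    finally show ?thesis .
  qed
  have bound: "\<bar>\<integral>x. f x * \<psi> x \<partial>lebesgue_on S\<bar> \<le> b * (LINT x|lebesgue_on S. norm (F x))"
    if f: "integrable (lebesgue_on S) f" and \<psi>: "\<psi> \<in> borel_measurable (lebesgue_on S)" "\<And>x. \<bar>\<psi> x\<bar> \<le> b"
      and F: "integrable (lebesgue_on S) F" "\<And>x. \<bar>f x\<bar> \<le> norm (F x)"
    for f \<psi> :: "'a \<Rightarrow> real" and b and F :: "'a \<Rightarrow> 'c::euclidean_space"
  proof -
    have "\<bar>\<integral>x. f x * \<psi> x \<partial>lebesgue_on S\<bar> \<le> (LINT x|lebesgue_on S. \<bar>f x * \<psi> x\<bar>)"
      by (rule integral_abs_bound)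
    also have "\<dots> \<le> (LINT x|lebesgue_on S. b * norm (F x))"
    proof (rule integral_mono)
      show "integrable (lebesgue_on S) (\<lambda>x. \<bar>f x * \<psi> x\<bar>)"
        by (intro Bochner_Integration.integrable_abs integrable_mult_bounded[OF f \<psi>])
      show "integrable (lebesgue_on S) (\<lambda>x. b * norm (F x))" using F(1) by simp
      show "\<bar>f x * \<psi> x\<bar> \<le> b * norm (F x)" for x
        using mult_mono[OF F(2)[of x] \<psi>(2)[of x]] by (simp add: abs_mult mult.commute)
    qed
    finally show ?thesis by simp
  qed
  have "\<bar>\<integral>x. u x * partial i \<phi> x \<partial>lebesgue_on S\<bar> \<le>
      B' * (LINT x|lebesgue_on S. norm (u x - w k x)) + B * (LINT x|lebesgue_on S. norm (gw k x))" for k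
  proof -
    have "(LINT x|lebesgue_on S. u x * partial i \<phi> x) =
       (LINT x|lebesgue_on S. (u x - w k x) * partial i \<phi> x + w k x * partial i \<phi> x)"
      by (intro Bochner_Integration.integral_cong) (auto simp: algebra_simps)
    also have "\<dots> = (LINT x|lebesgue_on S. (u x - w k x) * partial i \<phi> x) - (LINT x|lebesgue_on S. (gw k x \<bullet> i) * \<phi> x)"
      using uI wI(1)[of k] by (subst Bochner_Integration.integral_add) (auto intro!: I simp: parts)
    finally have "\<bar>\<integral>x. u x * partial i \<phi> x \<partial>lebesgue_on S\<bar> \<le>
      \<bar>\<integral>x. (u x - w k x) * partial i \<phi> x \<partial>lebesgue_on S\<bar> + \<bar>\<integral>x. (gw k x \<bullet> i) * \<phi> x \<partial>lebesgue_on S\<bar>"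
      by linarith
    moreover have "\<bar>\<integral>x. (u x - w k x) * partial i \<phi> x \<partial>lebesgue_on S\<bar> \<le> B' * (LINT x|lebesgue_on S. norm (u x - w k x))"
      using uI wI(1)[of k] by (intro bound[OF _ sm(2) B'(2)]) auto
    moreover have "\<bar>\<integral>x. (gw k x \<bullet> i) * \<phi> x \<partial>lebesgue_on S\<bar> \<le> B * (LINT x|lebesgue_on S. norm (gw k x))"
      using gwI[of k] wI(2)[of k] by (intro bound[OF _ sm(1) B(2)]) (auto simp: Basis_le_norm[OF i])
    ultimately show ?thesis by linarith
  qed
  moreover have "(\<lambda>k. B' * (LINT x|lebesgue_on S. norm (u x - w k x)) + B * (LINT x|lebesgue_on S. norm (gw k x))) \<longlonglongrightarrow> B' * 0 + B * 0"
    by (intro tendsto_intros modular_tendsto_0_imp_L1 assms(1,2) dL wL w(5) lim_gw)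
  ultimately have "\<bar>\<integral>x. u x * partial i \<phi> x \<partial>lebesgue_on S\<bar> \<le> B' * 0 + B * 0"
    by (intro LIMSEQ_le_const[of _ "B' * 0 + B * 0"]) auto
  then have int0: "(LINT x|lebesgue_on S. u x * (- partial i \<phi> x)) = 0" by simp
  have "integrable (lebesgue_on S) (\<lambda>x. - (u x * partial i \<phi> x))"
    using I(1)[OF uI] by (rule Bochner_Integration.integrable_minus)
  then have i': "integrable (lebesgue_on S) (\<lambda>x. u x * (- partial i \<phi> x))" by simp
  have "AE x in lebesgue_on S. 0 \<le> u x * (- partial i \<phi> x)"
    using nonneg \<phi>(2) by (intro AE_I2 mult_nonneg_nonneg) (auto intro: less_imp_le)
  from integral_nonneg_eq_0_iff_AE[OF i' this] int0
  have "AE x in lebesgue_on S. u x * (- partial i \<phi> x) = 0" by blast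
  then show ?thesis using AE_space
    by eventually_elim (use \<phi>(2) in \<open>auto simp: less_le\<close>)
qed

end

section \<open>Exponent bounds, lsc-regularization and the comparison of solutions\<close>

lemma log_hoelder_exponent_bounded:
  assumes "log_hoelder_exponent p"
  obtains P where "bounded_exponent p P" "AE x in lebesgue. 1 < p x"
proof -
  have p: "p \<in> borel_measurable lebesgue" "\<And>x. 1 \<le> p x"
    "1 < essinf lebesgue (\<lambda>x. ereal (p x))" "esssup lebesgue (\<lambda>x. ereal (p x)) < \<infinity>"
    using assms by (auto simp: log_hoelder_exponent_def)
  obtain M where M: "esssup lebesgue (\<lambda>x. ereal (p x)) \<le> ereal M"
    using p(4) by (cases "esssup lebesgue (\<lambda>x. ereal (p x))") auto
  have "AE x in lebesgue. p x \<le> max 1 M"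
    using esssup_AE[of "\<lambda>x. ereal (p x)" lebesgue]
  proof eventually_elim
    fix x assume "ereal (p x) \<le> esssup lebesgue (\<lambda>x. ereal (p x))"
    then have "ereal (p x) \<le> ereal M" using M by (rule order_trans)
    then show "p x \<le> max 1 M" by simp
  qed
  then have "bounded_exponent p (max 1 M)" using p by unfold_locales auto
  \<comment> \<open>The strict bound is what strict convexity will require; the essential infimum
    provides it almost everywhere.\<close>
  moreover have "AE x in lebesgue. 1 < ereal (p x)"
    using p(3) unfolding essinf_def by (rule less_LiminfD)
  then have "AE x in lebesgue. 1 < p x" by simp
  ultimately show thesis by (rule that)
qed

text \<open>Essential infima ignore null sets, so an inequality almost everywhere passes to each
  ball and, through the supremum over the radii, to every point.\<close>

lemma lsc_reg_mono:
  assumes "open S" "AE x in lebesgue_on S. u x \<le> v x"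
  shows "lsc_reg S u x \<le> lsc_reg S v x"
  unfolding lsc_reg_def
proof (rule SUP_mono')
  fix r
  have "AE y in lebesgue. y \<in> ball x r \<inter> S \<longrightarrow> u y \<le> v y"
    using assms(2) unfolding AE_lebesgue_on_open[OF assms(1)] by eventually_elim simp
  then have "AE y in lebesgue_on (ball x r \<inter> S). u y \<le> v y"
    using assms(1) by (subst AE_lebesgue_on_open) (auto intro: open_Int)
  then show "essinf (lebesgue_on (ball x r \<inter> S)) (\<lambda>y. ereal (u y)) \<le> essinf (lebesgue_on (ball x r \<inter> S)) (\<lambda>y. ereal (v y))"
    unfolding essinf_def by (intro Liminf_mono) simp
qed

context bounded_exponent
begin

lemma obstacle_comparison:
  assumes S: "open S" "bounded S" and p1: "AE x in lebesgue. 1 < p x"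
    and u1: "obstacle_solution p S \<psi>\<^sub>1 f\<^sub>1 u\<^sub>1" and u2: "obstacle_solution p S \<psi>\<^sub>2 f\<^sub>2 u\<^sub>2"
    and \<psi>: "AE x in lebesgue_on S. \<psi>\<^sub>1 x \<le> \<psi>\<^sub>2 x"
    and f12: "(\<lambda>x. max (f\<^sub>1 x - f\<^sub>2 x) 0) \<in> W1p_0 p S"
  shows "AE x in lebesgue_on S. u\<^sub>1 x \<le> u\<^sub>2 x"
proof -
  have K1: "u\<^sub>1 \<in> W1p p S" "(\<lambda>x. u\<^sub>1 x - f\<^sub>1 x) \<in> W1p_0 p S" "AE x in lebesgue_on S. \<psi>\<^sub>1 x \<le> ereal (u\<^sub>1 x)"
    and min1: "\<And>v. v \<in> obstacle_class p S \<psi>\<^sub>1 f\<^sub>1 \<Longrightarrow> modular p S (grad S u\<^sub>1) \<le> modular p S (grad S v)"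
    using u1 by (auto simp: obstacle_solution_def obstacle_class_def)
  have K2: "u\<^sub>2 \<in> W1p p S" "(\<lambda>x. u\<^sub>2 x - f\<^sub>2 x) \<in> W1p_0 p S" "AE x in lebesgue_on S. \<psi>\<^sub>2 x \<le> ereal (u\<^sub>2 x)"
    and min2: "\<And>v. v \<in> obstacle_class p S \<psi>\<^sub>2 f\<^sub>2 \<Longrightarrow> modular p S (grad S u\<^sub>2) \<le> modular p S (grad S v)"
    using u2 by (auto simp: obstacle_solution_def obstacle_class_def)
  obtain g1 where g1: "u\<^sub>1 \<in> Lp_var p S" "g1 \<in> Lp_var p S" "distributional_gradient S u\<^sub>1 g1" using W1pE[OF K1(1)] .
  obtain g2 where g2: "u\<^sub>2 \<in> Lp_var p S" "g2 \<in> Lp_var p S" "distributional_gradient S u\<^sub>2 g2" using W1pE[OF K2(1)] .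
  note m [measurable] = Lp_var_measurable[OF g1(1)] Lp_var_measurable[OF g1(2)] Lp_var_measurable[OF g2(1)] Lp_var_measurable[OF g2(2)]
  define a where "a x = max (u\<^sub>1 x - u\<^sub>2 x) 0" for x
  define ga where "ga x = (if 0 < u\<^sub>1 x - u\<^sub>2 x then g1 x - g2 x else 0)" for x
  have gam [measurable]: "ga \<in> borel_measurable (lebesgue_on S)" unfolding ga_def [abs_def] by measurable
  have da: "distributional_gradient S a ga"
    unfolding a_def [abs_def] ga_def [abs_def]
    by (intro distributional_gradient_pos_part(1) S distributional_gradient_diff g1(3) g2(3)) measurable
  have a0: "a \<in> W1p_0 p S"
    unfolding a_def [abs_def]
  proof (rule W1p_0_truncate[OF S(1)])
    show "(\<lambda>x. u\<^sub>1 x - u\<^sub>2 x) \<in> W1p p S" using W1p_lincomb[OF S(1) K1(1) K2(1), of 1 "- 1"] by simp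
    \<comment> \<open>This equals \<open>u\<^sub>1 - u\<^sub>2\<close> except that
      \<open>f\<^sub>1 - f\<^sub>2\<close> is replaced by its positive part, so it is an upper
      bound.\<close>
    have "(\<lambda>x. 1 * (1 * (u\<^sub>1 x - f\<^sub>1 x) + (- 1) * (u\<^sub>2 x - f\<^sub>2 x)) + 1 * max (f\<^sub>1 x - f\<^sub>2 x) 0) \<in> W1p_0 p S"
      by (rule W1p_0_lincomb[OF S(1) W1p_0_lincomb[OF S(1) K1(2) K2(2)] f12])
    then show "(\<lambda>x. (u\<^sub>1 x - f\<^sub>1 x) - (u\<^sub>2 x - f\<^sub>2 x) + max (f\<^sub>1 x - f\<^sub>2 x) 0) \<in> W1p_0 p S"
      by (simp add: algebra_simps)
  qed simp
  then have aW: "a \<in> W1p p S" by (simp add: W1p_0_def)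

  have v1: "(\<lambda>x. 1 * u\<^sub>1 x + (- 1 / 2) * a x) \<in> obstacle_class p S \<psi>\<^sub>1 f\<^sub>1"
    unfolding obstacle_class_def
  proof (intro CollectI conjI)
    show "(\<lambda>x. 1 * u\<^sub>1 x + (- 1 / 2) * a x) \<in> W1p p S" by (rule W1p_lincomb[OF S(1) K1(1) aW])
    have "(\<lambda>x. 1 * (u\<^sub>1 x - f\<^sub>1 x) + (- 1 / 2) * a x) \<in> W1p_0 p S" by (rule W1p_0_lincomb[OF S(1) K1(2) a0])
    then show "(\<lambda>x. 1 * u\<^sub>1 x + (- 1 / 2) * a x - f\<^sub>1 x) \<in> W1p_0 p S" by (simp add: algebra_simps)
    show "AE x in lebesgue_on S. \<psi>\<^sub>1 x \<le> ereal (1 * u\<^sub>1 x + (- 1 / 2) * a x)"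
      using K1(3) K2(3) \<psi>
    proof eventually_elim
      fix x assume "\<psi>\<^sub>1 x \<le> ereal (u\<^sub>1 x)" "\<psi>\<^sub>2 x \<le> ereal (u\<^sub>2 x)" "\<psi>\<^sub>1 x \<le> \<psi>\<^sub>2 x"
      \<comment> \<open>Where \<open>u\<^sub>1 > u\<^sub>2\<close> the competitor is the mean of the
        two solutions, so it stays above their minimum; \<open>u\<^sub>2\<close> lies above the
        first obstacle because it lies above the larger second one.\<close>
      then have "\<psi>\<^sub>1 x \<le> min (ereal (u\<^sub>1 x)) (ereal (u\<^sub>2 x))" by simp
      also have "\<dots> \<le> ereal (1 * u\<^sub>1 x + (- 1 / 2) * a x)"
        by (auto simp: a_def max_def min_def field_simps)
      finally show "\<psi>\<^sub>1 x \<le> ereal (1 * u\<^sub>1 x + (- 1 / 2) * a x)" .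
    qed
  qed
  have v2: "(\<lambda>x. 1 * u\<^sub>2 x + (1 / 2) * a x) \<in> obstacle_class p S \<psi>\<^sub>2 f\<^sub>2"
    unfolding obstacle_class_def
  proof (intro CollectI conjI)
    show "(\<lambda>x. 1 * u\<^sub>2 x + (1 / 2) * a x) \<in> W1p p S" by (rule W1p_lincomb[OF S(1) K2(1) aW])
    have "(\<lambda>x. 1 * (u\<^sub>2 x - f\<^sub>2 x) + (1 / 2) * a x) \<in> W1p_0 p S" by (rule W1p_0_lincomb[OF S(1) K2(2) a0])
    then show "(\<lambda>x. 1 * u\<^sub>2 x + (1 / 2) * a x - f\<^sub>2 x) \<in> W1p_0 p S" by (simp add: algebra_simps)
    show "AE x in lebesgue_on S. \<psi>\<^sub>2 x \<le> ereal (1 * u\<^sub>2 x + (1 / 2) * a x)"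
      using K2(3)
    proof eventually_elim
      fix x assume "\<psi>\<^sub>2 x \<le> ereal (u\<^sub>2 x)"
      also have "\<dots> \<le> ereal (1 * u\<^sub>2 x + (1 / 2) * a x)" by (simp add: a_def)
      finally show "\<psi>\<^sub>2 x \<le> ereal (1 * u\<^sub>2 x + (1 / 2) * a x)" .
    qed
  qed

  define h1 where "h1 x = 1 *\<^sub>R g1 x + (- 1 / 2) *\<^sub>R ga x" for x
  define h2 where "h2 x = 1 *\<^sub>R g2 x + (1 / 2) *\<^sub>R ga x" for x
  have gaL: "ga \<in> Lp_var p S"
  proof (rule Lp_var_bound[OF S(1) g1(2) g2(2) gam, where C = 1])
    show "norm (ga x) \<le> 1 * (norm (g1 x) + norm (g2 x))" for x
      by (simp add: ga_def norm_triangle_ineq4)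
  qed simp
  have hL: "h1 \<in> Lp_var p S" "h2 \<in> Lp_var p S"
    unfolding h1_def [abs_def] h2_def [abs_def]
    by (rule Lp_var_lincomb[OF S(1) g1(2) gaL] Lp_var_lincomb[OF S(1) g2(2) gaL])+
  have "modular p S g1 = modular p S (grad S u\<^sub>1)"
    by (rule modular_cong[OF grad_eq[OF S(1) g1(3)], symmetric])
  also have "\<dots> \<le> modular p S (grad S (\<lambda>x. 1 * u\<^sub>1 x + (- 1 / 2) * a x))"
    by (rule min1[OF v1])
  also have "\<dots> = modular p S h1"
    unfolding h1_def [abs_def]
    by (rule modular_cong[OF grad_eq[OF S(1) distributional_gradient_lincomb[OF S(1) g1(3) da]]])
  finally have le1: "modular p S g1 \<le> modular p S h1" .
  have "modular p S g2 = modular p S (grad S u\<^sub>2)"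
    by (rule modular_cong[OF grad_eq[OF S(1) g2(3)], symmetric])
  also have "\<dots> \<le> modular p S (grad S (\<lambda>x. 1 * u\<^sub>2 x + (1 / 2) * a x))"
    by (rule min2[OF v2])
  also have "\<dots> = modular p S h2"
    unfolding h2_def [abs_def]
    by (rule modular_cong[OF grad_eq[OF S(1) distributional_gradient_lincomb[OF S(1) g2(3) da]]])
  finally have le2: "modular p S g2 \<le> modular p S h2" .

  let ?N = "\<lambda>g x. norm (g x :: 'a) powr p x"
  note I = Lp_var_powr_integrable(1)[OF S(1) g1(2)] Lp_var_powr_integrable(1)[OF S(1) g2(2)]
    Lp_var_powr_integrable(1)[OF S(1) hL(1)] Lp_var_powr_integrable(1)[OF S(1) hL(2)]
  note M = Lp_var_powr_integrable(2)[OF S(1) g1(2)] Lp_var_powr_integrable(2)[OF S(1) g2(2)]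
    Lp_var_powr_integrable(2)[OF S(1) hL(1)] Lp_var_powr_integrable(2)[OF S(1) hL(2)]
  \<comment> \<open>The modulars are finite, so minimality becomes a pair of inequalities between
    real integrals, which may be subtracted.\<close>
  have int_le: "(LINT x|lebesgue_on S. ?N g1 x) \<le> (LINT x|lebesgue_on S. ?N h1 x)"
    "(LINT x|lebesgue_on S. ?N g2 x) \<le> (LINT x|lebesgue_on S. ?N h2 x)"
    using le1 le2 unfolding M by (simp_all add: ennreal_le_iff)
  let ?D = "\<lambda>x. (?N g1 x + ?N g2 x) - (?N h1 x + ?N h2 x)"
  have ID: "integrable (lebesgue_on S) ?D"
    by (intro Bochner_Integration.integrable_diff Bochner_Integration.integrable_add I)
  have p1': "AE x in lebesgue_on S. 1 < p x"
    unfolding AE_lebesgue_on_open[OF S(1)] using p1 by eventually_elim simp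
  \<comment> \<open>Where \<open>ga x = 0\<close> the competitors keep the original gradients and
    \<open>?D x = 0\<close>. Elsewhere both have the midpoint of two different vectors as
    gradient.\<close>
  have D: "0 \<le> ?D x \<and> (?D x = 0 \<longrightarrow> ga x = 0)" if "1 < p x" for x
  proof (cases "0 < u\<^sub>1 x - u\<^sub>2 x \<and> g1 x \<noteq> g2 x")
    case True
    have "g1 x - (1 / 2) *\<^sub>R (g1 x - g2 x) = (1 / 2) *\<^sub>R (g1 x + g2 x)"
      "g2 x + (1 / 2) *\<^sub>R (g1 x - g2 x) = (1 / 2) *\<^sub>R (g1 x + g2 x)"
      using scaleR_half_double[of "g1 x"] scaleR_half_double[of "g2 x"] by (simp_all add: algebra_simps flip: scaleR_add_left)
    then have "h1 x = (1 / 2) *\<^sub>R (g1 x + g2 x)" "h2 x = (1 / 2) *\<^sub>R (g1 x + g2 x)"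
      using True by (simp_all add: h1_def h2_def ga_def)
    with norm_powr_midpoint_less[of "g1 x" "g2 x" "p x"] True that show ?thesis by simp
  next
    case False
    then have "ga x = 0" by (auto simp: ga_def)
    then show ?thesis by (simp add: h1_def h2_def)
  qed
  have "AE x in lebesgue_on S. 0 \<le> ?D x"
    using p1' by eventually_elim (use D in blast)
  \<comment> \<open>Minimality of both solutions bounds the integral from above, the pointwise sign
    from below.\<close>
  moreover have "(LINT x|lebesgue_on S. ?D x) = 0"
  proof (rule antisym)
    have "(LINT x|lebesgue_on S. ?D x) = ((LINT x|lebesgue_on S. ?N g1 x) + (LINT x|lebesgue_on S. ?N g2 x)) - ((LINT x|lebesgue_on S. ?N h1 x) + (LINT x|lebesgue_on S. ?N h2 x))"
      using I by simp
    with int_le show "(LINT x|lebesgue_on S. ?D x) \<le> 0" by linarith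
    show "0 \<le> (LINT x|lebesgue_on S. ?D x)" by (rule integral_nonneg_AE) fact
  qed
  ultimately have "AE x in lebesgue_on S. ?D x = 0"
    using integral_nonneg_eq_0_iff_AE[OF ID] by blast
  then have "AE x in lebesgue_on S. ga x = 0"
    using p1' by eventually_elim (use D in blast)
  then have "AE x in lebesgue_on S. a x = 0"
    by (intro W1p_0_gradient_0_imp_0[OF S a0 da gam]) (simp_all add: a_def)
  then show ?thesis by eventually_elim (simp add: a_def max_def split: if_splits)
qed

end

theorem lemma3p11:
  fixes p :: "real ^ 'n \<Rightarrow> real"
    and \<Omega> :: "(real ^ 'n) set"
    and \<psi>\<^sub>1 \<psi>\<^sub>2 :: "real ^ 'n \<Rightarrow> ereal"
    and f\<^sub>1 f\<^sub>2 u\<^sub>1 u\<^sub>2 :: "real ^ 'n \<Rightarrow> real"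
  assumes "log_hoelder_exponent p"
    and "open \<Omega>" and "bounded \<Omega>" and "\<Omega> \<noteq> {}"
    and "\<exists>M::real. \<forall>x\<in>\<Omega>. \<psi>\<^sub>1 x \<le> ereal M"
    and "\<exists>M::real. \<forall>x\<in>\<Omega>. \<psi>\<^sub>2 x \<le> ereal M"
    and "f\<^sub>1 \<in> W1p p \<Omega>" and "\<exists>M. AE x in lebesgue_on \<Omega>. \<bar>f\<^sub>1 x\<bar> \<le> M"
    and "f\<^sub>2 \<in> W1p p \<Omega>" and "\<exists>M. AE x in lebesgue_on \<Omega>. \<bar>f\<^sub>2 x\<bar> \<le> M"
    and "obstacle_class p \<Omega> \<psi>\<^sub>1 f\<^sub>1 \<noteq> {}"
    and "obstacle_class p \<Omega> \<psi>\<^sub>2 f\<^sub>2 \<noteq> {}"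
    and "obstacle_solution p \<Omega> \<psi>\<^sub>1 f\<^sub>1 u\<^sub>1"
    and "obstacle_solution p \<Omega> \<psi>\<^sub>2 f\<^sub>2 u\<^sub>2"
    and "AE x in lebesgue_on \<Omega>. \<psi>\<^sub>1 x \<le> \<psi>\<^sub>2 x"
    and "(\<lambda>x. max (f\<^sub>1 x - f\<^sub>2 x) 0) \<in> W1p_0 p \<Omega>"
  shows "(AE x in lebesgue_on \<Omega>. u\<^sub>1 x \<le> u\<^sub>2 x) \<and>
         (\<forall>x\<in>\<Omega>. lsc_reg \<Omega> u\<^sub>1 x \<le> lsc_reg \<Omega> u\<^sub>2 x)"
proof -
  obtain P where P: "bounded_exponent p P" "AE x in lebesgue. 1 < p x"
    using log_hoelder_exponent_bounded[OF assms(1)] .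
  have "AE x in lebesgue_on \<Omega>. u\<^sub>1 x \<le> u\<^sub>2 x"
    using bounded_exponent.obstacle_comparison[OF P(1) assms(2,3) P(2) assms(13,14,15,16)] .
  with lsc_reg_mono[OF assms(2)] show ?thesis by blast
qed

end
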